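(* Let $\Omega=\mathbb{R}^2\setminus B_1$, let $\mu>0$, and let $2<p\le\infty$. Suppose that $v:\Omega\to\mathbb{R}^2$ is a smooth solution (with pressure $\pi:\Omega\to\mathbb{R}$) of the steady Navier-Stokes equations $$-\mu\Delta v+v\cdot\nabla v+\nabla\pi=0,\qquad \operatorname{div} v=0\qquad\text{in }\Omega,$$ with $\|v\|_{L^p(\Omega)}\lesssim 1$. Define $$M(R)=\inf_{|x_0|=R}\int_{B_1(x_0)}|v(y)|^2\,dy .$$ If $M(10)\neq 0$, then there exists a constant $C_0>0$ such that $$M(R)\ge \exp\left(-C_0R\log^2 R\right)$$ for all sufficiently large $R$.
   Context: $B_r(x_0)$ denotes the open ball in $\mathbb{R}^2$ of radius $r$ centered at $x_0$, and $B_1=\{x\in\mathbb{R}^2:|x|<1\}$. The notation $\|v\|_{L^p(\Omega)}\lesssim 1$ means that $\|v\|_{L^p(\Omega)}$ is bounded by a finite constant. $\log^2 R$ means $(\log R)^2$. No boundary condition on $\partial B_1$ is imposed. *)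

theory Defs
  imports "HOL-Analysis.Analysis" "HOL-Probability.Essential_Supremum"
begin

text \<open>
  All derivatives are taken within the set under consideration, so that only the values of a
  function on that set matter.  On the closed exterior domain \<open>exterior_domain\<close> below the
  derivative within the set is unique at every point, including the points of the unit circle
  (\<open>frechet_derivative_exterior_domain\<close>); at interior points it is the ordinary derivative.
\<close>

primrec Ck_on :: "nat \<Rightarrow> 'a::real_normed_vector set \<Rightarrow> ('a \<Rightarrow> 'b::real_normed_vector) \<Rightarrow> bool" where
  "Ck_on 0 S f \<longleftrightarrow> continuous_on S f"
| "Ck_on (Suc k) S f \<longleftrightarrow>
     f differentiable_on S \<and> (\<forall>h. Ck_on k S (\<lambda>x. frechet_derivative f (at x within S) h))"

definition smooth_on :: "'a::real_normed_vector set \<Rightarrow> ('a \<Rightarrow> 'b::real_normed_vector) \<Rightarrow> bool" where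
  "smooth_on S f \<longleftrightarrow> (\<forall>k. Ck_on k S f)"

definition partial_deriv ::
    "(real^'n) set \<Rightarrow> 'n::finite \<Rightarrow> (real^'n \<Rightarrow> 'b::real_normed_vector) \<Rightarrow> real^'n \<Rightarrow> 'b" where
  "partial_deriv S i f x = frechet_derivative f (at x within S) (axis i 1)"

definition laplacian ::
    "(real^'n::finite) set \<Rightarrow> (real^'n \<Rightarrow> 'b::real_normed_vector) \<Rightarrow> real^'n \<Rightarrow> 'b" where
  "laplacian S f x = (\<Sum>i\<in>UNIV. partial_deriv S i (partial_deriv S i f) x)"

definition gradient :: "(real^'n::finite) set \<Rightarrow> (real^'n \<Rightarrow> real) \<Rightarrow> real^'n \<Rightarrow> real^'n" where
  "gradient S q x = (\<chi> i. partial_deriv S i q x)"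

definition divergence :: "(real^'n::finite) set \<Rightarrow> (real^'n \<Rightarrow> real^'n) \<Rightarrow> real^'n \<Rightarrow> real" where
  "divergence S v x = (\<Sum>i\<in>UNIV. partial_deriv S i (\<lambda>y. v y $ i) x)"

definition convection :: "(real^'n::finite) set \<Rightarrow> (real^'n \<Rightarrow> real^'n) \<Rightarrow> real^'n \<Rightarrow> real^'n" where
  "convection S v x = (\<Sum>j\<in>UNIV. (v x $ j) *\<^sub>R partial_deriv S j v x)"

definition smooth_steady_NS_solution ::
    "real \<Rightarrow> (real^'n::finite) set \<Rightarrow> (real^'n \<Rightarrow> real^'n) \<Rightarrow> (real^'n \<Rightarrow> real) \<Rightarrow> bool" where
  "smooth_steady_NS_solution \<mu> S v q \<longleftrightarrow>
     smooth_on S v \<and> smooth_on S q \<and>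
     (\<forall>x\<in>S. - (\<mu> *\<^sub>R laplacian S v x) + convection S v x + gradient S q x = 0
            \<and> divergence S v x = 0)"

text \<open>
  The \<open>L\<^sup>p\<close> norm with respect to Lebesgue measure on \<open>S\<close>, as an extended nonnegative number;
  \<open>p = \<infinity>\<close> gives the essential supremum.
\<close>

definition Lp_norm ::
    "ennreal \<Rightarrow> 'a::euclidean_space set \<Rightarrow> ('a \<Rightarrow> 'b::real_normed_vector) \<Rightarrow> ennreal" where
  "Lp_norm p S f =
     (if p = \<infinity> then esssup (restrict_space lborel S) (\<lambda>x. ennreal (norm (f x)))
      else let r = enn2real p; I = \<integral>\<^sup>+x\<in>S. ennreal (norm (f x) powr r) \<partial>lborel
           in if I = \<infinity> then \<infinity> else ennreal (enn2real I powr (1 / r)))"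

definition exterior_domain :: "(real^2) set" where
  "exterior_domain = UNIV - ball 0 1"

text \<open>
  Meaningful for \<open>R \<ge> 2\<close>, when every ball involved lies in \<open>exterior_domain\<close>.
\<close>

definition min_local_energy :: "(real^2 \<Rightarrow> real^2) \<Rightarrow> real \<Rightarrow> real" where
  "min_local_energy v R = (INF x0\<in>sphere 0 R. LINT y:ball x0 1|lborel. (norm (v y))\<^sup>2)"

lemma frechet_derivative_exterior_domain:
  fixes f :: "real^2 \<Rightarrow> 'b::real_normed_vector"
  assumes x: "x \<in> exterior_domain"
    and f: "(f has_derivative f') (at x within exterior_domain)"
  shows "frechet_derivative f (at x within exterior_domain) = f'"
proof (rule frechet_derivative_unique_within)
  show "(f has_derivative frechet_derivative f (at x within exterior_domain))
          (at x within exterior_domain)"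
    using f frechet_derivative_works differentiable_def by blast
  show "(f has_derivative f') (at x within exterior_domain)" by (rule f)
next
  fix i :: "real^2" and e :: real
  assume "i \<in> Basis" "e > 0"
  define d where "d = (if x \<bullet> i \<ge> 0 then e / 2 else - (e / 2))"
  have "d * (x \<bullet> i) \<ge> 0"
    using \<open>e > 0\<close> by (auto simp: d_def intro: mult_nonneg_nonpos)
  have "(norm (x + d *\<^sub>R i))\<^sup>2 = (norm x)\<^sup>2 + 2 * (d * (x \<bullet> i)) + (norm (d *\<^sub>R i))\<^sup>2"
    by (simp only: power2_norm_eq_inner) (simp add: inner_simps inner_commute)
  then have "(norm x)\<^sup>2 \<le> (norm (x + d *\<^sub>R i))\<^sup>2"
    using \<open>d * (x \<bullet> i) \<ge> 0\<close> by simp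
  then have "norm x \<le> norm (x + d *\<^sub>R i)"
    by (rule power2_le_imp_le) simp
  then have "x + d *\<^sub>R i \<in> exterior_domain"
    using x by (simp add: exterior_domain_def)
  moreover have "0 < \<bar>d\<bar>" "\<bar>d\<bar> < e"
    using \<open>e > 0\<close> by (auto simp: d_def)
  ultimately show "\<exists>d. 0 < \<bar>d\<bar> \<and> \<bar>d\<bar> < e \<and> x + d *\<^sub>R i \<in> exterior_domain"
    by blast
qed

end

theory Submission
  imports Defs "HOL-Complex_Analysis.Conformal_Mappings" "HOL-Real_Asymp.Real_Asymp"
begin

text \<open>
  Identify the plane with the complex numbers and put \<open>f = v\<^sub>1 - \<i> v\<^sub>2\<close>.  Then \<open>div v = 0\<close> says that the
  vorticity is \<open>\<omega> = 2 \<i> \<partial>f/\<partial>cnj z\<close>, and with \<open>g = \<partial>\<omega>/\<partial>z\<close> the curl of the momentum equation becomes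
  the first order equation \<open>4 \<mu> \<partial>g/\<partial>cnj z = cnj f g + f cnj g\<close>.  Hence \<open>\<partial>g/\<partial>cnj z = a g\<close> with
  \<open>|a| \<le> |f| / (2 \<mu>)\<close>, and \<open>g\<close> is \<open>exp w\<close> times a holomorphic function, where \<open>w\<close> is the Cauchy
  transform of \<open>a\<close>.  As \<open>v\<close> is in \<open>L\<^sup>p\<close> with \<open>p > 2\<close>, \<open>w\<close> is \<open>O(R)\<close> on the annulus
  \<open>2 < |z| < 4 R\<close>, and \<open>|g(z)|\<close> is controlled by the integral of \<open>|v|\<close> over a ball around \<open>z\<close>.

  Now let \<open>|z\<^sub>0| = R\<close>.  The maximum principle on the annulus minus a disc around \<open>z\<^sub>0\<close> is applied to
  \<open>g exp(-w)\<close> times a power of order \<open>R\<close> of \<open>(z/2) ((R-2)/(z-z\<^sub>0))\<^sup>n\<close>, \<open>n\<close> of order \<open>log R\<close>; this factor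
  is at most 1 on both circles, is of size \<open>exp(O(log\<^sup>2 R))\<close> near \<open>z\<^sub>0\<close> and exceeds 1 by a fixed amount at
  a fixed point \<open>z\<^sub>1\<close> with \<open>g(z\<^sub>1) \<noteq> 0\<close>.  So \<open>v\<close> cannot be smaller than \<open>exp(-C R log\<^sup>2 R)\<close> near
  \<open>z\<^sub>0\<close>.  If \<open>g\<close> vanishes identically, \<open>\<omega>\<close> is holomorphic and takes over the role of \<open>g\<close>; if \<open>\<omega>\<close>
  vanishes as well, \<open>f\<close> is holomorphic and does.
\<close>

section \<open>Wirtinger derivatives\<close>

text \<open>The vorticity solves a second order equation whose drift is controlled only in L^p. Its
  complex derivative \<open>g\<close> solves a first order one, which has an integrating factor in
  the plane; the price is \<open>exp w\<close> with |w| = O(R), so the auxiliary factor must gain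
  exp(O(R)) at the fixed point \<open>z1\<close>. The quotient z/2 gains a fixed ratio there, hence
  the power of order R, but it has size 2R on the circle |z| = 4R. The quotient (R-2)/(z-z0) is at
  most 1 on the inner circle, at most 1/3 on the outer one and 1 - O(1/R) at \<open>z1\<close>: with
  n of order log R it pays for the outer circle and loses only O(log R / R) at \<open>z1\<close>. At
  distance 1/2 from \<open>z0\<close> it is at most 2R, so its n-th power costs exp(O(log^2 R)), and
  the power of order R turns this into exp(O(R log^2 R)). The condition p > 2 puts the conjugate
  exponent s below 2, so |u|^(-s) is locally integrable in the plane. The potential of |v| with
  kernel 1/|u| is then uniformly small on small balls, which gives the interior bound for
  \<open>g\<close>, and grows at most linearly in the radius, which gives the bound for
  \<open>w\<close>.\<close>

text \<open>
  The functions \<open>a\<close> and \<open>b\<close> are the derivatives of \<open>F\<close> with respect to \<open>z\<close> and \<open>cnj z\<close>.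
\<close>

definition wirtinger_on ::
    "complex set \<Rightarrow> (complex \<Rightarrow> complex) \<Rightarrow> (complex \<Rightarrow> complex) \<Rightarrow> (complex \<Rightarrow> complex) \<Rightarrow> bool" where
  "wirtinger_on S F a b \<longleftrightarrow>
     (\<forall>z\<in>S. (F has_derivative (\<lambda>h. a z * h + b z * cnj h)) (at z)) \<and>
     continuous_on S a \<and> continuous_on S b"

lemma wirtinger_onI:
  assumes "\<And>z. z \<in> S \<Longrightarrow> (F has_derivative (\<lambda>h. a z * h + b z * cnj h)) (at z)"
    and "continuous_on S a" "continuous_on S b"
  shows "wirtinger_on S F a b"
  using assms by (auto simp: wirtinger_on_def)

lemma wirtinger_onD:
  assumes "wirtinger_on S F a b"
  shows "z \<in> S \<Longrightarrow> (F has_derivative (\<lambda>h. a z * h + b z * cnj h)) (at z)"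
    and "continuous_on S a" "continuous_on S b"
  using assms by (auto simp: wirtinger_on_def)

lemma wirtinger_on_continuous: "wirtinger_on S F a b \<Longrightarrow> continuous_on S F"
  by (meson continuous_at_imp_continuous_on has_derivative_continuous wirtinger_onD(1))

lemma wirtinger_on_subset: "wirtinger_on S F a b \<Longrightarrow> T \<subseteq> S \<Longrightarrow> wirtinger_on T F a b"
  unfolding wirtinger_on_def by (meson continuous_on_subset subsetD)

text \<open>The maps h and cnj h are linearly independent over the complex numbers; testing at 1 and
  \<i> gives the sum and the difference of the coefficients.\<close>

lemma wirtinger_unique:
  assumes "(F has_derivative (\<lambda>h. a * h + b * cnj h)) (at z)"
    and "(F has_derivative (\<lambda>h. a' * h + b' * cnj h)) (at z)"
  shows "a = a'" "b = b'"
proof -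
  have eq: "(\<lambda>h. a * h + b * cnj h) = (\<lambda>h. a' * h + b' * cnj h)"
    using assms has_derivative_unique by blast
  have "a + b = a' + b'" using fun_cong[OF eq, of 1] by simp
  moreover have "a - b = a' - b'"
  proof -
    have "\<i> * (a - b) = \<i> * (a' - b')"
      using fun_cong[OF eq, of \<i>] by (simp add: algebra_simps)
    then show ?thesis by simp
  qed
  ultimately have "(a + b) + (a - b) = (a' + b') + (a' - b')" "(a + b) - (a - b) = (a' + b') - (a' - b')"
    by simp_all
  then have "2 * a = 2 * a'" "2 * b = 2 * b'" by (simp_all add: algebra_simps)
  then show "a = a'" "b = b'" by auto
qed

lemma wirtinger_on_unique:
  assumes "wirtinger_on S F a b" "wirtinger_on S F a' b'" "z \<in> S"
  shows "a z = a' z" "b z = b' z"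
  using wirtinger_unique[OF wirtinger_onD(1)[OF assms(1,3)] wirtinger_onD(1)[OF assms(2,3)]] by blast+

lemma wirtinger_on_transform:
  assumes "wirtinger_on S F a b" "open S"
    and "\<And>z. z \<in> S \<Longrightarrow> F z = G z" "\<And>z. z \<in> S \<Longrightarrow> a z = a' z" "\<And>z. z \<in> S \<Longrightarrow> b z = b' z"
  shows "wirtinger_on S G a' b'"
proof (rule wirtinger_onI)
  fix z assume z: "z \<in> S"
  have "(F has_derivative (\<lambda>h. a' z * h + b' z * cnj h)) (at z)"
    using wirtinger_onD(1)[OF assms(1) z] assms z by simp
  then show "(G has_derivative (\<lambda>h. a' z * h + b' z * cnj h)) (at z)"
    by (rule has_derivative_transform_within_open[OF _ assms(2) z]) (use assms in auto)
next
  show "continuous_on S a'" using continuous_on_cong[of S S a a'] assms(4) wirtinger_onD(2)[OF assms(1)] by simp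
  show "continuous_on S b'" using continuous_on_cong[of S S b b'] assms(5) wirtinger_onD(3)[OF assms(1)] by simp
qed

lemma wirtinger_on_const: "wirtinger_on S (\<lambda>z. c) (\<lambda>z. 0) (\<lambda>z. 0)"
  by (auto intro!: wirtinger_onI)

lemma wirtinger_on_id: "wirtinger_on S (\<lambda>z. z) (\<lambda>z. 1) (\<lambda>z. 0)"
  by (auto intro!: wirtinger_onI)

lemma wirtinger_on_add:
  assumes "wirtinger_on S F a b" "wirtinger_on S G p q"
  shows "wirtinger_on S (\<lambda>z. F z + G z) (\<lambda>z. a z + p z) (\<lambda>z. b z + q z)"
proof (rule wirtinger_onI)
  fix z assume "z \<in> S"
  note wirtinger_onD(1)[OF assms(1) this] wirtinger_onD(1)[OF assms(2) this]
  from has_derivative_add[OF this]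
  show "((\<lambda>z. F z + G z) has_derivative (\<lambda>h. (a z + p z) * h + (b z + q z) * cnj h)) (at z)"
    by (simp add: algebra_simps)
qed (auto intro!: continuous_intros assms[THEN wirtinger_onD(2)] assms[THEN wirtinger_onD(3)])

lemma wirtinger_on_mult:
  assumes "wirtinger_on S F a b" "wirtinger_on S G p q"
  shows "wirtinger_on S (\<lambda>z. F z * G z) (\<lambda>z. a z * G z + F z * p z) (\<lambda>z. b z * G z + F z * q z)"
proof (rule wirtinger_onI)
  fix z assume "z \<in> S"
  note wirtinger_onD(1)[OF assms(1) this] wirtinger_onD(1)[OF assms(2) this]
  from has_derivative_mult[OF this]
  show "((\<lambda>z. F z * G z) has_derivative
      (\<lambda>h. (a z * G z + F z * p z) * h + (b z * G z + F z * q z) * cnj h)) (at z)"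
    by (simp add: algebra_simps)
qed (auto intro!: continuous_intros assms[THEN wirtinger_onD(2)] assms[THEN wirtinger_onD(3)]
       assms[THEN wirtinger_on_continuous])

lemma wirtinger_on_cmult:
  assumes "wirtinger_on S F a b"
  shows "wirtinger_on S (\<lambda>z. c * F z) (\<lambda>z. c * a z) (\<lambda>z. c * b z)"
  using wirtinger_on_mult[OF wirtinger_on_const assms] by simp

lemma wirtinger_on_diff:
  assumes "wirtinger_on S F a b" "wirtinger_on S G p q"
  shows "wirtinger_on S (\<lambda>z. F z - G z) (\<lambda>z. a z - p z) (\<lambda>z. b z - q z)"
  using wirtinger_on_add[OF assms(1) wirtinger_on_cmult[OF assms(2), of "-1"]] by simp

lemma wirtinger_on_cnj:
  assumes "wirtinger_on S F a b"
  shows "wirtinger_on S (\<lambda>z. cnj (F z)) (\<lambda>z. cnj (b z)) (\<lambda>z. cnj (a z))"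
proof (rule wirtinger_onI)
  fix z assume "z \<in> S"
  from has_derivative_cnj[OF wirtinger_onD(1)[OF assms this]]
  show "((\<lambda>z. cnj (F z)) has_derivative (\<lambda>h. cnj (b z) * h + cnj (a z) * cnj h)) (at z)"
    by (simp add: algebra_simps)
qed (auto intro!: continuous_intros assms[THEN wirtinger_onD(2)] assms[THEN wirtinger_onD(3)])

lemma wirtinger_on_holomorphic_compose:
  assumes "wirtinger_on S F a b"
    and "\<And>z. z \<in> S \<Longrightarrow> (\<phi> has_field_derivative \<phi>' (F z)) (at (F z))"
    and "continuous_on S (\<lambda>z. \<phi>' (F z))"
  shows "wirtinger_on S (\<lambda>z. \<phi> (F z)) (\<lambda>z. \<phi>' (F z) * a z) (\<lambda>z. \<phi>' (F z) * b z)"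
proof (rule wirtinger_onI)
  fix z assume z: "z \<in> S"
  from has_derivative_compose[OF wirtinger_onD(1)[OF assms(1) z] assms(2)[OF z, unfolded has_field_derivative_def]]
  show "((\<lambda>z. \<phi> (F z)) has_derivative (\<lambda>h. \<phi>' (F z) * a z * h + \<phi>' (F z) * b z * cnj h)) (at z)"
    by (simp add: algebra_simps)
qed (auto intro!: continuous_intros assms(1)[THEN wirtinger_onD(2)] assms(1)[THEN wirtinger_onD(3)] assms(3))

lemma wirtinger_on_inverse:
  assumes "wirtinger_on S F a b" and "\<And>z. z \<in> S \<Longrightarrow> F z \<noteq> 0"
  shows "wirtinger_on S (\<lambda>z. inverse (F z)) (\<lambda>z. - inverse (F z ^ 2) * a z) (\<lambda>z. - inverse (F z ^ 2) * b z)"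
proof (rule wirtinger_on_holomorphic_compose[OF assms(1), where \<phi>'="\<lambda>w. - inverse (w^2)"])
  fix z assume "z \<in> S"
  then show "(inverse has_field_derivative - inverse ((F z)\<^sup>2)) (at (F z))"
    using DERIV_inverse[OF assms(2), of z UNIV] by (simp add: power2_eq_square power_inverse)
qed (use assms(2) in \<open>auto intro!: continuous_intros wirtinger_on_continuous[OF assms(1)]\<close>)

lemma wirtinger_on_imp_field_derivative:
  assumes "(F has_derivative (\<lambda>h. a * h + b * cnj h)) (at z)" "b = 0"
  shows "(F has_field_derivative a) (at z)"
  using assms by (simp add: has_field_derivative_def)

text \<open>Cut-offs are differentiated only a few times, so truncated powers serve as bump
  functions: the n-th one is n - 1 times continuously differentiable, and each derivative is again a
  multiple of a truncated power.\<close>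

definition pos_pow :: "nat \<Rightarrow> complex \<Rightarrow> complex" where
  "pos_pow n w = of_real (max 0 (Re w) ^ n)"

lemma has_derivative_max_pow:
  fixes t :: real
  assumes "n \<ge> 2"
  shows "((\<lambda>t. max 0 t ^ n) has_real_derivative (real n * max 0 t ^ (n - 1))) (at t)"
proof -
  consider "t > 0" | "t < 0" | "t = 0" by linarith
  then show ?thesis
  proof cases
    case 1
    have "((\<lambda>t. t ^ n) has_real_derivative (real n * t ^ (n - 1))) (at t)"
      by (auto intro!: derivative_eq_intros)
    then show ?thesis using 1
      by (subst DERIV_cong_ev[OF refl _ refl, where g="\<lambda>t. t ^ n"])
         (auto intro!: eventually_mono[OF eventually_gt_at_top] eventually_nhds_in_open[of "{0<..}", THEN eventually_mono])
  next
    case 2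
    have "((\<lambda>t. 0) has_real_derivative 0) (at t)" by simp
    moreover have "max 0 t ^ (n - 1) = 0" using 2 assms by simp
    ultimately show ?thesis using 2 assms
      by (simp only: mult_zero_right, subst DERIV_cong_ev[OF refl _ refl, where g="\<lambda>t. 0"])
         (auto intro!: eventually_nhds_in_open[of "{..<0}", THEN eventually_mono])
  next
    case 3
    \<comment> \<open>At the corner the difference quotient is at most |h|^(n-1), which tends to 0
      because n is at least 2.\<close>
    have "((\<lambda>h::real. max 0 h ^ n / h) \<longlongrightarrow> 0) (at 0)"
    proof (rule Lim_null_comparison)
      have "norm (max 0 h ^ n / h) \<le> \<bar>h\<bar> ^ (n - 1)" for h :: real
      proof (cases "h > 0")
        case True
        then have "h ^ n = h ^ (n - 1) * h" using assms
          by (metis Suc_diff_1 Suc_1 Suc_le_lessD gr0I not_less_zero power_Suc2)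
        then show ?thesis using True by simp
      next
        case False
        then have "max 0 h = 0" by simp
        then show ?thesis using assms by (simp add: power_0_left)
      qed
      then show "\<forall>\<^sub>F h in at 0. norm (max 0 h ^ n / h) \<le> \<bar>h\<bar> ^ (n - 1)" by simp
      have "((\<lambda>h::real. \<bar>h\<bar> ^ (n - 1)) \<longlongrightarrow> \<bar>0\<bar> ^ (n - 1)) (at 0)"
        by (intro tendsto_intros)
      then show "((\<lambda>h::real. \<bar>h\<bar> ^ (n - 1)) \<longlongrightarrow> 0) (at 0)"
        using assms by (simp add: power_0_left)
    qed
    then show ?thesis using 3 assms by (simp add: DERIV_def power_0_left)
  qed
qed

text \<open>\<open>pos_pow n\<close> is not holomorphic; it sees only the real part of F, whose
  Wirtinger derivatives are (a + cnj b)/2 and (b + cnj a)/2. For real F these are a and b.\<close>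

lemma wirtinger_on_pos_pow:
  assumes "wirtinger_on S F a b" "n \<ge> 2"
  shows "wirtinger_on S (\<lambda>z. pos_pow n (F z))
           (\<lambda>z. of_nat n * pos_pow (n - 1) (F z) * ((a z + cnj (b z)) / 2))
           (\<lambda>z. of_nat n * pos_pow (n - 1) (F z) * ((b z + cnj (a z)) / 2))"
proof (rule wirtinger_onI)
  fix z assume z: "z \<in> S"
  have "((\<lambda>z. Re (F z)) has_derivative (\<lambda>h. Re (a z * h + b z * cnj h))) (at z)"
    by (rule has_derivative_Re[OF wirtinger_onD(1)[OF assms(1) z]])
  from has_derivative_compose[OF this has_derivative_max_pow[OF assms(2), unfolded has_field_derivative_def]]
  have "((\<lambda>z. max 0 (Re (F z)) ^ n) has_derivative
      (\<lambda>h. real n * max 0 (Re (F z)) ^ (n - 1) * Re (a z * h + b z * cnj h))) (at z)" .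
  from has_derivative_of_real[OF this]
  have "((\<lambda>z. pos_pow n (F z)) has_derivative
      (\<lambda>h. complex_of_real (real n * max 0 (Re (F z)) ^ (n - 1) * Re (a z * h + b z * cnj h)))) (at z)"
    by (simp add: pos_pow_def)
  moreover have "complex_of_real (real n * max 0 (Re (F z)) ^ (n - 1) * Re (a z * h + b z * cnj h))
     = of_nat n * pos_pow (n - 1) (F z) * ((a z + cnj (b z)) / 2) * h
        + of_nat n * pos_pow (n - 1) (F z) * ((b z + cnj (a z)) / 2) * cnj h" for h
  proof -
    have "complex_of_real (Re (a z * h + b z * cnj h)) =
        (a z + cnj (b z)) / 2 * h + (b z + cnj (a z)) / 2 * cnj h"
      by (simp add: complex_eq_iff field_simps)
    then show ?thesis
      by (simp only: of_real_mult pos_pow_def of_real_of_nat_eq) (simp add: algebra_simps)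
  qed
  ultimately show "((\<lambda>z. pos_pow n (F z)) has_derivative
     (\<lambda>h. of_nat n * pos_pow (n - 1) (F z) * ((a z + cnj (b z)) / 2) * h
        + of_nat n * pos_pow (n - 1) (F z) * ((b z + cnj (a z)) / 2) * cnj h)) (at z)"
    by simp
qed (auto intro!: continuous_intros assms(1)[THEN wirtinger_onD(2)] assms(1)[THEN wirtinger_onD(3)]
       wirtinger_on_continuous[OF assms(1)] simp: pos_pow_def)

lemma wirtinger_on_cnj_id: "wirtinger_on S cnj (\<lambda>z. 0) (\<lambda>z. 1)"
  using wirtinger_on_cnj[OF wirtinger_on_id] by simp

lemma wirtinger_on_normsq:
  assumes "wirtinger_on S F a b"
  shows "wirtinger_on S (\<lambda>z. of_real ((cmod (F z))\<^sup>2))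
    (\<lambda>z. a z * cnj (F z) + F z * cnj (b z)) (\<lambda>z. b z * cnj (F z) + F z * cnj (a z))"
  using wirtinger_on_mult[OF assms wirtinger_on_cnj[OF assms]]
  by (simp add: complex_norm_square del: of_real_power)

section \<open>Cut-offs and extension by zero\<close>

lemma continuous_on_extend_zero:
  fixes F :: "complex \<Rightarrow> complex"
  assumes "open S" "closed K" "K \<subseteq> S" "continuous_on S F" "\<And>z. z \<notin> K \<Longrightarrow> F z = 0"
  shows "continuous_on UNIV F"
proof -
  have "continuous_on (- K) F \<longleftrightarrow> continuous_on (- K) (\<lambda>_. 0::complex)"
    by (rule continuous_on_cong) (auto simp: assms(5))
  then have "continuous_on (- K) F" by simp
  then have "continuous_on (S \<union> - K) F"
    using assms by (intro continuous_on_open_Un) auto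
  moreover have "S \<union> - K = UNIV" using assms(3) by auto
  ultimately show ?thesis by simp
qed

lemma wirtinger_zero_off_support:
  assumes "wirtinger_on S F a b" "open S" "closed K" "\<And>z. z \<notin> K \<Longrightarrow> F z = 0" "z \<in> S" "z \<notin> K"
  shows "a z = 0" "b z = 0"
proof -
  have "((\<lambda>_. 0) has_derivative (\<lambda>h. 0 * h + 0 * cnj h)) (at z)" by simp
  then have "(F has_derivative (\<lambda>h. 0 * h + 0 * cnj h)) (at z)"
    by (rule has_derivative_transform_within_open[of _ _ _ _ "- K"]) (use assms in auto)
  then show "a z = 0" "b z = 0"
    using wirtinger_unique[OF wirtinger_onD(1)[OF assms(1,5)]] by blast+
qed

text \<open>F may be arbitrary off S: the product vanishes near every point outside S. The four
  products are shown continuous separately because integration by parts needs each of them to be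
  integrable.\<close>

lemma wirtinger_on_cutoff:
  assumes F: "wirtinger_on S F a b" and G: "wirtinger_on UNIV G p q"
    and "open S" "closed K" "K \<subseteq> S" and G0: "\<And>z. z \<notin> K \<Longrightarrow> G z = 0"
  shows "wirtinger_on UNIV (\<lambda>z. F z * G z) (\<lambda>z. a z * G z + F z * p z) (\<lambda>z. b z * G z + F z * q z)"
    and "continuous_on UNIV (\<lambda>z. a z * G z)" "continuous_on UNIV (\<lambda>z. F z * p z)"
    and "continuous_on UNIV (\<lambda>z. b z * G z)" "continuous_on UNIV (\<lambda>z. F z * q z)"
    and "\<And>z. z \<notin> K \<Longrightarrow> p z = 0" "\<And>z. z \<notin> K \<Longrightarrow> q z = 0"
proof -
  show p0: "\<And>z. z \<notin> K \<Longrightarrow> p z = 0" and q0: "\<And>z. z \<notin> K \<Longrightarrow> q z = 0"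
    using wirtinger_zero_off_support[OF G open_UNIV \<open>closed K\<close> G0 UNIV_I] by blast+
  have GS: "wirtinger_on S G p q" by (rule wirtinger_on_subset[OF G subset_UNIV])
  note ext = continuous_on_extend_zero[OF \<open>open S\<close> \<open>closed K\<close> \<open>K \<subseteq> S\<close>]
  note cont = wirtinger_onD(2,3)[OF F] wirtinger_onD(2,3)[OF GS] wirtinger_on_continuous[OF F] wirtinger_on_continuous[OF GS]
  show c: "continuous_on UNIV (\<lambda>z. a z * G z)" "continuous_on UNIV (\<lambda>z. F z * p z)"
    "continuous_on UNIV (\<lambda>z. b z * G z)" "continuous_on UNIV (\<lambda>z. F z * q z)"
    by (rule ext, intro continuous_on_mult cont, simp add: G0 p0 q0)+
  show "wirtinger_on UNIV (\<lambda>z. F z * G z) (\<lambda>z. a z * G z + F z * p z) (\<lambda>z. b z * G z + F z * q z)"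
  proof (rule wirtinger_onI)
    fix z :: complex
    show "((\<lambda>z. F z * G z) has_derivative
      (\<lambda>h. (a z * G z + F z * p z) * h + (b z * G z + F z * q z) * cnj h)) (at z)"
    proof (cases "z \<in> S")
      case True
      then show ?thesis by (rule wirtinger_onD(1)[OF wirtinger_on_mult[OF F GS]])
    next
      case False
      then have z: "z \<notin> K" using assms by auto
      have "((\<lambda>_. 0) has_derivative (\<lambda>h. 0)) (at z)" by simp
      then have "((\<lambda>z. F z * G z) has_derivative (\<lambda>h. 0)) (at z)"
        by (rule has_derivative_transform_within_open[of _ _ _ _ "- K"]) (use assms z in auto)
      then show ?thesis using z by (simp add: G0 p0 q0)
    qed
  qed (auto intro!: continuous_intros c)
qed

section \<open>Integration by parts and convolutions\<close>

text \<open>Dyadic decomposition. Where r/2^(n+1) \<le> |u| < r/2^n the integrand is at most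
  (r/2^(n+1))^(-s); bounding the annulus by the whole ball gives a geometric series of ratio
  2^(s-2), which converges because s < 2.\<close>

lemma nn_integral_ball_powr:
  fixes s :: real
  assumes "0 \<le> s" "s < 2"
  obtains C where "C \<ge> 0"
    "\<And>r. r > 0 \<Longrightarrow> (\<integral>\<^sup>+u. ennreal (cmod u powr (- s)) * indicator (ball 0 r) u \<partial>lborel) \<le> ennreal (C * r powr (2 - s))"
proof -
  define x where "x = 2 powr (s - 2)"
  have x: "0 < x" "x < 1" using assms by (auto simp: x_def powr_less_one)
  define C where "C = pi * 2 powr s / (1 - x)"
  have "C \<ge> 0" using x by (simp add: C_def)
  moreover have "(\<integral>\<^sup>+u. ennreal (cmod u powr (- s)) * indicator (ball 0 r) u \<partial>lborel) \<le> ennreal (C * r powr (2 - s))"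
    if r: "r > 0" for r
  proof -
    let ?t = "\<lambda>n u. ennreal ((r / 2 ^ Suc n) powr (- s)) * indicator (ball (0::complex) (r / 2 ^ n)) u"
    have pointwise: "ennreal (cmod u powr (- s)) * indicator (ball 0 r) u \<le> (\<Sum>n. ?t n u)" for u
    proof (cases "u \<noteq> 0 \<and> u \<in> ball 0 r")
      case True
      then have "0 < cmod u" "cmod u < r" by auto
      have "\<exists>n. r / 2 ^ Suc n \<le> cmod u"
      proof -
        obtain n where "(1/2) ^ n < cmod u / r"
          using real_arch_pow_inv[of "cmod u / r" "1/2"] \<open>0 < cmod u\<close> r by auto
        then have "r / 2 ^ n < cmod u" using r by (simp add: field_simps power_divide)
        moreover have "r / 2 ^ Suc n \<le> r / 2 ^ n" using r by (simp add: field_simps)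
        ultimately show ?thesis by (intro exI[of _ n]) linarith
      qed
      define n where "n = (LEAST n. r / 2 ^ Suc n \<le> cmod u)"
      have n1: "r / 2 ^ Suc n \<le> cmod u" unfolding n_def by (rule LeastI_ex) fact
      have n2: "cmod u < r / 2 ^ n"
      proof (cases n)
        case 0 then show ?thesis using \<open>cmod u < r\<close> by simp
      next
        case (Suc m)
        then have "\<not> r / 2 ^ Suc m \<le> cmod u" using not_less_Least[of m "\<lambda>n. r / 2 ^ Suc n \<le> cmod u"] n_def by simp
        then show ?thesis using Suc by simp
      qed
      have "cmod u powr (- s) \<le> (r / 2 ^ Suc n) powr (- s)"
        using n1 r assms by (intro powr_mono2') auto
      then have "ennreal (cmod u powr (- s)) * indicator (ball 0 r) u \<le> ?t n u"
        using n2 True by (simp add: ennreal_leI)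
      also have "\<dots> = (\<Sum>n\<in>{n}. ?t n u)" by (simp only: sum.insert sum.empty finite.emptyI empty_iff not_False_eq_True add_0_right)
      also have "\<dots> \<le> (\<Sum>n. ?t n u)" by (rule sum_le_suminf) auto
      finally show ?thesis .
    qed auto
    have "(\<integral>\<^sup>+u. ennreal (cmod u powr (- s)) * indicator (ball 0 r) u \<partial>lborel) \<le> (\<integral>\<^sup>+u. (\<Sum>n. ?t n u) \<partial>lborel)"
      by (rule nn_integral_mono) (rule pointwise)
    also have "\<dots> = (\<Sum>n. \<integral>\<^sup>+u. ?t n u \<partial>lborel)"
      by (rule nn_integral_suminf) (intro borel_measurable_times_ennreal borel_measurable_const borel_measurable_indicator, simp)
    also have "\<dots> = (\<Sum>n. ennreal ((pi * 2 powr s * r powr (2 - s)) * x ^ n))"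
    proof (rule suminf_cong)
      fix n
      have "(\<integral>\<^sup>+u. ?t n u \<partial>lborel) = ennreal ((r / 2 ^ Suc n) powr (- s)) * emeasure lborel (ball (0::complex) (r / 2 ^ n))"
        by (rule nn_integral_cmult_indicator) simp
      also have "\<dots> = ennreal ((r / 2 ^ Suc n) powr (- s) * (pi * (r / 2 ^ n)\<^sup>2))"
        using r by (simp add: emeasure_ball unit_ball_vol_2 ennreal_mult)
      also have "(r / 2 ^ Suc n) powr (- s) * (pi * (r / 2 ^ n)\<^sup>2) = (pi * 2 powr s * r powr (2 - s)) * x ^ n"
      proof -
        have "(2::real) ^ Suc n = 2 powr (real n + 1)" by (simp add: powr_add powr_realpow)
        then have "r / 2 ^ Suc n = r * 2 powr (- (real n + 1))" by (simp only: powr_minus divide_inverse)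
        then have e1: "(r / 2 ^ Suc n) powr (- s) = r powr (- s) * 2 powr (s * (real n + 1))"
          using r by (simp add: powr_mult powr_powr algebra_simps)
        have "(2::real) ^ n = 2 powr real n" by (simp add: powr_realpow)
        then have eq: "r / 2 ^ n = r * 2 powr (- real n)" by (simp only: powr_minus divide_inverse)
        have e2: "(r / 2 ^ n)\<^sup>2 = r powr 2 * 2 powr (- 2 * real n)"
        proof -
          have "(2 powr (- real n))\<^sup>2 = 2 powr (- 2 * real n)"
            unfolding power2_eq_square powr_add[symmetric] by simp
          then show ?thesis unfolding eq power_mult_distrib using r by simp
        qed
        have e3: "x ^ n = 2 powr ((s - 2) * real n)"
          unfolding x_def powr_powr[symmetric] by (simp add: powr_realpow)
        have a1: "2 powr (s * (real n + 1)) * 2 powr (- 2 * real n) = 2 powr s * 2 powr ((s - 2) * real n)"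
          unfolding powr_add[symmetric] by (rule arg_cong[of _ _ "(powr) 2"]) (simp add: algebra_simps)
        have a2: "r powr (- s) * r powr 2 = r powr (2 - s)" unfolding powr_add[symmetric] by simp
        have "(r / 2 ^ Suc n) powr (- s) * (pi * (r / 2 ^ n)\<^sup>2)
            = pi * (r powr (- s) * r powr 2) * (2 powr (s * (real n + 1)) * 2 powr (- 2 * real n))"
          unfolding e1 e2 by (simp only: mult_ac)
        also have "\<dots> = (pi * 2 powr s * r powr (2 - s)) * x ^ n"
          unfolding a1 a2 e3 by (simp only: mult_ac)
        finally show ?thesis .
      qed
      finally show "(\<integral>\<^sup>+u. ?t n u \<partial>lborel) = ennreal ((pi * 2 powr s * r powr (2 - s)) * x ^ n)" .
    qed
    also have "\<dots> = ennreal (C * r powr (2 - s))"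
    proof (rule suminf_ennreal_eq)
      show "(\<lambda>n. pi * 2 powr s * r powr (2 - s) * x ^ n) sums (C * r powr (2 - s))"
        using sums_mult[OF geometric_sums[of x], of "pi * 2 powr s * r powr (2 - s)"] x
        by (simp add: C_def field_simps)
    qed (use x in auto)
    finally show ?thesis .
  qed
  ultimately show thesis by (rule that)
qed

lemma norm_integral_le:
  fixes f :: "'a \<Rightarrow> 'b::{banach, second_countable_topology}"
  assumes "integrable M f" "integrable M g" "\<And>x. norm (f x) \<le> g x"
  shows "norm (integral\<^sup>L M f) \<le> integral\<^sup>L M g"
  by (rule order_trans[OF integral_norm_bound integral_mono]) (use assms in auto)

lemma set_integrable_inverse_ball: "set_integrable lborel (ball 0 r) (\<lambda>u::complex. 1 / u)"
proof (cases "r > 0")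
  case True
  obtain C where C: "C \<ge> 0"
    "\<And>r. r > 0 \<Longrightarrow> (\<integral>\<^sup>+u. ennreal (cmod u powr (- 1)) * indicator (ball 0 r) u \<partial>lborel) \<le> ennreal (C * r powr (2 - 1))"
    using nn_integral_ball_powr[of 1] by auto
  show ?thesis unfolding set_integrable_def
  proof (rule integrableI_bounded)
    have "(\<integral>\<^sup>+ x. ennreal (norm (indicat_real (ball 0 r) (x::complex) *\<^sub>R (1 / x))) \<partial>lborel)
      = (\<integral>\<^sup>+u. ennreal (cmod u powr (- 1)) * indicator (ball 0 r) u \<partial>lborel)"
      by (rule nn_integral_cong) (auto simp: indicator_def powr_minus norm_divide field_simps powr_one')
    also have "\<dots> < \<infinity>" using C(2)[OF True] by (auto simp: order.strict_trans1)
    finally show "(\<integral>\<^sup>+ x. ennreal (norm (indicat_real (ball 0 r) (x::complex) *\<^sub>R (1 / x))) \<partial>lborel) < \<infinity>" .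
    show "(\<lambda>x::complex. indicat_real (ball 0 r) x *\<^sub>R (1 / x)) \<in> borel_measurable lborel"
      by (intro borel_measurable_scaleR borel_measurable_indicator) (simp_all add: divide_inverse)
  qed
qed (simp add: set_integrable_def ball_empty)

lemma lborel_distr_reflect: "distr lborel borel (\<lambda>x::'a::euclidean_space. z - x) = lborel"
  using lborel_affine[of "-1" z] by (simp add: density_1)

lemma integral_reflect:
  fixes F :: "complex \<Rightarrow> complex"
  assumes "F \<in> borel_measurable borel"
  shows "(LBINT x. F (z - x)) = integral\<^sup>L lborel F"
  using integral_distr[of "\<lambda>x. z - x" lborel borel F] assms
  by (simp add: lborel_distr_reflect)

lemma compact_support_bounded:
  fixes g :: "complex \<Rightarrow> complex"
  assumes "continuous_on UNIV g" "\<And>z. z \<notin> cball 0 M \<Longrightarrow> g z = 0"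
  obtains B where "B \<ge> 0" "\<And>z. cmod (g z) \<le> B"
proof -
  have "bounded (g ` cball 0 M)"
    by (intro compact_imp_bounded compact_continuous_image continuous_on_subset[OF assms(1)]) auto
  then obtain B where B: "B > 0" "\<And>z. z \<in> cball 0 M \<Longrightarrow> cmod (g z) \<le> B"
    unfolding bounded_pos by auto
  then have "cmod (g z) \<le> B" for z
    using assms(2)[of z] by (cases "z \<in> cball 0 M") auto
  then show thesis using that[of B] B by auto
qed

lemma integrable_compact_support:
  fixes g :: "complex \<Rightarrow> complex"
  assumes "continuous_on UNIV g" "\<And>z. z \<notin> K \<Longrightarrow> g z = 0" "compact K"
  shows "integrable lborel g"
proof -
  have "integrable lborel (\<lambda>x. indicator K x *\<^sub>R g x)"
    by (rule borel_integrable_compact[OF assms(3) continuous_on_subset[OF assms(1)]]) auto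
  moreover have "(\<lambda>x. indicator K x *\<^sub>R g x) = g" using assms(2) by (auto simp: indicator_def)
  ultimately show ?thesis by simp
qed

text \<open>The support of g confines u to a ball around 0, where k is integrable; this admits the
  kernel 1/u.\<close>

lemma integrable_convolution:
  fixes g k :: "complex \<Rightarrow> complex"
  assumes "continuous_on UNIV g" "\<And>z. z \<notin> cball 0 M \<Longrightarrow> g z = 0"
    and k: "\<And>r. set_integrable lborel (ball 0 r) k" and [measurable]: "k \<in> borel_measurable borel"
  shows "integrable lborel (\<lambda>u. g (z - u) * k u)"
proof -
  obtain B where B: "B \<ge> 0" "\<And>z. cmod (g z) \<le> B"
    using compact_support_bounded[OF assms(1,2)] by blast
  have [measurable]: "g \<in> borel_measurable borel" by (rule borel_measurable_continuous_onI[OF assms(1)])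
  define r where "r = cmod z + M + 1"
  have int: "integrable lborel (\<lambda>u. B * norm (indicat_real (ball 0 r) u *\<^sub>R k u))"
    using k[of r] unfolding set_integrable_def by (intro integrable_mult_right integrable_norm)
  show ?thesis
  proof (rule Bochner_Integration.integrable_bound[OF int])
    have "norm (g (z - u) * k u) \<le> norm (B * norm (indicat_real (ball 0 r) u *\<^sub>R k u))" for u
    proof (cases "u \<in> ball 0 r")
      case True
      then show ?thesis using B by (auto simp: norm_mult abs_mult intro!: mult_right_mono)
    next
      case False
      have "cmod u \<le> cmod (z - u) + cmod z" using norm_triangle_sub[of u z] by (simp add: norm_minus_commute)
      then have "z - u \<notin> cball 0 M" using False by (auto simp: r_def)
      then show ?thesis using assms(2) by simp
    qed
    then show "AE u in lborel. norm (g (z - u) * k u) \<le> norm (B * norm (indicat_real (ball 0 r) u *\<^sub>R k u))"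
      by simp
  qed simp
qed

text \<open>All derivatives fall on F, so local integrability of the kernel suffices. Uniform
  continuity of a and b on a compact ball makes the first order remainder of F uniformly o(|h|), and
  this is integrated against |k|.\<close>

lemma has_derivative_convolution:
  fixes F k :: "complex \<Rightarrow> complex"
  assumes F: "wirtinger_on UNIV F a b" and F0: "\<And>z. z \<notin> cball 0 M \<Longrightarrow> F z = 0"
    and k: "\<And>r. set_integrable lborel (ball 0 r) k" and km: "k \<in> borel_measurable borel"
  shows "((\<lambda>z. (LBINT u. F (z - u) * k u)) has_derivative
     (\<lambda>h. (LBINT u. a (z - u) * k u) * h + (LBINT u. b (z - u) * k u) * cnj h)) (at z)"
proof -
  have a0: "\<And>z. z \<notin> cball 0 M \<Longrightarrow> a z = 0" and b0: "\<And>z. z \<notin> cball 0 M \<Longrightarrow> b z = 0"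
    using wirtinger_zero_off_support[OF F open_UNIV closed_cball F0 UNIV_I] by blast+
  have iF: "integrable lborel (\<lambda>u. F (z - u) * k u)" for z
    by (rule integrable_convolution[OF wirtinger_on_continuous[OF F] _ k km]) (rule F0)
  have ia: "integrable lborel (\<lambda>u. a (z - u) * k u)" for z
    by (rule integrable_convolution[OF wirtinger_onD(2)[OF F] _ k km]) (rule a0)
  have ib: "integrable lborel (\<lambda>u. b (z - u) * k u)" for z
    by (rule integrable_convolution[OF wirtinger_onD(3)[OF F] _ k km]) (rule b0)
  define r where "r = cmod z + M + 2"
  have kr: "integrable lborel (\<lambda>u. norm (indicat_real (ball 0 r) u *\<^sub>R k u))"
    using k[of r] unfolding set_integrable_def by (rule integrable_norm)
  define C where "C = (LBINT u. norm (indicat_real (ball 0 r) u *\<^sub>R k u))"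
  have "C \<ge> 0" unfolding C_def by simp
  show ?thesis unfolding has_derivative_at_alt
  proof (intro conjI allI impI)
    show "bounded_linear (\<lambda>h. (LBINT u. a (z - u) * k u) * h + (LBINT u. b (z - u) * k u) * cnj h)"
      by (intro bounded_linear_add bounded_linear_mult_right
           bounded_linear_compose[OF bounded_linear_mult_right bounded_linear_cnj])
    fix e :: real assume "e > 0"
    \<comment> \<open>The 2 counts the two Wirtinger derivatives; C + 1 guards against C =
      0.\<close>
    define e' where "e' = e / (2 * (C + 1))"
    have "e' > 0" using \<open>e > 0\<close> \<open>C \<ge> 0\<close> by (simp add: e'_def)
    have "uniformly_continuous_on (cball 0 (M + 2)) a" "uniformly_continuous_on (cball 0 (M + 2)) b"
      by (auto intro!: compact_uniformly_continuous continuous_on_subset[OF wirtinger_onD(2)[OF F]]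
           continuous_on_subset[OF wirtinger_onD(3)[OF F]])
    note uc = this[unfolded uniformly_continuous_on_def, rule_format, OF \<open>e' > 0\<close>]
    from uc(1) obtain d1 where d1: "d1 > 0"
      "\<And>x y. \<lbrakk>x \<in> cball 0 (M + 2); y \<in> cball 0 (M + 2); dist x y < d1\<rbrakk> \<Longrightarrow> dist (a x) (a y) < e'"
      by (metis dist_commute)
    from uc(2) obtain d2 where d2: "d2 > 0"
      "\<And>x y. \<lbrakk>x \<in> cball 0 (M + 2); y \<in> cball 0 (M + 2); dist x y < d2\<rbrakk> \<Longrightarrow> dist (b x) (b y) < e'"
      by (metis dist_commute)
    note d = d1(1) d2(1) d1(2) d2(2)
    define d where "d = min 1 (min d1 d2)"
    have "d > 0" using d by (simp add: d_def)
    have lin: "cmod (F (y + h) - F y - (a y * h + b y * cnj h)) \<le> cmod h * (2 * e')"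
      if h: "cmod h < d" and y: "cmod y \<le> M + 1" for y h
    proof -
      let ?L = "\<lambda>x h. a x * h + b x * cnj h"
      have "norm (F (y + h) - F y - ?L y ((y + h) - y)) \<le> norm ((y + h) - y) * (2 * e')"
      proof (rule differentiable_bound_linearization[where S="ball y d" and f'="?L" and ?x0.0=y])
        fix t :: real assume "t \<in> {0..1}"
        then have "t * cmod h \<le> cmod h" by (auto intro!: mult_left_le_one_le)
        then show "y + t *\<^sub>R (y + h - y) \<in> ball y d"
          using h \<open>t \<in> {0..1}\<close> by (simp add: dist_norm)
      next
        fix x assume x: "x \<in> ball y d"
        show "(F has_derivative ?L x) (at x within ball y d)"
          by (rule has_derivative_at_withinI[OF wirtinger_onD(1)[OF F]]) simp
        have "cmod x \<le> M + 2" using x y norm_triangle_sub[of x y] by (auto simp: d_def dist_norm norm_minus_commute)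
        then have ab: "cmod (a x - a y) \<le> e'" "cmod (b x - b y) \<le> e'"
          using d(3)[of x y] d(4)[of x y] x y by (auto simp: d_def dist_norm norm_minus_commute less_imp_le)
        show "onorm (?L x - ?L y) \<le> 2 * e'"
        proof (rule onorm_bound)
          fix h
          have "norm ((?L x - ?L y) h) = cmod ((a x - a y) * h + (b x - b y) * cnj h)"
            by (simp add: algebra_simps)
          also have "\<dots> \<le> cmod (a x - a y) * cmod h + cmod (b x - b y) * cmod h"
            by (metis norm_triangle_ineq norm_mult complex_mod_cnj)
          also have "\<dots> \<le> e' * cmod h + e' * cmod h"
            using ab by (intro add_mono mult_right_mono) auto
          finally show "norm ((?L x - ?L y) h) \<le> 2 * e' * norm h" by simp
        qed (use \<open>e' > 0\<close> in auto)
      qed (use \<open>d > 0\<close> in auto)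
      then show ?thesis by simp
    qed
    show "\<exists>d>0. \<forall>y. cmod (y - z) < d \<longrightarrow>
      cmod ((LBINT u. F (y - u) * k u) - (LBINT u. F (z - u) * k u) -
        ((LBINT u. a (z - u) * k u) * (y - z) + (LBINT u. b (z - u) * k u) * cnj (y - z)))
      \<le> e * cmod (y - z)"
    proof (intro exI[of _ d] conjI allI impI \<open>d > 0\<close>)
      fix y assume yz: "cmod (y - z) < d"
      define h where "h = y - z"
      have y: "y = z + h" by (simp add: h_def)
      let ?R = "\<lambda>u. (F (y - u) - F (z - u) - (a (z - u) * h + b (z - u) * cnj h)) * k u"
      have "(LBINT u. F (y - u) * k u) - (LBINT u. F (z - u) * k u) -
        ((LBINT u. a (z - u) * k u) * h + (LBINT u. b (z - u) * k u) * cnj h)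
        = (LBINT u. F (y - u) * k u - F (z - u) * k u -
           (a (z - u) * k u * h + b (z - u) * k u * cnj h))"
        using iF ia ib by simp
      also have "\<dots> = integral\<^sup>L lborel ?R" by (intro Bochner_Integration.integral_cong) (auto simp: algebra_simps)
      finally have eq: "(LBINT u. F (y - u) * k u) - (LBINT u. F (z - u) * k u) -
        ((LBINT u. a (z - u) * k u) * h + (LBINT u. b (z - u) * k u) * cnj h)
        = integral\<^sup>L lborel ?R" .
      have "norm (integral\<^sup>L lborel ?R) \<le> (LBINT u. cmod h * (2 * e') * norm (indicat_real (ball 0 r) u *\<^sub>R k u))"
      proof (rule norm_integral_le)
        have "integrable lborel (\<lambda>u. F (y - u) * k u - F (z - u) * k u -
           (a (z - u) * k u * h + b (z - u) * k u * cnj h))"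
          using iF ia ib by simp
        then show "integrable lborel ?R" by (simp add: algebra_simps)
        show "integrable lborel (\<lambda>u. cmod h * (2 * e') * norm (indicat_real (ball 0 r) u *\<^sub>R k u))"
          using kr by simp
        fix u
        show "norm (?R u) \<le> cmod h * (2 * e') * norm (indicat_real (ball 0 r) u *\<^sub>R k u)"
        proof (cases "cmod (z - u) \<le> M + 1")
          case True
          have "cmod u \<le> cmod z + cmod (z - u)" using norm_triangle_sub[of u z] by (simp add: norm_minus_commute)
          then have "u \<in> ball 0 r" using True by (simp add: r_def)
          moreover have "cmod (F (y - u) - F (z - u) - (a (z - u) * h + b (z - u) * cnj h)) \<le> cmod h * (2 * e')"
            using lin[of h "z - u"] yz True by (simp add: y algebra_simps)
          ultimately show ?thesis by (auto simp: norm_mult intro!: mult_right_mono)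
        next
          case False
          have "cmod (z - u) \<le> cmod (y - u) + cmod (y - z)"
            using norm_triangle_ineq4[of "y - u" "y - z"] by simp
          then have "cmod (y - u) > M" using False yz by (simp add: d_def)
          then have "F (y - u) = 0" "F (z - u) = 0" "a (z - u) = 0" "b (z - u) = 0"
            using False by (auto intro!: F0 a0 b0)
          then show ?thesis using \<open>e' > 0\<close> by simp
        qed
      qed
      also have "\<dots> = cmod h * (2 * e' * C)" by (simp add: C_def)
      also have "\<dots> \<le> cmod h * e"
      proof (rule mult_left_mono)
        have "2 * e' * C = e * (C / (C + 1))" using \<open>C \<ge> 0\<close> by (simp add: e'_def field_simps)
        also have "\<dots> \<le> e * 1" using \<open>C \<ge> 0\<close> \<open>e > 0\<close> by (intro mult_left_mono) auto
        finally show "2 * e' * C \<le> e" by simp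
      qed simp
      finally show "cmod ((LBINT u. F (y - u) * k u) - (LBINT u. F (z - u) * k u) -
        ((LBINT u. a (z - u) * k u) * (y - z) + (LBINT u. b (z - u) * k u) * cnj (y - z)))
      \<le> e * cmod (y - z)"
        using eq by (simp add: h_def mult.commute)
    qed
  qed
qed

text \<open>Substitute for Stokes' theorem: the convolution of F with the kernel 1 is constant by
  translation invariance, and its Wirtinger derivatives are the integrals of a and b.\<close>

lemma integral_wirtinger_zero:
  assumes F: "wirtinger_on UNIV F a b" and F0: "\<And>z. z \<notin> K \<Longrightarrow> F z = 0" and K: "compact K"
  shows "integral\<^sup>L lborel a = 0" "integral\<^sup>L lborel b = 0"
proof -
  obtain M where "\<And>z. z \<in> K \<Longrightarrow> cmod z \<le> M"
    using compact_imp_bounded[OF K] unfolding bounded_iff by blast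
  then have F0': "\<And>z. z \<notin> cball 0 M \<Longrightarrow> F z = 0" using F0 by auto
  have [measurable]: "F \<in> borel_measurable borel" "a \<in> borel_measurable borel" "b \<in> borel_measurable borel"
    using wirtinger_on_continuous[OF F] wirtinger_onD(2,3)[OF F] by (auto intro: borel_measurable_continuous_onI)
  have one: "set_integrable lborel (ball 0 r) (\<lambda>_::complex. 1::complex)" for r
    using emeasure_lborel_ball_finite[of "0::complex" r]
    unfolding set_integrable_def by (intro integrable_scaleR_left integrable_real_indicator) auto
  have "((\<lambda>z. integral\<^sup>L lborel F) has_derivative (\<lambda>h. integral\<^sup>L lborel a * h + integral\<^sup>L lborel b * cnj h)) (at 0)"
  proof -
    have "((\<lambda>z. (LBINT u. F (z - u) * 1)) has_derivative
      (\<lambda>h. (LBINT u. a (0 - u) * 1) * h + (LBINT u. b (0 - u) * 1) * cnj h)) (at 0)"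
      by (rule has_derivative_convolution[OF F _ one]) (use F0' in auto)
    then show ?thesis
      by (simp only: mult_1_right integral_reflect[OF \<open>F \<in> _\<close>] integral_reflect[OF \<open>a \<in> _\<close>] integral_reflect[OF \<open>b \<in> _\<close>])
  qed
  moreover have "((\<lambda>z. integral\<^sup>L lborel F) has_derivative (\<lambda>h. 0 * h + 0 * cnj h)) (at 0)" by simp
  ultimately show "integral\<^sup>L lborel a = 0" "integral\<^sup>L lborel b = 0"
    using wirtinger_unique by blast+
qed

lemma integration_by_parts_wirtinger:
  assumes F: "wirtinger_on S F a b" and G: "wirtinger_on UNIV G p q"
    and S: "open S" and K: "compact K" "K \<subseteq> S" and G0: "\<And>z. z \<notin> K \<Longrightarrow> G z = 0"
  shows "(LBINT z. a z * G z) = - (LBINT z. F z * p z)"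
    and "(LBINT z. b z * G z) = - (LBINT z. F z * q z)"
    and "integrable lborel (\<lambda>z. a z * G z)" "integrable lborel (\<lambda>z. F z * p z)"
    and "integrable lborel (\<lambda>z. b z * G z)" "integrable lborel (\<lambda>z. F z * q z)"
proof -
  note cut = wirtinger_on_cutoff[OF F G S compact_imp_closed[OF K(1)] K(2) G0]
  note int = integrable_compact_support[OF _ _ K(1)]
  show i: "integrable lborel (\<lambda>z. a z * G z)" "integrable lborel (\<lambda>z. F z * p z)"
    "integrable lborel (\<lambda>z. b z * G z)" "integrable lborel (\<lambda>z. F z * q z)"
    by (rule int, rule cut, simp, simp add: G0 cut)+
  have "(LBINT z. a z * G z + F z * p z) = 0" "(LBINT z. b z * G z + F z * q z) = 0"
    by (rule integral_wirtinger_zero[OF cut(1) _ K(1)]; simp add: G0)+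
  then show "(LBINT z. a z * G z) = - (LBINT z. F z * p z)"
    "(LBINT z. b z * G z) = - (LBINT z. F z * q z)"
    using i by (simp_all add: eq_neg_iff_add_eq_0)
qed

section \<open>The Cauchy--Pompeiu formula\<close>

text \<open>
  \<open>reg_normsq d\<close> is a continuously differentiable substitute for the squared modulus which is bounded
  away from 0 and differs from it only where the squared modulus is below \<open>d\<close>.  It regularises both the
  Cauchy kernel \<open>1/z = cnj z / |z|\<^sup>2\<close> and, in the integrating factor, the quotient \<open>cnj g / g\<close>.
\<close>

definition reg_gap :: "real \<Rightarrow> complex \<Rightarrow> real" where
  "reg_gap d w = max 0 (d - (cmod w)\<^sup>2) / d"

definition reg_normsq :: "real \<Rightarrow> complex \<Rightarrow> real" where
  "reg_normsq d w = (cmod w)\<^sup>2 + d * (reg_gap d w)\<^sup>2"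

lemma reg_normsq_ge: "d > 0 \<Longrightarrow> (cmod w)\<^sup>2 \<le> reg_normsq d w"
  by (simp add: reg_normsq_def)

lemma reg_normsq_pos: "d > 0 \<Longrightarrow> reg_normsq d w > 0"
proof -
  assume "d > 0"
  show ?thesis
  proof (cases "w = 0")
    case True
    then show ?thesis using \<open>d > 0\<close> by (simp add: reg_normsq_def reg_gap_def)
  next
    case False
    then have "0 < (cmod w)\<^sup>2" by simp
    then show ?thesis using reg_normsq_ge[OF \<open>d > 0\<close>, of w] by linarith
  qed
qed

lemma reg_normsq_eq: "d \<le> (cmod w)\<^sup>2 \<Longrightarrow> reg_normsq d w = (cmod w)\<^sup>2"
  by (simp add: reg_normsq_def reg_gap_def)

lemma wirtinger_on_reg_normsq:
  assumes "wirtinger_on S F a b" "d > 0"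
  shows "wirtinger_on S (\<lambda>z. of_real (reg_normsq d (F z)))
    (\<lambda>z. (a z * cnj (F z) + F z * cnj (b z)) * (1 - 2 * of_real (reg_gap d (F z))))
    (\<lambda>z. (b z * cnj (F z) + F z * cnj (a z)) * (1 - 2 * of_real (reg_gap d (F z))))"
proof -
  let ?A = "\<lambda>z. a z * cnj (F z) + F z * cnj (b z)" and ?B = "\<lambda>z. b z * cnj (F z) + F z * cnj (a z)"
  let ?N = "\<lambda>z. of_real ((cmod (F z))\<^sup>2) :: complex"
  have N: "wirtinger_on S ?N ?A ?B" by (rule wirtinger_on_normsq[OF assms(1)])
  have "wirtinger_on S (\<lambda>z. of_real d - ?N z) (\<lambda>z. 0 - ?A z) (\<lambda>z. 0 - ?B z)"
    by (rule wirtinger_on_diff[OF wirtinger_on_const N])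
  from wirtinger_on_add[OF N wirtinger_on_cmult[OF wirtinger_on_pos_pow[OF this, of 2], of "1 / of_real d"]]
  show ?thesis
    by (rule back_subst[of "\<lambda>(f,a,b). wirtinger_on S f a b", where a="(_,_,_)" and b="(_,_,_)", simplified prod.case])
       (use assms(2) in \<open>auto simp: fun_eq_iff pos_pow_def reg_normsq_def reg_gap_def power_divide field_simps power2_eq_square
           simp del: of_real_power\<close>)
qed

lemma borel_measurable_one_over: "(\<lambda>u::complex. 1 / u) \<in> borel_measurable borel"
proof -
  have "(\<lambda>u::complex. 1 / u) = inverse" by (simp add: fun_eq_iff inverse_eq_divide)
  then show ?thesis by simp
qed

text \<open>The derivative with respect to \<open>cnj z\<close> of the regularised kernel
  \<open>cnj z / reg_normsq d z\<close>, in a form that shows that it is nonnegative and vanishes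
  for |z|^2 \<ge> d. As d tends to 0 it concentrates at the origin with total mass
  \<open>cp_const\<close>.\<close>

definition mollifier :: "real \<Rightarrow> complex \<Rightarrow> real" where
  "mollifier d z = reg_gap d z * (d * reg_gap d z + 2 * (cmod z)\<^sup>2) / (reg_normsq d z)\<^sup>2"

lemma wirtinger_on_reg_kernel:
  assumes "d > 0"
  obtains a where "wirtinger_on UNIV (\<lambda>z. cnj z / of_real (reg_normsq d z)) a (\<lambda>z. of_real (mollifier d z))"
proof -
  have "wirtinger_on UNIV (\<lambda>z. of_real (reg_normsq d z))
    (\<lambda>z. (1 * cnj z + z * cnj 0) * (1 - 2 * of_real (reg_gap d z)))
    (\<lambda>z. (0 * cnj z + z * cnj 1) * (1 - 2 * of_real (reg_gap d z)))"
    by (rule wirtinger_on_reg_normsq[OF wirtinger_on_id assms])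
  note wirtinger_on_mult[OF wirtinger_on_cnj_id wirtinger_on_inverse[OF this]]
  then have w: "wirtinger_on UNIV (\<lambda>z. cnj z * inverse (of_real (reg_normsq d z)))
     (\<lambda>z. 0 * inverse (of_real (reg_normsq d z)) +
        cnj z * (- inverse ((of_real (reg_normsq d z))\<^sup>2) * ((1 * cnj z + z * cnj 0) * (1 - 2 * of_real (reg_gap d z)))))
     (\<lambda>z. 1 * inverse (of_real (reg_normsq d z)) +
        cnj z * (- inverse ((of_real (reg_normsq d z))\<^sup>2) * ((0 * cnj z + z * cnj 1) * (1 - 2 * of_real (reg_gap d z)))))"
    using reg_normsq_pos[OF assms] by (simp add: less_imp_neq[symmetric])
  show thesis
  proof (rule that, rule wirtinger_on_transform[OF w open_UNIV _ refl])
    fix z :: complex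
    let ?r = "reg_normsq d z" and ?s = "reg_gap d z" and ?N = "(cmod z)\<^sup>2"
    have r: "?r > 0" by (rule reg_normsq_pos[OF assms])
    have "mollifier d z = inverse ?r - ?N * inverse (?r\<^sup>2) * (1 - 2 * ?s)"
    proof -
      have "mollifier d z = (?r - ?N * (1 - 2 * ?s)) / ?r\<^sup>2"
        by (simp add: mollifier_def reg_normsq_def algebra_simps power2_eq_square)
      also have "\<dots> = inverse ?r - ?N * inverse (?r\<^sup>2) * (1 - 2 * ?s)"
        using r by (simp add: field_simps power2_eq_square)
      finally show ?thesis .
    qed
    then have "complex_of_real (mollifier d z) =
       inverse (of_real ?r) - (cnj z * z) * inverse ((of_real ?r)\<^sup>2) * (1 - 2 * of_real ?s)"
      by (simp add: complex_norm_square mult.commute del: of_real_power)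
         (simp add: complex_norm_square mult.commute)
    then show "1 * inverse (of_real ?r) + cnj z * (- inverse ((of_real ?r)\<^sup>2) * ((0 * cnj z + z * cnj 1) * (1 - 2 * of_real ?s)))
        = of_real (mollifier d z)"
      by (simp add: algebra_simps)
  qed (simp_all add: divide_inverse)
qed

lemma mollifier_nonneg: "d > 0 \<Longrightarrow> mollifier d z \<ge> 0"
  by (simp add: mollifier_def reg_gap_def)

lemma mollifier_zero: "d \<le> (cmod z)\<^sup>2 \<Longrightarrow> mollifier d z = 0"
  by (simp add: mollifier_def reg_gap_def)

lemma mollifier_continuous: "d > 0 \<Longrightarrow> continuous_on UNIV (mollifier d)"
proof -
  assume "d > 0"
  then obtain a where "wirtinger_on UNIV (\<lambda>z. cnj z / of_real (reg_normsq d z)) a (\<lambda>z. of_real (mollifier d z))"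
    by (rule wirtinger_on_reg_kernel)
  then have "continuous_on UNIV (\<lambda>z. Re (of_real (mollifier d z)))"
    by (intro continuous_on_Re wirtinger_onD(3))
  then show ?thesis by simp
qed

text \<open>
  The constant is \<open>\<pi>\<close>, but only its positivity matters.
\<close>

definition cp_const :: real where
  "cp_const = integral\<^sup>L lborel (mollifier 1)"

lemma mollifier_support: "d > 0 \<Longrightarrow> z \<notin> cball 0 (sqrt d) \<Longrightarrow> mollifier d z = 0"
  by (rule mollifier_zero) (simp add: real_le_lsqrt sqrt_le_D less_imp_le)

lemma integrable_mollifier: "d > 0 \<Longrightarrow> integrable lborel (\<lambda>z. complex_of_real (mollifier d z))"
  by (rule integrable_compact_support[of _ "cball 0 (sqrt d)"])
     (auto intro!: continuous_intros mollifier_continuous mollifier_support)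

text \<open>
  Two regularised kernels differ by a function of compact support, so the integral does not depend on \<open>d\<close>.
\<close>

lemma integral_mollifier:
  assumes "d > 0"
  shows "(LBINT z. complex_of_real (mollifier d z)) = of_real cp_const"
proof -
  obtain a where a: "wirtinger_on UNIV (\<lambda>z. cnj z / of_real (reg_normsq d z)) a (\<lambda>z. of_real (mollifier d z))"
    by (rule wirtinger_on_reg_kernel[OF assms])
  obtain a' where a': "wirtinger_on UNIV (\<lambda>z. cnj z / of_real (reg_normsq 1 z)) a' (\<lambda>z. of_real (mollifier 1 z))"
    by (rule wirtinger_on_reg_kernel[OF zero_less_one])
  have "(LBINT z. complex_of_real (mollifier d z) - of_real (mollifier 1 z)) = 0"
  proof (rule integral_wirtinger_zero(2)[OF wirtinger_on_diff[OF a a'], where K="cball 0 (sqrt (max 1 d))"])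
    fix z :: complex assume "z \<notin> cball 0 (sqrt (max 1 d))"
    then have "sqrt (max 1 d) ^ 2 \<le> (cmod z)\<^sup>2" by (intro power_mono) auto
    then have "max 1 d \<le> (cmod z)\<^sup>2" by simp
    then show "cnj z / of_real (reg_normsq d z) - cnj z / of_real (reg_normsq 1 z) = 0"
      by (simp add: reg_normsq_eq)
  qed simp
  then show ?thesis using integrable_mollifier[OF assms] integrable_mollifier[of 1]
    by (simp add: cp_const_def)
qed

text \<open>Otherwise the nonnegative \<open>mollifier 1\<close> would vanish almost everywhere, but
  it is positive on the unit ball.\<close>

lemma cp_const_pos: "cp_const > 0"
proof (rule ccontr)
  assume neg: "\<not> cp_const > 0"
  have int: "integrable lborel (mollifier 1)" using integrable_Re[OF integrable_mollifier[of 1]] by simp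
  have nn: "AE z in lborel. 0 \<le> mollifier 1 z" by (simp add: mollifier_nonneg)
  have "cp_const \<ge> 0" unfolding cp_const_def by (simp add: mollifier_nonneg)
  then have "AE z in lborel. mollifier 1 z = 0"
    using integral_nonneg_eq_0_iff_AE[OF int nn] neg by (simp add: cp_const_def)
  moreover have "mollifier 1 z \<noteq> 0" if "z \<in> ball 0 1" for z
  proof -
    have "(cmod z)\<^sup>2 < 1" using that by (simp add: power_less_one_iff abs_square_less_1)
    moreover then have "0 < reg_gap 1 z" by (simp add: reg_gap_def)
    ultimately have "0 < reg_gap 1 z * (1 * reg_gap 1 z + 2 * (cmod z)\<^sup>2)"
      by (intro mult_pos_pos add_pos_nonneg) auto
    then have "0 < mollifier 1 z"
      unfolding mollifier_def by (rule divide_pos_pos) (use reg_normsq_pos[of 1 z] in simp)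
    then show ?thesis by simp
  qed
  ultimately have "AE z in lborel. (z::complex) \<notin> ball 0 1" by (auto elim: eventually_mono)
  moreover have "ball (0::complex) 1 = {z. cmod z < 1}" by auto
  ultimately have "emeasure lborel (ball (0::complex) 1) = 0"
    by (subst (asm) AE_iff_measurable[OF _ refl]) auto
  then show False by (simp add: emeasure_ball unit_ball_vol_2)
qed

text \<open>Integrate by parts against the regularised kernel and let d tend to 0. The regularised
  kernels are dominated by 1/|u|, which handles one side; on the other side the mollifiers form an
  approximate identity of mass \<open>cp_const\<close>.\<close>

lemma cauchy_pompeiu:
  assumes F: "wirtinger_on UNIV F a b" and F0: "\<And>z. z \<notin> cball 0 M \<Longrightarrow> F z = 0"
  shows "(LBINT u. b (z - u) * (1 / u)) = of_real cp_const * F z"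
proof -
  have b0: "\<And>z. z \<notin> cball 0 M \<Longrightarrow> b z = 0"
    using wirtinger_zero_off_support[OF F open_UNIV closed_cball F0 UNIV_I] by blast
  define d where "d n = inverse (real (Suc n))" for n
  have d: "d n > 0" for n by (simp add: d_def)
  have dlim: "d \<longlonglongrightarrow> 0" unfolding d_def by (rule LIMSEQ_inverse_real_of_nat)
  let ?K = "\<lambda>n u. cnj u / complex_of_real (reg_normsq (d n) u)"
  have G: "wirtinger_on UNIV (\<lambda>u. F (z - u)) (\<lambda>u. - a (z - u)) (\<lambda>u. - b (z - u))"
  proof (rule wirtinger_onI)
    fix u
    have "((\<lambda>u. z - u) has_derivative (\<lambda>h. - h)) (at u)" by (auto intro!: derivative_eq_intros)
    from has_derivative_compose[OF this wirtinger_onD(1)[OF F UNIV_I]]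
    show "((\<lambda>u. F (z - u)) has_derivative (\<lambda>h. - a (z - u) * h + - b (z - u) * cnj h)) (at u)"
      by simp
  qed (auto intro!: continuous_intros continuous_on_compose2[OF wirtinger_onD(2)[OF F]] continuous_on_compose2[OF wirtinger_onD(3)[OF F]])
  have G0: "F (z - u) = 0" if "u \<notin> cball z M" for u
    using F0[of "z - u"] that by (simp add: dist_norm norm_minus_commute)
  have eq: "(LBINT u. ?K n u * b (z - u)) = (LBINT u. of_real (mollifier (d n) u) * F (z - u))" for n
  proof -
    obtain k where k: "wirtinger_on UNIV (?K n) k (\<lambda>z. of_real (mollifier (d n) z))"
      by (rule wirtinger_on_reg_kernel[OF d])
    show ?thesis
      using integration_by_parts_wirtinger(2)[OF k G open_UNIV compact_cball subset_UNIV, of z M] G0 by simp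
  qed
  have "(\<lambda>n. (LBINT u. ?K n u * b (z - u))) \<longlonglongrightarrow> (LBINT u. b (z - u) * (1 / u))"
  proof (rule integral_dominated_convergence)
    have i: "integrable lborel (\<lambda>u. b (z - u) * (1 / u))"
      by (rule integrable_convolution[OF wirtinger_onD(3)[OF F] _ set_integrable_inverse_ball borel_measurable_one_over])
         (rule b0)
    then show "(\<lambda>u. b (z - u) * (1 / u)) \<in> borel_measurable lborel" by (rule borel_measurable_integrable)
    from i show "integrable lborel (\<lambda>u. norm (b (z - u) * (1 / u)))" by (rule integrable_norm)
    fix n
    obtain k where k: "wirtinger_on UNIV (?K n) k (\<lambda>z. of_real (mollifier (d n) z))"
      by (rule wirtinger_on_reg_kernel[OF d])
    have "continuous_on UNIV (\<lambda>u. ?K n u * b (z - u))"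
      by (intro continuous_intros wirtinger_on_continuous[OF k] continuous_on_compose2[OF wirtinger_onD(3)[OF F]]) auto
    then show "(\<lambda>u. ?K n u * b (z - u)) \<in> borel_measurable lborel"
      by (simp add: borel_measurable_continuous_onI)
    have "norm (?K n u * b (z - u)) \<le> norm (b (z - u) * (1 / u))" for u
    proof (cases "u = 0")
      case False
      have "cmod u / reg_normsq (d n) u \<le> cmod u / (cmod u)\<^sup>2"
        using reg_normsq_ge[OF d, of u n] False by (intro divide_left_mono mult_pos_pos reg_normsq_pos d) auto
      also have "\<dots> = 1 / cmod u" using False by (simp add: power2_eq_square)
      finally have "norm (?K n u) \<le> 1 / cmod u" using reg_normsq_pos[OF d, of n u] by (simp add: norm_divide)
      then have "norm (?K n u) * cmod (b (z - u)) \<le> 1 / cmod u * cmod (b (z - u))" by (rule mult_right_mono) simp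
      then show ?thesis by (simp add: norm_mult norm_divide)
    qed simp
    then show "AE u in lborel. norm (?K n u * b (z - u)) \<le> norm (b (z - u) * (1 / u))" by simp
  next
    have "(\<lambda>n. ?K n u * b (z - u)) \<longlonglongrightarrow> b (z - u) * (1 / u)" for u
    proof (cases "u = 0")
      case False
      then have "0 < (cmod u)\<^sup>2" by simp
      from order_tendstoD(2)[OF dlim this] have "\<forall>\<^sub>F n in sequentially. d n < (cmod u)\<^sup>2" .
      then have "\<forall>\<^sub>F n in sequentially. ?K n u * b (z - u) = b (z - u) * (1 / u)"
      proof (rule eventually_mono)
        fix n assume "d n < (cmod u)\<^sup>2"
        then have "reg_normsq (d n) u = (cmod u)\<^sup>2" by (simp add: reg_normsq_eq)
        then have "?K n u = cnj u / (u * cnj u)" by (simp add: complex_norm_square del: of_real_power)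
        then show "?K n u * b (z - u) = b (z - u) * (1 / u)" using False by simp
      qed
      then show ?thesis by (rule tendsto_eventually)
    qed simp
    then show "AE u in lborel. (\<lambda>n. ?K n u * b (z - u)) \<longlonglongrightarrow> b (z - u) * (1 / u)" by simp
  qed
  moreover have "(\<lambda>n. (LBINT u. of_real (mollifier (d n) u) * F (z - u))) \<longlonglongrightarrow> of_real cp_const * F z"
  proof (rule LIMSEQ_I)
    fix e :: real assume "e > 0"
    define e' where "e' = e / (2 * cp_const)"
    have "e' > 0" using \<open>e > 0\<close> cp_const_pos by (simp add: e'_def)
    have "isCont F z" using wirtinger_on_continuous[OF F] by (simp add: continuous_on_eq_continuous_at)
    then obtain r where r: "r > 0" "\<And>w. dist w z < r \<Longrightarrow> dist (F w) (F z) < e'"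
      unfolding continuous_at_eps_delta using \<open>e' > 0\<close> by metis
    have "0 < r\<^sup>2" using r by simp
    from order_tendstoD(2)[OF dlim this] obtain N where N: "\<And>n. n \<ge> N \<Longrightarrow> d n < r\<^sup>2"
      unfolding eventually_sequentially by blast
    show "\<exists>N. \<forall>n\<ge>N. norm ((LBINT u. of_real (mollifier (d n) u) * F (z - u)) - of_real cp_const * F z) < e"
    proof (intro exI[of _ N] allI impI)
      fix n assume n: "n \<ge> N"
      have i1: "integrable lborel (\<lambda>u. of_real (mollifier (d n) u) * F (z - u))"
        by (rule integrable_compact_support[of _ "cball 0 (sqrt (d n))"])
           (auto intro!: continuous_intros mollifier_continuous d continuous_on_compose2[OF wirtinger_on_continuous[OF F]] mollifier_support)
      have i2: "integrable lborel (\<lambda>u. of_real (mollifier (d n) u) * F z)"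
        using integrable_mollifier[OF d, of n] by simp
      have "(LBINT u. of_real (mollifier (d n) u) * F (z - u)) - of_real cp_const * F z
        = (LBINT u. of_real (mollifier (d n) u) * F (z - u) - of_real (mollifier (d n) u) * F z)"
        using i1 i2 integral_mollifier[OF d, of n] by simp
      also have "norm \<dots> \<le> (LBINT u. mollifier (d n) u * e')"
      proof (rule norm_integral_le)
        show "integrable lborel (\<lambda>u. of_real (mollifier (d n) u) * F (z - u) - of_real (mollifier (d n) u) * F z)"
          using i1 i2 by simp
        show "integrable lborel (\<lambda>u. mollifier (d n) u * e')"
          using integrable_Re[OF integrable_mollifier[OF d, of n]] by simp
        fix u
        show "norm (of_real (mollifier (d n) u) * F (z - u) - of_real (mollifier (d n) u) * F z) \<le> mollifier (d n) u * e'"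
        proof (cases "d n \<le> (cmod u)\<^sup>2")
          case True then show ?thesis by (simp add: mollifier_zero)
        next
          case False
          then have "(cmod u)\<^sup>2 < r\<^sup>2" using N[OF n] by linarith
          then have "cmod u < r" using r by (simp add: power_less_imp_less_base)
          then have "cmod (F (z - u) - F z) \<le> e'" using r(2)[of "z - u"] by (simp add: dist_norm less_imp_le)
          moreover have "norm (of_real (mollifier (d n) u) * F (z - u) - of_real (mollifier (d n) u) * F z)
             = mollifier (d n) u * cmod (F (z - u) - F z)"
            by (simp only: right_diff_distrib[symmetric] norm_mult) (simp add: mollifier_nonneg d)
          ultimately show ?thesis by (simp add: mult_left_mono mollifier_nonneg d)
        qed
      qed
      also have "\<dots> = cp_const * e'"
      proof -
        have "complex_of_real (integral\<^sup>L lborel (mollifier (d n))) = of_real cp_const"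
          using integral_mollifier[OF d, of n] by simp
        then show ?thesis by simp
      qed
      also have "\<dots> < e" using cp_const_pos \<open>e > 0\<close> by (simp add: e'_def)
      finally show "norm ((LBINT u. of_real (mollifier (d n) u) * F (z - u)) - of_real cp_const * F z) < e" .
    qed
  qed
  ultimately show ?thesis unfolding eq by (rule LIMSEQ_unique)
qed

definition cauchy_transform :: "(complex \<Rightarrow> complex) \<Rightarrow> complex \<Rightarrow> complex" where
  "cauchy_transform b z = (LBINT u. b (z - u) * (1 / u)) / of_real cp_const"

text \<open>Both derivatives pass under the integral onto b. In the \<open>cnj z\<close> direction
  the result is the left side of the Cauchy--Pompeiu formula for b itself.\<close>

lemma has_derivative_cauchy_transform:
  assumes b: "wirtinger_on UNIV b p q" and b0: "\<And>z. z \<notin> cball 0 M \<Longrightarrow> b z = 0"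
  shows "(cauchy_transform b has_derivative (\<lambda>h. cauchy_transform p z * h + b z * cnj h)) (at z)"
proof -
  have "((\<lambda>z. (LBINT u. b (z - u) * (1 / u))) has_derivative
     (\<lambda>h. (LBINT u. p (z - u) * (1 / u)) * h + (LBINT u. q (z - u) * (1 / u)) * cnj h)) (at z)"
    by (rule has_derivative_convolution[OF b _ set_integrable_inverse_ball borel_measurable_one_over]) (use b0 in auto)
  then have "((\<lambda>z. (LBINT u. b (z - u) * (1 / u))) has_derivative
     (\<lambda>h. (LBINT u. p (z - u) * (1 / u)) * h + of_real cp_const * b z * cnj h)) (at z)"
    by (subst (asm) cauchy_pompeiu[OF b b0])
  from has_derivative_mult_right[OF this, of "1 / of_real cp_const"]
  show ?thesis unfolding cauchy_transform_def[abs_def] using cp_const_pos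
    by (simp add: field_simps)
qed

lemma nn_integral_reflect:
  fixes F :: "complex \<Rightarrow> ennreal"
  assumes "F \<in> borel_measurable borel"
  shows "(\<integral>\<^sup>+x. F (z - x) \<partial>lborel) = (\<integral>\<^sup>+x. F x \<partial>lborel)"
  using nn_integral_distr[of "\<lambda>x. z - x" lborel borel F] assms
  by (simp add: lborel_distr_reflect)

lemma norm_convolution_inverse_le:
  assumes b: "continuous_on UNIV b" and b0: "\<And>z. z \<notin> cball 0 M \<Longrightarrow> b z = 0"
  shows "ennreal (cmod ((LBINT u. b (z - u) * (1 / u)))) \<le> (\<integral>\<^sup>+u. ennreal (cmod (b u) / cmod (z - u)) \<partial>lborel)"
proof -
  have [measurable]: "b \<in> borel_measurable borel" by (rule borel_measurable_continuous_onI[OF b])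
  have "integrable lborel (\<lambda>u. b (z - u) * (1 / u))"
    by (rule integrable_convolution[OF b _ set_integrable_inverse_ball borel_measurable_one_over]) (use b0 in auto)
  then have "ennreal (cmod ((LBINT u. b (z - u) * (1 / u)))) \<le> (\<integral>\<^sup>+u. ennreal (norm (b (z - u) * (1 / u))) \<partial>lborel)"
    by (rule integral_norm_bound_ennreal)
  also have "\<dots> = (\<integral>\<^sup>+u. (\<lambda>u. ennreal (cmod (b u) / cmod (z - u))) (z - u) \<partial>lborel)"
    by (simp add: norm_mult norm_divide)
  also have "\<dots> = (\<integral>\<^sup>+u. ennreal (cmod (b u) / cmod (z - u)) \<partial>lborel)"
    by (rule nn_integral_reflect) simp
  finally show ?thesis .
qed

section \<open>Localisation of the Cauchy--Pompeiu formula\<close>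

definition bump :: "nat \<Rightarrow> complex \<Rightarrow> real \<Rightarrow> complex \<Rightarrow> complex" where
  "bump n z r u = pos_pow n (1 - of_real ((cmod (u - z))\<^sup>2) / of_real (r\<^sup>2))"

lemma bump_center [simp]: "bump n z r z = 1"
  by (simp add: bump_def pos_pow_def)

lemma bump_norm_le: "cmod (bump n z r u) \<le> 1"
proof -
  have "Re (1 - of_real ((cmod (u - z))\<^sup>2) / of_real (r\<^sup>2)) \<le> 1"
    by (simp add: Re_divide_of_real del: of_real_power)
  then show ?thesis unfolding bump_def pos_pow_def
    by (simp add: power_le_one del: of_real_power minus_complex.sel)
qed

lemma bump_zero: "r > 0 \<Longrightarrow> n > 0 \<Longrightarrow> u \<notin> ball z r \<Longrightarrow> bump n z r u = 0"
proof -
  assume "r > 0" "n > 0" "u \<notin> ball z r"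
  then have "r\<^sup>2 \<le> (cmod (u - z))\<^sup>2" by (intro power_mono) (auto simp: dist_norm norm_minus_commute)
  then have "Re (1 - of_real ((cmod (u - z))\<^sup>2) / of_real (r\<^sup>2)) \<le> 0"
    using \<open>r > 0\<close> by (simp add: Re_divide_of_real del: of_real_power)
  then show ?thesis using \<open>n > 0\<close> unfolding bump_def pos_pow_def
    by (simp add: max_def del: of_real_power minus_complex.sel)
qed

lemma wirtinger_on_bump:
  assumes "n \<ge> 2"
  shows "wirtinger_on S (bump n z r)
    (\<lambda>u. - (of_nat n / of_real (r\<^sup>2)) * (bump (n - 1) z r u * cnj (u - z)))
    (\<lambda>u. - (of_nat n / of_real (r\<^sup>2)) * (bump (n - 1) z r u * (u - z)))"
proof -
  have "wirtinger_on UNIV (\<lambda>u. u - z) (\<lambda>u. 1 - 0) (\<lambda>u. 0 - 0)"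
    by (rule wirtinger_on_diff[OF wirtinger_on_id wirtinger_on_const])
  from wirtinger_on_diff[OF wirtinger_on_const[of _ 1] wirtinger_on_cmult[OF wirtinger_on_normsq[OF this], of "1 / of_real (r\<^sup>2)"]]
  have "wirtinger_on UNIV (\<lambda>u. 1 - of_real ((cmod (u - z))\<^sup>2) / of_real (r\<^sup>2))
     (\<lambda>u. - (1 / of_real (r\<^sup>2)) * cnj (u - z)) (\<lambda>u. - (1 / of_real (r\<^sup>2)) * (u - z))"
    by (simp del: of_real_power)
  from wirtinger_on_pos_pow[OF this assms]
  have "wirtinger_on UNIV (bump n z r)
    (\<lambda>u. - (of_nat n / of_real (r\<^sup>2)) * (bump (n - 1) z r u * cnj (u - z)))
    (\<lambda>u. - (of_nat n / of_real (r\<^sup>2)) * (bump (n - 1) z r u * (u - z)))"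
  proof (rule wirtinger_on_transform[OF _ open_UNIV])
    fix u
    define c :: complex where "c = 1 / of_real (r\<^sup>2)"
    have c: "cnj c = c" by (simp add: c_def)
    have "(- c * cnj (u - z) + cnj (- c * (u - z))) / 2 = - c * cnj (u - z)"
      by (simp add: c field_simps)
    then show "of_nat n * pos_pow (n - 1) (1 - of_real ((cmod (u - z))\<^sup>2) / of_real (r\<^sup>2)) *
        ((- (1 / of_real (r\<^sup>2)) * cnj (u - z) + cnj (- (1 / of_real (r\<^sup>2)) * (u - z))) / 2)
      = - (of_nat n / of_real (r\<^sup>2)) * (bump (n - 1) z r u * cnj (u - z))"
      unfolding bump_def c_def[symmetric] by (simp add: c_def del: of_real_power)
    have "(- c * (u - z) + cnj (- c * cnj (u - z))) / 2 = - c * (u - z)"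
      by (simp add: c field_simps)
    then show "of_nat n * pos_pow (n - 1) (1 - of_real ((cmod (u - z))\<^sup>2) / of_real (r\<^sup>2)) *
        ((- (1 / of_real (r\<^sup>2)) * (u - z) + cnj (- (1 / of_real (r\<^sup>2)) * cnj (u - z))) / 2)
      = - (of_nat n / of_real (r\<^sup>2)) * (bump (n - 1) z r u * (u - z))"
      unfolding bump_def c_def[symmetric] by (simp add: c_def del: of_real_power)
  qed (simp add: bump_def)
  then show ?thesis by (rule wirtinger_on_subset) simp
qed

lemma continuous_on_bump: "continuous_on S (bump n z r)"
  unfolding bump_def[abs_def] pos_pow_def divide_inverse by (intro continuous_intros)

text \<open>Cauchy--Pompeiu for G times \<open>bump 4 z r\<close>. The derivative of the bump
  contains the factor u - z, which cancels the kernel and leaves the bounded weight 4/r^2 times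
  \<open>bump 3 z r\<close>; the derivative of G is the error term.\<close>

lemma cauchy_pompeiu_local:
  assumes G: "wirtinger_on S G a b" and S: "open S" "cball z r \<subseteq> S" and r: "r > 0"
  shows "ennreal (cmod (of_real cp_const * G z - (LBINT u. G u * (4 / of_real (r\<^sup>2) * bump 3 z r u))))
     \<le> (\<integral>\<^sup>+u. ennreal (cmod (b u) / cmod (z - u)) * indicator (ball z r) u \<partial>lborel)"
proof -
  let ?B = "bump 4 z r"
  let ?q = "\<lambda>u. - (of_nat 4 / of_real (r\<^sup>2)) * (bump (4 - 1) z r u * (u - z))"
  have z0: "\<And>u. u \<notin> cball z r \<Longrightarrow> ?B u = 0" using r by (auto intro!: bump_zero)
  have BM: "cball z r \<subseteq> cball 0 (cmod z + r)"
    by (auto simp: dist_norm) (metis add.commute add_le_cancel_right norm_minus_commute norm_triangle_sub order_trans)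
  have z0': "?B u = 0" if "u \<notin> cball 0 (cmod z + r)" for u using z0 BM that by blast
  have z3: "bump 3 z r u = 0" if "u \<notin> cball 0 (cmod z + r)" for u
  proof -
    have "u \<notin> ball z r" using BM that ball_subset_cball[of z r] by blast
    then show ?thesis using r by (intro bump_zero) auto
  qed
  have w: "wirtinger_on UNIV (\<lambda>u. G u * ?B u)
     (\<lambda>u. a u * ?B u + G u * (- (of_nat 4 / of_real (r\<^sup>2)) * (bump (4 - 1) z r u * cnj (u - z))))
     (\<lambda>u. b u * ?B u + G u * ?q u)"
    and cb: "continuous_on UNIV (\<lambda>u. b u * ?B u)" and cG: "continuous_on UNIV (\<lambda>u. G u * ?q u)"
    using wirtinger_on_cutoff[OF G wirtinger_on_bump[of 4] S(1) closed_cball S(2) z0] by simp_all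
  have cp: "(LBINT u. (b (z - u) * ?B (z - u) + G (z - u) * ?q (z - u)) * (1 / u)) = of_real cp_const * G z"
    by (rule trans[OF cauchy_pompeiu[OF w, of "cmod z + r"]]) (use z0' in auto)
  have ib: "integrable lborel (\<lambda>u. b (z - u) * ?B (z - u) * (1 / u))"
    by (rule integrable_convolution[OF cb _ set_integrable_inverse_ball borel_measurable_one_over, of "cmod z + r"])
       (use z0' in auto)
  have iG: "integrable lborel (\<lambda>u. G (z - u) * ?q (z - u) * (1 / u))"
    by (rule integrable_convolution[OF cG _ set_integrable_inverse_ball borel_measurable_one_over, of "cmod z + r"])
       (simp add: z3)
  have m: "(\<lambda>u. G u * (4 / of_real (r\<^sup>2) * bump 3 z r u)) \<in> borel_measurable borel"
  proof -
    have "continuous_on UNIV (\<lambda>u. G u * (4 / of_real (r\<^sup>2) * bump 3 z r u))"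
      by (rule continuous_on_extend_zero[OF S(1) closed_cball S(2)])
         (use r in \<open>auto intro!: continuous_intros wirtinger_on_continuous[OF G] continuous_on_bump bump_zero\<close>)
    then show ?thesis by (rule borel_measurable_continuous_onI)
  qed
  have "(LBINT u. G (z - u) * ?q (z - u) * (1 / u))
     = (LBINT u. (\<lambda>u. G u * (4 / of_real (r\<^sup>2) * bump 3 z r u)) (z - u))"
  proof (rule integral_cong_AE)
    show "(\<lambda>u. (\<lambda>u. G u * (4 / of_real (r\<^sup>2) * bump 3 z r u)) (z - u)) \<in> borel_measurable lborel"
      using measurable_compose[OF _ m, of "\<lambda>u. z - u" lborel] by simp
    \<comment> \<open>At u = 0 the convention 1/0 = 0 spoils the cancellation, so the integrands
      agree only off a null set.\<close>
    show "AE u in lborel. G (z - u) * ?q (z - u) * (1 / u) = (\<lambda>u. G u * (4 / of_real (r\<^sup>2) * bump 3 z r u)) (z - u)"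
      using AE_lborel_singleton[of 0] by eventually_elim auto
  qed (use iG in \<open>rule borel_measurable_integrable\<close>)
  also have "\<dots> = (LBINT u. G u * (4 / of_real (r\<^sup>2) * bump 3 z r u))"
    by (rule integral_reflect[OF m])
  finally have fin: "(LBINT u. G (z - u) * ?q (z - u) * (1 / u))
     = (LBINT u. G u * (4 / of_real (r\<^sup>2) * bump 3 z r u))" .
  have "of_real cp_const * G z = (LBINT u. b (z - u) * ?B (z - u) * (1 / u))
      + (LBINT u. G (z - u) * ?q (z - u) * (1 / u))"
    unfolding cp[symmetric] Bochner_Integration.integral_add[OF ib iG, symmetric] by (simp only: distrib_right)
  then have "of_real cp_const * G z - (LBINT u. G u * (4 / of_real (r\<^sup>2) * bump 3 z r u))
     = (LBINT u. b (z - u) * ?B (z - u) * (1 / u))"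
    unfolding fin by (simp only: add_diff_cancel_right')
  then have "ennreal (cmod (of_real cp_const * G z - (LBINT u. G u * (4 / of_real (r\<^sup>2) * bump 3 z r u))))
     \<le> (\<integral>\<^sup>+u. ennreal (cmod (b u * ?B u) / cmod (z - u)) \<partial>lborel)"
    by (simp only:) (rule norm_convolution_inverse_le[OF cb, of "cmod z + r" z], use z0' in auto)
  also have "\<dots> \<le> (\<integral>\<^sup>+u. ennreal (cmod (b u) / cmod (z - u)) * indicator (ball z r) u \<partial>lborel)"
  proof (rule nn_integral_mono)
    fix u
    show "ennreal (cmod (b u * ?B u) / cmod (z - u)) \<le> ennreal (cmod (b u) / cmod (z - u)) * indicator (ball z r) u"
    proof (cases "u \<in> ball z r")
      case True
      have "cmod (b u * ?B u) \<le> cmod (b u)"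
        using bump_norm_le[of 4 z r u] by (simp add: norm_mult mult_left_le)
      then show ?thesis using True by (auto intro!: ennreal_leI divide_right_mono)
    next
      case False
      then show ?thesis using r by (simp add: bump_zero)
    qed
  qed
  finally show ?thesis .
qed

section \<open>Weighted mean values\<close>

text \<open>
  Dividing the derivative of \<open>bump 4 z r\<close> by \<open>z - u\<close> leaves no singularity, so the weight in
  the local Cauchy--Pompeiu formula can be differentiated twice.
\<close>

definition cp_weight :: "complex \<Rightarrow> real \<Rightarrow> complex \<Rightarrow> complex" where
  "cp_weight z r u = 4 / of_real (r\<^sup>2) * bump 3 z r u"

definition cp_weight' :: "complex \<Rightarrow> real \<Rightarrow> complex \<Rightarrow> complex" where
  "cp_weight' z r u = - (12 / of_real (r ^ 4)) * (bump 2 z r u * (u - z))"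

text \<open>The mixed second derivative of \<open>cp_weight\<close>. It is reached in either order,
  which is what the symmetry of mixed derivatives and the interior bound for \<open>g\<close> rest
  on.\<close>

definition cp_weight'' :: "complex \<Rightarrow> real \<Rightarrow> complex \<Rightarrow> complex" where
  "cp_weight'' z r u = - (12 / of_real (r ^ 4)) *
     (bump 2 z r u - 2 / of_real (r\<^sup>2) * (bump 1 z r u * of_real ((cmod (u - z))\<^sup>2)))"

lemma wirtinger_on_cp_weight:
  "wirtinger_on UNIV (cp_weight z r) (\<lambda>u. - (12 / of_real (r ^ 4)) * (bump 2 z r u * cnj (u - z))) (cp_weight' z r)"
  unfolding cp_weight_def[abs_def]
  by (rule wirtinger_on_transform[OF wirtinger_on_cmult[OF wirtinger_on_bump[of 3 UNIV z r], where c="4 / of_real (r\<^sup>2)"] open_UNIV])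
     (auto simp: cp_weight'_def power2_eq_square power4_eq_xxxx)

lemma wirtinger_on_bump_mult:
  assumes "n \<ge> 2"
  shows "wirtinger_on UNIV (\<lambda>u. bump n z r u * (u - z))
      (\<lambda>u. bump n z r u - of_nat n / of_real (r\<^sup>2) * (bump (n - 1) z r u * of_real ((cmod (u - z))\<^sup>2)))
      (\<lambda>u. - (of_nat n / of_real (r\<^sup>2)) * (bump (n - 1) z r u * (u - z)\<^sup>2))"
    and "wirtinger_on UNIV (\<lambda>u. bump n z r u * cnj (u - z))
      (\<lambda>u. - (of_nat n / of_real (r\<^sup>2)) * (bump (n - 1) z r u * (cnj (u - z))\<^sup>2))
      (\<lambda>u. bump n z r u - of_nat n / of_real (r\<^sup>2) * (bump (n - 1) z r u * of_real ((cmod (u - z))\<^sup>2)))"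
proof -
  have id: "wirtinger_on UNIV (\<lambda>u. u - z) (\<lambda>u. 1) (\<lambda>u. 0)"
    using wirtinger_on_diff[OF wirtinger_on_id wirtinger_on_const, of UNIV z] by simp
  have cnj: "wirtinger_on UNIV (\<lambda>u. cnj (u - z)) (\<lambda>u. 0) (\<lambda>u. 1)"
    using wirtinger_on_cnj[OF id] by simp
  note sq = complex_norm_square
  show "wirtinger_on UNIV (\<lambda>u. bump n z r u * (u - z))
      (\<lambda>u. bump n z r u - of_nat n / of_real (r\<^sup>2) * (bump (n - 1) z r u * of_real ((cmod (u - z))\<^sup>2)))
      (\<lambda>u. - (of_nat n / of_real (r\<^sup>2)) * (bump (n - 1) z r u * (u - z)\<^sup>2))"
    by (rule wirtinger_on_transform[OF wirtinger_on_mult[OF wirtinger_on_bump[OF assms] id] open_UNIV refl])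
       (simp_all only: sq, simp_all add: power2_eq_square)
  show "wirtinger_on UNIV (\<lambda>u. bump n z r u * cnj (u - z))
      (\<lambda>u. - (of_nat n / of_real (r\<^sup>2)) * (bump (n - 1) z r u * (cnj (u - z))\<^sup>2))
      (\<lambda>u. bump n z r u - of_nat n / of_real (r\<^sup>2) * (bump (n - 1) z r u * of_real ((cmod (u - z))\<^sup>2)))"
    by (rule wirtinger_on_transform[OF wirtinger_on_mult[OF wirtinger_on_bump[OF assms] cnj] open_UNIV refl])
       (simp_all only: sq, simp_all add: power2_eq_square)
qed

lemma wirtinger_on_cp_weight_second:
  obtains a where "wirtinger_on UNIV (\<lambda>u. - (12 / of_real (r ^ 4)) * (bump 2 z r u * cnj (u - z))) a (cp_weight'' z r)"
proof (rule that)
  show "wirtinger_on UNIV (\<lambda>u. - (12 / of_real (r ^ 4)) * (bump 2 z r u * cnj (u - z)))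
    (\<lambda>u. - (12 / of_real (r ^ 4)) * (- (of_nat 2 / of_real (r\<^sup>2)) * (bump (2 - 1) z r u * (cnj (u - z))\<^sup>2)))
    (cp_weight'' z r)"
    by (rule wirtinger_on_transform[OF wirtinger_on_cmult[OF wirtinger_on_bump_mult(2)[of 2 z r], where c="- (12 / of_real (r ^ 4))"] open_UNIV])
       (simp_all add: cp_weight''_def)
qed

lemma wirtinger_on_cp_weight'_second:
  obtains b where "wirtinger_on UNIV (cp_weight' z r) (cp_weight'' z r) b"
proof (rule that)
  show "wirtinger_on UNIV (cp_weight' z r) (cp_weight'' z r)
    (\<lambda>u. - (12 / of_real (r ^ 4)) * (- (of_nat 2 / of_real (r\<^sup>2)) * (bump (2 - 1) z r u * (u - z)\<^sup>2)))"
    by (rule wirtinger_on_transform[OF wirtinger_on_cmult[OF wirtinger_on_bump_mult(1)[of 2 z r], where c="- (12 / of_real (r ^ 4))"] open_UNIV])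
       (simp_all add: cp_weight''_def cp_weight'_def)
qed

lemma cp_weight_zero:
  assumes "r > 0" "u \<notin> ball z r"
  shows "cp_weight z r u = 0" "cp_weight' z r u = 0" "cp_weight'' z r u = 0"
    "- (12 / of_real (r ^ 4)) * (bump 2 z r u * cnj (u - z)) = 0"
  using assms by (simp_all add: cp_weight_def cp_weight'_def cp_weight''_def bump_zero)

lemma cp_weight_bounds:
  assumes "r > 0"
  shows "cmod (cp_weight z r u) \<le> 4 / r ^ 2" "cmod (cp_weight' z r u) \<le> 12 / r ^ 3"
    "cmod (cp_weight'' z r u) \<le> 36 / r ^ 4"
proof -
  show "cmod (cp_weight z r u) \<le> 4 / r ^ 2"
    using bump_norm_le[of 3 z r u] assms by (simp add: cp_weight_def norm_mult norm_divide norm_power divide_le_cancel)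
  show "cmod (cp_weight' z r u) \<le> 12 / r ^ 3"
  proof (cases "u \<in> ball z r")
    case True
    then have "cmod (bump 2 z r u) * cmod (u - z) \<le> 1 * r"
      by (intro mult_mono bump_norm_le) (auto simp: dist_norm norm_minus_commute)
    then have "12 / r ^ 4 * (cmod (bump 2 z r u) * cmod (u - z)) \<le> 12 / r ^ 4 * (1 * r)"
      using assms by (intro mult_left_mono) auto
    also have "\<dots> = 12 / r ^ 3" using assms by (simp add: field_simps eval_nat_numeral)
    finally show ?thesis using assms by (simp add: cp_weight'_def norm_mult norm_divide norm_power)
  qed (use assms in \<open>simp add: cp_weight_zero\<close>)
  show "cmod (cp_weight'' z r u) \<le> 36 / r ^ 4"
  proof (cases "u \<in> ball z r")
    case True
    then have "(cmod (u - z))\<^sup>2 \<le> r\<^sup>2" by (intro power_mono) (auto simp: dist_norm norm_minus_commute)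
    then have "cmod (bump 1 z r u) * (cmod (u - z))\<^sup>2 \<le> 1 * r\<^sup>2"
      by (intro mult_mono bump_norm_le) auto
    then have "2 / r\<^sup>2 * (cmod (bump 1 z r u) * (cmod (u - z))\<^sup>2) \<le> 2 / r\<^sup>2 * (1 * r\<^sup>2)"
      using assms by (intro mult_left_mono) auto
    then have "cmod (2 / of_real (r\<^sup>2) * (bump 1 z r u * of_real ((cmod (u - z))\<^sup>2))) \<le> 2"
      using assms by (simp add: norm_mult norm_divide norm_power)
    then have "cmod (bump 2 z r u - 2 / of_real (r\<^sup>2) * (bump 1 z r u * of_real ((cmod (u - z))\<^sup>2))) \<le> 1 + 2"
      using bump_norm_le[of 2 z r u] by (intro order_trans[OF norm_triangle_ineq4]) linarith
    then have "12 / r ^ 4 * cmod (bump 2 z r u - 2 / of_real (r\<^sup>2) * (bump 1 z r u * of_real ((cmod (u - z))\<^sup>2))) \<le> 12 / r ^ 4 * 3"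
      using assms by (intro mult_left_mono) auto
    moreover have n: "cmod (- (12 / complex_of_real (r ^ 4))) = 12 / r ^ 4"
      using assms by (simp add: norm_divide norm_power)
    ultimately show ?thesis unfolding cp_weight''_def norm_mult n by simp
  qed (use assms in \<open>simp add: cp_weight_zero\<close>)
qed

text \<open>The local formula for the constant function 1, whose error term is zero.\<close>

lemma integral_cp_weight: "r > 0 \<Longrightarrow> integral\<^sup>L lborel (cp_weight z r) = of_real cp_const"
  using cauchy_pompeiu_local[OF wirtinger_on_const[of UNIV 1] open_UNIV subset_UNIV, of r z]
  by (simp add: cp_weight_def[abs_def])

lemma integral_norm_cp_weight: 
  assumes "r > 0"
  shows "integrable lborel (cp_weight z r)" "(LBINT u. cmod (cp_weight z r u)) = cp_const"
proof -
  show i: "integrable lborel (cp_weight z r)"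
    by (rule integrable_compact_support[OF wirtinger_on_continuous[OF wirtinger_on_cp_weight] _ compact_cball[of z r]])
       (use assms in \<open>auto intro!: cp_weight_zero\<close>)
  have "complex_of_real (cmod (cp_weight z r u)) = cp_weight z r u" for u
    by (simp add: cp_weight_def bump_def pos_pow_def norm_mult norm_divide norm_power)
  then have "complex_of_real ((LBINT u. cmod (cp_weight z r u))) = of_real cp_const"
    using integral_cp_weight[OF assms, of z] by (simp flip: integral_complex_of_real)
  then show "(LBINT u. cmod (cp_weight z r u)) = cp_const" by simp
qed

text \<open>
  Schwarz' theorem: both mixed derivatives have the same integral against every weight.
\<close>

lemma wirtinger_mixed_symmetric:
  assumes F: "wirtinger_on S F a b" and a: "wirtinger_on S a a1 a2" and b: "wirtinger_on S b b1 b2"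
    and S: "open S" and z: "z \<in> S"
  shows "a2 z = b1 z"
proof (rule ccontr)
  assume ne: "a2 z \<noteq> b1 z"
  define e where "e u = a2 u - b1 u" for u
  have ce: "continuous_on S e" unfolding e_def by (intro continuous_intros wirtinger_onD(3)[OF a] wirtinger_onD(2)[OF b])
  have ez: "cmod (e z) > 0" using ne by (simp add: e_def)
  have "isCont e z" using ce S z by (simp add: continuous_on_eq_continuous_at)
  \<comment> \<open>Within this radius \<open>e\<close> differs from \<open>e z\<close> by less than
    half of |e z|, so its mean with a nonnegative weight cannot be 0.\<close>
  then obtain r1 where r1: "r1 > 0" "\<And>w. dist w z < r1 \<Longrightarrow> dist (e w) (e z) < cmod (e z) / 2"
    unfolding continuous_at_eps_delta using ez half_gt_zero by metis
  obtain r2 where r2: "r2 > 0" "cball z r2 \<subseteq> S" using S z open_contains_cball by metis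
  define r where "r = min r2 (r1 / 2)"
  have r: "r > 0" "cball z r \<subseteq> S" using r1 r2 by (auto simp: r_def)
  let ?w = "cp_weight z r" and ?K = "cball z r"
  have K: "compact ?K" by simp
  have w0: "u \<notin> ?K \<Longrightarrow> ?w u = 0" "u \<notin> ?K \<Longrightarrow> cp_weight' z r u = 0" 
    "u \<notin> ?K \<Longrightarrow> - (12 / of_real (r ^ 4)) * (bump 2 z r u * cnj (u - z)) = 0" for u
    using r by (auto intro!: cp_weight_zero bump_zero)
  obtain a3 where a3: "wirtinger_on UNIV (\<lambda>u. - (12 / of_real (r ^ 4)) * (bump 2 z r u * cnj (u - z))) a3 (cp_weight'' z r)"
    by (rule wirtinger_on_cp_weight_second)
  obtain b3 where b3: "wirtinger_on UNIV (cp_weight' z r) (cp_weight'' z r) b3"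
    by (rule wirtinger_on_cp_weight'_second)
  have "(LBINT u. a2 u * ?w u) = - (LBINT u. a u * cp_weight' z r u)"
    by (rule integration_by_parts_wirtinger(2)[OF a wirtinger_on_cp_weight S K r(2)]) (rule w0)
  also have "\<dots> = (LBINT u. F u * cp_weight'' z r u)"
    by (subst integration_by_parts_wirtinger(1)[OF F b3 S K r(2)]) (auto intro: w0)
  also have "\<dots> = - (LBINT u. b u * (- (12 / of_real (r ^ 4)) * (bump 2 z r u * cnj (u - z))))"
    by (subst integration_by_parts_wirtinger(2)[OF F a3 S K r(2)]) (erule w0(3) | simp)+
  also have "\<dots> = (LBINT u. b1 u * ?w u)"
    by (subst integration_by_parts_wirtinger(1)[OF b wirtinger_on_cp_weight S K r(2)]) (auto intro: w0)
  finally have eq: "(LBINT u. a2 u * ?w u) = (LBINT u. b1 u * ?w u)" .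
  have i: "integrable lborel (\<lambda>u. a2 u * ?w u)" "integrable lborel (\<lambda>u. b1 u * ?w u)"
    by (rule integration_by_parts_wirtinger(5)[OF a wirtinger_on_cp_weight S K r(2)], rule w0, assumption)
       (rule integration_by_parts_wirtinger(3)[OF b wirtinger_on_cp_weight S K r(2)], rule w0)
  have ie: "integrable lborel (\<lambda>u. e u * ?w u)" using Bochner_Integration.integrable_diff[OF i] by (simp add: e_def left_diff_distrib)
  have "(LBINT u. e u * ?w u) = 0"
    using Bochner_Integration.integral_diff[OF i] eq by (simp add: e_def left_diff_distrib)
  then have "e z * of_real cp_const = (LBINT u. e z * ?w u) - (LBINT u. e u * ?w u)"
    using integral_cp_weight[OF r(1), of z] by simp
  also have "\<dots> = (LBINT u. e z * ?w u - e u * ?w u)"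
    using ie integral_norm_cp_weight(1)[OF r(1)] by simp
  also have "cmod \<dots> \<le> (LBINT u. cmod (e z) / 2 * cmod (?w u))"
  proof (rule norm_integral_le)
    show "integrable lborel (\<lambda>u. e z * ?w u - e u * ?w u)" using ie integral_norm_cp_weight(1)[OF r(1)] by simp
    show "integrable lborel (\<lambda>u. cmod (e z) / 2 * cmod (?w u))" using integral_norm_cp_weight(1)[OF r(1)] by simp
    fix u
    show "cmod (e z * ?w u - e u * ?w u) \<le> cmod (e z) / 2 * cmod (?w u)"
    proof (cases "u \<in> ball z r")
      case True
      then have "dist u z < r1" using r1(1) by (auto simp: r_def dist_commute)
      then have "cmod (e z - e u) \<le> cmod (e z) / 2"
        using r1(2)[of u] by (simp add: dist_norm norm_minus_commute less_imp_le)
      then show ?thesis unfolding left_diff_distrib[symmetric] norm_mult by (rule mult_right_mono) simp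
    qed (use r in \<open>simp add: cp_weight_zero\<close>)
  qed
  also have "\<dots> = cmod (e z) / 2 * cp_const" using integral_norm_cp_weight[OF r(1), of z] by simp
  finally have "cmod (e z) * cp_const \<le> cmod (e z) / 2 * cp_const" using cp_const_pos by (simp add: norm_mult)
  then show False using mult_pos_pos[OF ez cp_const_pos] by (simp add: mult.commute)
qed

text \<open>The L^1 norm is the one that appears when derivatives of f are moved to a bounded
  weight; the passage to the energy is left to \<open>local_energy_ge\<close>.\<close>

definition ball_mass :: "(complex \<Rightarrow> complex) \<Rightarrow> complex \<Rightarrow> real \<Rightarrow> ennreal" where
  "ball_mass f z r = (\<integral>\<^sup>+u. ennreal (cmod (f u)) * indicator (ball z r) u \<partial>lborel)"

lemma ball_mass_mono: "ball z r \<subseteq> ball z' r' \<Longrightarrow> ball_mass f z r \<le> ball_mass f z' r'"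
  unfolding ball_mass_def by (intro nn_integral_mono mult_left_mono) (auto simp: indicator_def)

lemma norm_integral_weight_le:
  assumes f: "continuous_on S f" and S: "ball z r \<subseteq> S"
    and w: "\<And>u. cmod (w u) \<le> c" "\<And>u. u \<notin> ball z r \<Longrightarrow> w u = 0"
    and i: "integrable lborel (\<lambda>u. f u * w u)"
  shows "ennreal (cmod ((LBINT u. f u * w u))) \<le> ennreal c * ball_mass f z r"
proof -
  have c: "c \<ge> 0" using w(1)[of 0] norm_ge_zero order_trans by blast
  have "(\<lambda>u. indicator (ball z r) u *\<^sub>R f u) \<in> borel_measurable borel"
    by (rule borel_measurable_continuous_on_indicator) (use continuous_on_subset[OF f S] in auto)
  note [measurable] = this
  have eq: "(\<lambda>u. ennreal (cmod (indicator (ball z r) u *\<^sub>R f u))) = (\<lambda>u. ennreal (cmod (f u)) * indicator (ball z r) u)"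
    by (auto simp: indicator_def)
  have m: "(\<lambda>u. ennreal (cmod (f u)) * indicator (ball z r) u) \<in> borel_measurable lborel"
    unfolding eq[symmetric] by measurable
  have "ennreal (cmod ((LBINT u. f u * w u))) \<le> (\<integral>\<^sup>+u. ennreal (norm (f u * w u)) \<partial>lborel)"
    by (rule integral_norm_bound_ennreal[OF i])
  also have "\<dots> \<le> (\<integral>\<^sup>+u. ennreal c * (ennreal (cmod (f u)) * indicator (ball z r) u) \<partial>lborel)"
  proof (rule nn_integral_mono)
    fix u
    show "ennreal (norm (f u * w u)) \<le> ennreal c * (ennreal (cmod (f u)) * indicator (ball z r) u)"
    proof (cases "u \<in> ball z r")
      case True
      have "norm (f u * w u) \<le> c * cmod (f u)" using mult_right_mono[OF w(1)[of u], of "cmod (f u)"] by (simp add: norm_mult mult.commute)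
      then show ?thesis using True c by (simp add: ennreal_mult[symmetric] ennreal_leI)
    qed (simp add: w)
  qed
  also have "\<dots> = ennreal c * ball_mass f z r" unfolding ball_mass_def by (rule nn_integral_cmult[OF m])
  finally show ?thesis .
qed

lemma integral_zbar_derivative_le:
  assumes f: "wirtinger_on S f a b" and S: "open S" "cball z r \<subseteq> S" and r: "r > 0"
  shows "ennreal (cmod ((LBINT u. b u * cp_weight z r u))) \<le> ennreal (12 / r ^ 3) * ball_mass f z r"
proof -
  have w0: "\<And>u. u \<notin> cball z r \<Longrightarrow> cp_weight z r u = 0" using r by (auto intro!: cp_weight_zero)
  note ibp = integration_by_parts_wirtinger[OF f wirtinger_on_cp_weight S(1) compact_cball S(2)]
  have "(LBINT u. b u * cp_weight z r u) = - (LBINT u. f u * cp_weight' z r u)"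
    by (rule ibp(2)) (rule w0)
  moreover have "integrable lborel (\<lambda>u. f u * cp_weight' z r u)" by (rule ibp(6)) (rule w0)
  then have "ennreal (cmod ((LBINT u. f u * cp_weight' z r u))) \<le> ennreal (12 / r ^ 3) * ball_mass f z r"
    using r S(2) by (intro norm_integral_weight_le[OF wirtinger_on_continuous[OF f]] cp_weight_bounds cp_weight_zero) auto
  ultimately show ?thesis by simp
qed

text \<open>Two integrations by parts, first in z and then in \<open>cnj z\<close>, leave f against
  \<open>cp_weight''\<close>; hence the power r^(-4).\<close>

lemma integral_second_derivative_le:
  assumes f: "wirtinger_on S f a b" and b: "wirtinger_on S b b1 b2"
    and S: "open S" "cball z r \<subseteq> S" and r: "r > 0"
  shows "ennreal (cmod ((LBINT u. b1 u * cp_weight z r u))) \<le> ennreal (36 / r ^ 4) * ball_mass f z r"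
proof -
  have w0: "\<And>u. u \<notin> cball z r \<Longrightarrow> cp_weight z r u = 0"
    "\<And>u. u \<notin> cball z r \<Longrightarrow> - (12 / of_real (r ^ 4)) * (bump 2 z r u * cnj (u - z)) = 0"
    using r by (auto intro!: cp_weight_zero bump_zero)
  obtain a3 where a3: "wirtinger_on UNIV (\<lambda>u. - (12 / of_real (r ^ 4)) * (bump 2 z r u * cnj (u - z))) a3 (cp_weight'' z r)"
    by (rule wirtinger_on_cp_weight_second)
  note ibp = integration_by_parts_wirtinger[OF f a3 S(1) compact_cball S(2)]
  have "(LBINT u. b1 u * cp_weight z r u)
     = - (LBINT u. b u * (- (12 / of_real (r ^ 4)) * (bump 2 z r u * cnj (u - z))))"
    by (rule integration_by_parts_wirtinger(1)[OF b wirtinger_on_cp_weight S(1) compact_cball S(2)]) (rule w0)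
  also have "\<dots> = (LBINT u. f u * cp_weight'' z r u)"
    by (subst ibp(2)) (erule w0(2) | simp)+
  finally have "(LBINT u. b1 u * cp_weight z r u) = (LBINT u. f u * cp_weight'' z r u)" .
  moreover have "integrable lborel (\<lambda>u. f u * cp_weight'' z r u)" by (rule ibp(6)) (rule w0)
  then have "ennreal (cmod ((LBINT u. f u * cp_weight'' z r u))) \<le> ennreal (36 / r ^ 4) * ball_mass f z r"
    using r S(2) by (intro norm_integral_weight_le[OF wirtinger_on_continuous[OF f]] cp_weight_bounds cp_weight_zero) auto
  ultimately show ?thesis by simp
qed

section \<open>Interior bounds and the integrating factor\<close>

definition outer :: "real \<Rightarrow> complex set" where
  "outer r = {z. r < cmod z}"

lemma open_outer [simp]: "open (outer r)"
  unfolding outer_def by (intro open_Collect_less continuous_intros)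

lemma cball_subset_outer: "t + r < cmod z \<Longrightarrow> cball z r \<subseteq> outer t"
proof
  fix x assume "t + r < cmod z" "x \<in> cball z r"
  then show "x \<in> outer t" using norm_triangle_sub[of z x] by (simp add: outer_def dist_norm)
qed

text \<open>The truncated potential of |f| whose uniform smallness for small r defines the Kato
  class in this first order setting. The restriction to \<open>outer 1\<close> ignores the values of
  f where nothing is assumed about it.\<close>

definition kato :: "(complex \<Rightarrow> complex) \<Rightarrow> real \<Rightarrow> complex \<Rightarrow> ennreal" where
  "kato f r z = (\<integral>\<^sup>+u. ennreal (cmod (f u) / cmod (z - u)) * indicator (ball z r \<inter> outer 1) u \<partial>lborel)"

lemma kato_mono: "r \<le> s \<Longrightarrow> kato f r z \<le> kato f s z"
  unfolding kato_def by (intro nn_integral_mono mult_left_mono) (auto simp: indicator_def)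

lemma kato_cmult:
  assumes "continuous_on (outer 1) f"
  shows "(\<integral>\<^sup>+u. ennreal c * (ennreal (cmod (f u) / cmod (z - u)) * indicator (ball z r \<inter> outer 1) u) \<partial>lborel)
    = ennreal c * kato f r z"
  unfolding kato_def
proof (rule nn_integral_cmult)
  have [measurable]: "(\<lambda>u. indicator (ball z r \<inter> outer 1) u *\<^sub>R f u) \<in> borel_measurable borel"
    by (rule borel_measurable_continuous_on_indicator) (auto intro: continuous_on_subset[OF assms])
  have eq: "(\<lambda>u. ennreal (cmod (f u) / cmod (z - u)) * indicator (ball z r \<inter> outer 1) u)
     = (\<lambda>u. ennreal (cmod (indicator (ball z r \<inter> outer 1) u *\<^sub>R f u) / cmod (z - u)))"
    by (auto simp: indicator_def)
  show "(\<lambda>u. ennreal (cmod (f u) / cmod (z - u)) * indicator (ball z r \<inter> outer 1) u) \<in> borel_measurable lborel"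
    unfolding eq by measurable
qed

lemma ball_mass_le_kato:
  assumes "r \<le> 1" "ball z r \<subseteq> outer 1"
  shows "ball_mass f z r \<le> kato f r z"
  unfolding ball_mass_def kato_def
proof (rule nn_integral_mono_AE)
  \<comment> \<open>At u = z the quotient is 0 by the convention for division, so the pointwise
    bound may fail there.\<close>
  have "AE u in lborel. u \<noteq> z" by (rule AE_lborel_singleton)
  then show "AE u in lborel. ennreal (cmod (f u)) * indicator (ball z r) u
     \<le> ennreal (cmod (f u) / cmod (z - u)) * indicator (ball z r \<inter> outer 1) u"
  proof eventually_elim
    case (elim u)
    show ?case
    proof (cases "u \<in> ball z r")
      case True
      then have "0 < cmod (z - u)" "cmod (z - u) \<le> 1" using assms elim by (auto simp: dist_norm)
      then have "cmod (f u) \<le> cmod (f u) / cmod (z - u)"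
        by (simp add: pos_le_divide_eq mult_left_le)
      then show ?thesis using True assms(2) by (auto intro!: ennreal_leI simp: indicator_def)
    qed simp
  qed
qed

text \<open>
  No energy estimate is needed.  At a maximum point of \<open>d\<^sup>4 |g|\<close> on the ball, \<open>d\<close> being the distance to
  the boundary, the error term of the local Cauchy--Pompeiu formula at scale \<open>\<rho> d\<close> is absorbed by
  the smallness of the Kato integral, and in the main term both derivatives are moved to the weight.
\<close>

lemma norm_le_ball_mass_gradient:
  assumes f: "wirtinger_on (outer 1) f fz fb" and \<omega>: "\<And>z. z \<in> outer 1 \<Longrightarrow> \<omega> z = 2 * \<i> * fb z"
    and W: "wirtinger_on (outer 1) \<omega> g gb" and g: "wirtinger_on (outer 1) g gz gzb"
    and le: "\<And>z. z \<in> outer 1 \<Longrightarrow> cmod (gzb z) \<le> c * (cmod (f z) * cmod (g z))" and c: "c \<ge> 0"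
    and K1: "\<And>\<eta>. \<eta> > 0 \<Longrightarrow> \<exists>\<rho>>0. \<forall>z. kato f \<rho> z \<le> ennreal \<eta>"
  obtains C where "C > 0" "\<And>z. cmod z \<ge> 2 \<Longrightarrow> ennreal (cmod (g z)) \<le> ennreal C * ball_mass f z (1/2)"
proof -
  let ?\<kappa> = cp_const
  note \<kappa> = cp_const_pos
  have fbW: "wirtinger_on (outer 1) fb (\<lambda>z. - (\<i> / 2) * g z) (\<lambda>z. - (\<i> / 2) * gb z)"
    by (rule wirtinger_on_transform[OF wirtinger_on_cmult[OF W, where c="- (\<i> / 2)"]])
       (auto simp: \<omega>)
  \<comment> \<open>On \<open>cball zs r\<close> the distance \<open>d\<close> is at least half of
    \<open>d zs\<close>, so |g| is at most 2^4 |g zs| by maximality. The remaining factor 2 of 32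
    makes the error term at most half of the left side, and c + 1 guards against c = 0.\<close>
  define \<eta> where "\<eta> = ?\<kappa> / (32 * (c + 1))"
  have "\<eta> > 0" using \<kappa> c by (simp add: \<eta>_def)
  obtain \<rho>1 where \<rho>1: "\<rho>1 > 0" "\<And>z. kato f \<rho>1 z \<le> ennreal \<eta>" using K1[OF \<open>\<eta> > 0\<close>] by blast
  define \<rho> where "\<rho> = min \<rho>1 (1/2)"
  have \<rho>: "\<rho> > 0" "\<rho> \<le> 1/2" using \<rho>1 by (auto simp: \<rho>_def)
  have K\<rho>: "kato f r z \<le> ennreal \<eta>" if "r \<le> \<rho>" for r z
    using kato_mono[of r \<rho>1 f z] \<rho>1(2)[of z] that by (auto simp: \<rho>_def intro: order_trans)
  \<comment> \<open>2304 = 16 * 2 * 2 * 36: from (1/2)^4 at the centre, from the absorbed half, from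
    the factor 1/2 between \<open>g\<close> and the mixed derivative of f, and from the bound on
    \<open>cp_weight''\<close>.\<close>
  define C where "C = 2304 / (?\<kappa> * \<rho> ^ 4)"
  have "C > 0" using \<kappa> \<rho> by (simp add: C_def)
  moreover have "ennreal (cmod (g z0)) \<le> ennreal C * ball_mass f z0 (1/2)" if z0: "cmod z0 \<ge> 2" for z0
  proof (cases "g z0 = 0")
    case False
    define d where "d z = 1/2 - dist z0 z" for z
    have sub: "cball z0 (1/2) \<subseteq> outer 1" using z0 by (intro cball_subset_outer) auto
    have cg: "continuous_on (outer 1) g" by (rule wirtinger_on_continuous[OF g])
    \<comment> \<open>The exponent 4 is the order of the loss r^(-4) in the second derivative bound:
      with r = \<rho> * d zs the powers of \<open>d zs\<close> cancel in the end.\<close>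
    have "continuous_on (cball z0 (1/2)) (\<lambda>z. d z ^ 4 * cmod (g z))"
      unfolding d_def by (intro continuous_intros continuous_on_subset[OF cg sub])
    from continuous_attains_sup[OF compact_cball _ this] obtain zs where zs: "zs \<in> cball z0 (1/2)"
      and max: "\<And>z. z \<in> cball z0 (1/2) \<Longrightarrow> d z ^ 4 * cmod (g z) \<le> d zs ^ 4 * cmod (g zs)" by auto
    have g0: "(1/2) ^ 4 * cmod (g z0) \<le> d zs ^ 4 * cmod (g zs)" using max[of z0] by (simp add: d_def)
    have "0 < (1/2) ^ 4 * cmod (g z0)" using False by simp
    then have "d zs \<noteq> 0" using g0 by auto
    then have ds: "0 < d zs" "d zs \<le> 1/2" using zs by (auto simp: d_def)
    define r where "r = \<rho> * d zs"
    have r: "r > 0" "r \<le> d zs / 2" using \<rho> ds mult_right_mono[of \<rho> "1/2" "d zs"] by (auto simp: r_def)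
    have "r \<le> \<rho> * 1" unfolding r_def using \<rho> ds by (intro mult_left_mono) auto
    then have r\<rho>: "r \<le> \<rho>" by simp
    have sub2: "cball zs r \<subseteq> ball z0 (1/2)"
    proof
      fix x assume "x \<in> cball zs r"
      then have "dist z0 x \<le> dist z0 zs + r" using dist_triangle[of z0 x zs] by auto
      also have "\<dots> < 1/2" using r ds by (simp add: d_def)
      finally show "x \<in> ball z0 (1/2)" by simp
    qed
    have gle: "cmod (g x) \<le> 16 * cmod (g zs)" if x: "x \<in> cball zs r" for x
    proof -
      have "dist z0 x \<le> dist z0 zs + r" using dist_triangle[of z0 x zs] x by auto
      then have dx: "d zs / 2 \<le> d x" using r by (simp add: d_def)
      have "x \<in> cball z0 (1/2)" using sub2 x by auto
      have "(d zs / 2) ^ 4 * cmod (g x) \<le> d x ^ 4 * cmod (g x)"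
        using dx ds by (intro mult_right_mono power_mono) auto
      also have "\<dots> \<le> d zs ^ 4 * cmod (g zs)" by (rule max) fact
      finally have "d zs ^ 4 * cmod (g x) \<le> d zs ^ 4 * (16 * cmod (g zs))" by (simp add: power_divide)
      then show ?thesis using ds by simp
    qed
    have S: "cball zs r \<subseteq> outer 1" using sub2 sub ball_subset_cball by blast
    let ?I = "(LBINT u. g u * cp_weight zs r u)"
    have "ennreal (cmod (of_real ?\<kappa> * g zs - ?I))
      \<le> (\<integral>\<^sup>+u. ennreal (cmod (gzb u) / cmod (zs - u)) * indicator (ball zs r) u \<partial>lborel)"
      using cauchy_pompeiu_local[OF g open_outer S r(1)] by (simp add: cp_weight_def)
    also have "\<dots> \<le> (\<integral>\<^sup>+u. ennreal (16 * c * cmod (g zs)) * (ennreal (cmod (f u) / cmod (zs - u)) * indicator (ball zs r \<inter> outer 1) u) \<partial>lborel)"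
    proof (rule nn_integral_mono)
      fix u
      show "ennreal (cmod (gzb u) / cmod (zs - u)) * indicator (ball zs r) u
        \<le> ennreal (16 * c * cmod (g zs)) * (ennreal (cmod (f u) / cmod (zs - u)) * indicator (ball zs r \<inter> outer 1) u)"
      proof (cases "u \<in> ball zs r")
        case True
        then have u: "u \<in> outer 1" "u \<in> cball zs r" using S by auto
        have "cmod (gzb u) \<le> c * (cmod (f u) * (16 * cmod (g zs)))"
          using le[OF u(1)] gle[OF u(2)] c by (meson order_trans mult_left_mono norm_ge_zero)
        then have "cmod (gzb u) / cmod (zs - u) \<le> c * (cmod (f u) * (16 * cmod (g zs))) / cmod (zs - u)"
          by (rule divide_right_mono) simp
        then have "cmod (gzb u) / cmod (zs - u) \<le> (16 * c * cmod (g zs)) * (cmod (f u) / cmod (zs - u))"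
          by (simp add: mult_ac)
        then show ?thesis using True u c by (simp add: ennreal_mult[symmetric] ennreal_leI)
      qed simp
    qed
    also have "\<dots> = ennreal (16 * c * cmod (g zs)) * kato f r zs"
      by (rule kato_cmult[OF wirtinger_on_continuous[OF f]])
    also have "\<dots> \<le> ennreal (16 * c * cmod (g zs)) * ennreal \<eta>" by (intro mult_left_mono K\<rho> r\<rho>) simp
    also have "\<dots> = ennreal (16 * c * cmod (g zs) * \<eta>)" using c \<open>\<eta> > 0\<close> by (simp add: ennreal_mult)
    finally have "cmod (of_real ?\<kappa> * g zs - ?I) \<le> 16 * c * cmod (g zs) * \<eta>"
      using c \<open>\<eta> > 0\<close> by (subst (asm) ennreal_le_iff) auto
    also have "\<dots> \<le> ?\<kappa> / 2 * cmod (g zs)"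
    proof -
      have "16 * c * \<eta> = ?\<kappa> / 2 * (c / (c + 1))" using c by (simp add: \<eta>_def field_simps)
      also have "\<dots> \<le> ?\<kappa> / 2 * 1" using c \<kappa> by (intro mult_left_mono) auto
      finally have "16 * c * \<eta> * cmod (g zs) \<le> ?\<kappa> / 2 * 1 * cmod (g zs)" by (rule mult_right_mono) simp
      then show ?thesis by (simp add: mult_ac)
    qed
    finally have "?\<kappa> * cmod (g zs) - cmod ?I \<le> ?\<kappa> / 2 * cmod (g zs)"
      using norm_triangle_ineq2[of "of_real ?\<kappa> * g zs" ?I] \<kappa> by (simp add: norm_mult)
    then have "?\<kappa> / 2 * cmod (g zs) \<le> cmod ?I" by (simp add: field_simps)
    then have "ennreal (?\<kappa> / 2 * cmod (g zs)) \<le> ennreal (cmod ?I)" by (rule ennreal_leI)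
    also have "\<dots> \<le> ennreal (2 * (36 / r ^ 4)) * ball_mass f zs r"
    proof -
      have "ennreal (cmod ((LBINT u. - (\<i> / 2) * g u * cp_weight zs r u))) \<le> ennreal (36 / r ^ 4) * ball_mass f zs r"
        by (rule integral_second_derivative_le[OF f fbW open_outer S r(1)])
      moreover have "(LBINT u. - (\<i> / 2) * g u * cp_weight zs r u) = - (\<i> / 2) * ?I"
        by (simp only: mult.assoc integral_mult_right_zero)
      ultimately have "ennreal (1 / 2 * cmod ?I) \<le> ennreal (36 / r ^ 4) * ball_mass f zs r"
        by (simp add: norm_mult norm_divide)
      then have "ennreal 2 * ennreal (1 / 2 * cmod ?I) \<le> ennreal 2 * (ennreal (36 / r ^ 4) * ball_mass f zs r)"
        by (rule mult_left_mono) simp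
      then show ?thesis using r by (simp add: ennreal_mult[symmetric] mult.assoc[symmetric] del: ennreal_numeral)
    qed
    also have "\<dots> \<le> ennreal (2 * (36 / r ^ 4)) * ball_mass f z0 (1/2)"
      by (intro mult_left_mono ball_mass_mono) (use sub2 ball_subset_cball in \<open>blast, simp\<close>)
    finally have main: "ennreal (?\<kappa> / 2 * cmod (g zs)) \<le> ennreal (2 * (36 / r ^ 4)) * ball_mass f z0 (1/2)" .
    have "cmod (g z0) \<le> (32 / ?\<kappa> * d zs ^ 4) * (?\<kappa> / 2 * cmod (g zs))"
      using g0 \<kappa> by (simp add: field_simps)
    then have "ennreal (cmod (g z0)) \<le> ennreal (32 / ?\<kappa> * d zs ^ 4) * ennreal (?\<kappa> / 2 * cmod (g zs))"
      using \<kappa> ds by (subst ennreal_mult[symmetric]) (auto intro: ennreal_leI)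
    also have "\<dots> \<le> ennreal (32 / ?\<kappa> * d zs ^ 4) * (ennreal (2 * (36 / r ^ 4)) * ball_mass f z0 (1/2))"
      by (intro mult_left_mono main) simp
    also have "\<dots> = ennreal ((32 / ?\<kappa> * d zs ^ 4) * (2 * (36 / r ^ 4))) * ball_mass f z0 (1/2)"
      using r \<kappa> ds by (subst ennreal_mult) (auto simp: mult.assoc)
    also have "(32 / ?\<kappa> * d zs ^ 4) * (2 * (36 / r ^ 4)) = C"
      using \<kappa> \<rho> ds by (simp add: C_def r_def power_mult_distrib field_simps)
    finally show ?thesis .
  qed simp
  ultimately show thesis by (rule that)
qed

text \<open>The mean value property with a weight: the error term of the local formula is zero when
  the derivative in \<open>cnj z\<close> vanishes.\<close>

lemma cauchy_pompeiu_holomorphic: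
  assumes G: "wirtinger_on S G a b" and S: "open S" "cball z r \<subseteq> S" and r: "r > 0"
    and b: "\<And>u. u \<in> S \<Longrightarrow> b u = 0"
  shows "of_real cp_const * G z = (LBINT u. G u * cp_weight z r u)"
proof -
  have "(\<lambda>u. ennreal (cmod (b u) / cmod (z - u)) * indicator (ball z r) u) = (\<lambda>u. 0)"
  proof
    fix u
    have "u \<in> ball z r \<Longrightarrow> u \<in> S" using S(2) ball_subset_cball[of z r] by blast
    then show "ennreal (cmod (b u) / cmod (z - u)) * indicator (ball z r) u = 0"
      using b[of u] by (auto simp: indicator_def)
  qed
  then have "ennreal (cmod (of_real cp_const * G z - (LBINT u. G u * cp_weight z r u))) \<le> 0"
    using cauchy_pompeiu_local[OF G S r] by (simp add: cp_weight_def)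
  then show ?thesis by (simp add: ennreal_eq_0_iff)
qed

text \<open>Mean value property for the holomorphic \<omega>, followed by moving its one derivative
  of f to the weight; 192 is 2 * 12 / (1/2)^3.\<close>

lemma norm_le_ball_mass_vorticity:
  assumes f: "wirtinger_on S f fz fb" and \<omega>: "\<And>z. z \<in> S \<Longrightarrow> \<omega> z = 2 * \<i> * fb z"
    and W: "wirtinger_on S \<omega> g gb" and gb: "\<And>z. z \<in> S \<Longrightarrow> gb z = 0"
    and S: "open S" "cball z (1/2) \<subseteq> S"
  shows "ennreal (cmod (\<omega> z)) \<le> ennreal (192 / cp_const) * ball_mass f z (1/2)"
proof -
  let ?I = "(LBINT u. fb u * cp_weight z (1/2) u)"
  have "of_real cp_const * \<omega> z = (LBINT u. \<omega> u * cp_weight z (1/2) u)"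
    by (rule cauchy_pompeiu_holomorphic[OF W S]) (use gb in auto)
  also have "(\<lambda>u. \<omega> u * cp_weight z (1/2) u) = (\<lambda>u. 2 * \<i> * (fb u * cp_weight z (1/2) u))"
  proof
    fix u
    have "u \<in> ball z (1/2) \<Longrightarrow> u \<in> S" using S(2) ball_subset_cball[of z "1/2"] by blast
    then show "\<omega> u * cp_weight z (1/2) u = 2 * \<i> * (fb u * cp_weight z (1/2) u)"
      using \<omega>[of u] cp_weight_zero(1)[of "1/2" u z] by (cases "u \<in> ball z (1/2)") simp_all
  qed
  also have "integral\<^sup>L lborel \<dots> = 2 * \<i> * ?I" by (rule integral_mult_right_zero)
  finally have "cmod (of_real cp_const * \<omega> z) = 2 * cmod ?I" by (simp add: norm_mult)
  then have "cmod (\<omega> z) = 2 / cp_const * cmod ?I" using cp_const_pos by (simp add: norm_mult field_simps)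
  then have "ennreal (cmod (\<omega> z)) = ennreal (2 / cp_const) * ennreal (cmod ?I)"
    using cp_const_pos by (simp only: ennreal_mult norm_ge_zero divide_nonneg_pos zero_le_one zero_le_numeral)
  also have "\<dots> \<le> ennreal (2 / cp_const) * (ennreal (12 / (1/2) ^ 3) * ball_mass f z (1/2))"
    by (intro mult_left_mono integral_zbar_derivative_le[OF f S]) auto
  also have "\<dots> = ennreal (2 / cp_const * (12 / (1/2) ^ 3)) * ball_mass f z (1/2)"
    using cp_const_pos by (subst ennreal_mult) (auto simp: mult.assoc)
  also have "2 / cp_const * (12 / (1/2) ^ 3) = 192 / cp_const" by (simp add: eval_nat_numeral)
  finally show ?thesis .
qed

lemma norm_le_ball_mass_velocity:
  assumes f: "wirtinger_on S f fz fb" and fb: "\<And>z. z \<in> S \<Longrightarrow> fb z = 0"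
    and S: "open S" "cball z (1/2) \<subseteq> S"
  shows "ennreal (cmod (f z)) \<le> ennreal (16 / cp_const) * ball_mass f z (1/2)"
proof -
  let ?I = "(LBINT u. f u * cp_weight z (1/2) u)"
  have "of_real cp_const * f z = ?I"
    by (rule cauchy_pompeiu_holomorphic[OF f S]) (use fb in auto)
  then have "cmod (of_real cp_const * f z) = cmod ?I" by simp
  then have "cmod (f z) = 1 / cp_const * cmod ?I" using cp_const_pos by (simp add: norm_mult field_simps)
  then have "ennreal (cmod (f z)) = ennreal (1 / cp_const) * ennreal (cmod ?I)"
    using cp_const_pos by (simp only: ennreal_mult norm_ge_zero divide_nonneg_pos zero_le_one zero_le_numeral)
  also have "\<dots> \<le> ennreal (1 / cp_const) * (ennreal (4 / (1/2) ^ 2) * ball_mass f z (1/2))"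
  proof (intro mult_left_mono norm_integral_weight_le[OF wirtinger_on_continuous[OF f]])
    show "integrable lborel (\<lambda>u. f u * cp_weight z (1/2) u)"
      by (rule integrable_compact_support[of _ "cball z (1/2)"])
         (auto intro!: wirtinger_on_continuous wirtinger_on_cutoff(1)[OF f wirtinger_on_cp_weight S(1) closed_cball S(2)] cp_weight_zero)
  qed (use S(2) ball_subset_cball in \<open>auto intro!: cp_weight_bounds cp_weight_zero\<close>)
  also have "\<dots> = ennreal (1 / cp_const * (4 / (1/2) ^ 2)) * ball_mass f z (1/2)"
    using cp_const_pos by (subst ennreal_mult) (auto simp: mult.assoc)
  also have "1 / cp_const * (4 / (1/2) ^ 2) = 16 / cp_const" by (simp add: eval_nat_numeral)
  finally show ?thesis .
qed

text \<open>A continuously differentiable step from 0 at t = 0 to 1 at t = 1, assembled from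
  truncated squares so that the Wirtinger rules apply to it.\<close>

definition smooth_step :: "complex \<Rightarrow> complex" where
  "smooth_step t = 1 - pos_pow 2 (1 - pos_pow 2 t)"

lemma smooth_step:
  shows smooth_step_0: "t \<le> 0 \<Longrightarrow> smooth_step (of_real t) = 0"
    and smooth_step_1: "t \<ge> 1 \<Longrightarrow> smooth_step (of_real t) = 1"
    and norm_smooth_step_le: "cmod (smooth_step (of_real t)) \<le> 1"
proof -
  define s where "s = max 0 (1 - max 0 t ^ 2) ^ 2"
  have eq: "smooth_step (of_real t) = of_real (1 - s)"
    by (simp add: smooth_step_def pos_pow_def s_def)
  show "t \<le> 0 \<Longrightarrow> smooth_step (of_real t) = 0" unfolding eq s_def by (simp add: max_def)
  show "t \<ge> 1 \<Longrightarrow> smooth_step (of_real t) = 1"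
  proof -
    assume "t \<ge> 1"
    then have "1 \<le> max 0 t ^ 2" by (simp add: one_le_power)
    then show ?thesis unfolding eq s_def by (simp add: max_def)
  qed
  have "0 \<le> s" "s \<le> 1" unfolding s_def by (auto intro!: power_le_one)
  then show "cmod (smooth_step (of_real t)) \<le> 1" unfolding eq norm_of_real by simp
qed

lemma wirtinger_on_smooth_step:
  assumes "wirtinger_on S F a b"
  shows "\<exists>p q. wirtinger_on S (\<lambda>z. smooth_step (F z)) p q"
  unfolding smooth_step_def
  using wirtinger_on_diff[OF wirtinger_on_const wirtinger_on_pos_pow[OF wirtinger_on_diff[OF wirtinger_on_const
     wirtinger_on_pos_pow[OF assms order_refl]] order_refl]] by blast

lemma wirtinger_ex_mult:
  "\<exists>p q. wirtinger_on S F p q \<Longrightarrow> \<exists>p q. wirtinger_on S G p q \<Longrightarrow> \<exists>p q. wirtinger_on S (\<lambda>z. F z * G z) p q"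
  by (elim exE) (rule exI, rule exI, erule (1) wirtinger_on_mult)

lemma wirtinger_ex_add:
  "\<exists>p q. wirtinger_on S F p q \<Longrightarrow> \<exists>p q. wirtinger_on S G p q \<Longrightarrow> \<exists>p q. wirtinger_on S (\<lambda>z. F z + G z) p q"
  by (elim exE) (rule exI, rule exI, erule (1) wirtinger_on_add)

text \<open>
  The true coefficient involves \<open>cnj g / g\<close>, which is discontinuous at the zeros of \<open>g\<close>; the regularised
  one agrees with it where \<open>|g| > \<delta>\<close>, which is all that the maximum principle requires.
\<close>

lemma integrating_factor:
  assumes f: "wirtinger_on (outer 1) f fz fb" and g: "wirtinger_on (outer 1) g gz gzb"
    and eq: "\<And>z. z \<in> outer 1 \<Longrightarrow> of_real (4 * \<mu>) * gzb z = cnj (f z) * g z + f z * cnj (g z)"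
    and \<mu>: "\<mu> > 0"
    and K2: "\<And>r z. r \<ge> 1 \<Longrightarrow> kato f r z \<le> ennreal (C * r)" and C: "C \<ge> 0"
    and R: "R \<ge> 1" and \<delta>: "\<delta> > 0"
  obtains w where "continuous_on UNIV w"
    "\<And>z. cmod z \<le> 4 * R \<Longrightarrow> cmod (w z) \<le> 11 * C / (2 * \<mu> * cp_const) * R"
    "(\<lambda>z. g z * exp (- w z)) holomorphic_on {z. 2 < cmod z \<and> cmod z < 4 * R \<and> \<delta> < cmod (g z)}"
proof -
  define d where "d = \<delta>\<^sup>2"
  have d: "d > 0" using \<delta> by (simp add: d_def)
  \<comment> \<open>Here cnj g / g is written as (cnj g)^2 / |g|^2 and the denominator is
    regularised. This only enlarges the denominator, so |a| \<le> |f| / (2 \<mu>) survives. The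
    parameter is \<delta>^2 because \<open>reg_normsq\<close> compares it with a squared
    modulus.\<close>
  define a where "a z = (cnj (f z) + f z * (cnj (g z))\<^sup>2 / of_real (reg_normsq d (g z))) / of_real (4 * \<mu>)" for z
  have "\<exists>p q. wirtinger_on (outer 1) a p q"
  proof -
    have "complex_of_real (reg_normsq d (g z)) \<noteq> 0" for z using reg_normsq_pos[OF d, of "g z"] by simp
    then have inv: "\<exists>p q. wirtinger_on (outer 1) (\<lambda>z. inverse (complex_of_real (reg_normsq d (g z)))) p q"
      by (intro exI) (rule wirtinger_on_inverse[OF wirtinger_on_reg_normsq[OF g d]])
    have cf: "\<exists>p q. wirtinger_on (outer 1) (\<lambda>z. cnj (f z)) p q" by (intro exI) (rule wirtinger_on_cnj[OF f])
    have cg: "\<exists>p q. wirtinger_on (outer 1) (\<lambda>z. cnj (g z)) p q" by (intro exI) (rule wirtinger_on_cnj[OF g])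
    have ff: "\<exists>p q. wirtinger_on (outer 1) f p q" by (intro exI) (rule f)
    have c0: "\<exists>p q. wirtinger_on (outer 1) (\<lambda>z. 1 / complex_of_real (4 * \<mu>)) p q"
      by (intro exI) (rule wirtinger_on_const)
    note m1 = wirtinger_ex_mult[OF cg cg]
    note m2 = wirtinger_ex_mult[OF ff m1]
    note m3 = wirtinger_ex_mult[OF m2 inv]
    note m4 = wirtinger_ex_add[OF cf m3]
    note m5 = wirtinger_ex_mult[OF c0 m4]
    have eq: "a = (\<lambda>z. 1 / complex_of_real (4 * \<mu>) *
        (cnj (f z) + f z * (cnj (g z) * cnj (g z)) * inverse (complex_of_real (reg_normsq d (g z)))))"
      unfolding a_def divide_inverse power2_eq_square by (rule ext) (simp only: mult_ac mult_1_left)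
    show ?thesis unfolding eq by (rule m5)
  qed
  then obtain p q where a: "wirtinger_on (outer 1) a p q" by blast
  have a_le: "cmod (a z) \<le> 1 / (2 * \<mu>) * cmod (f z)" for z
  proof -
    have "cmod (f z * (cnj (g z))\<^sup>2 / of_real (reg_normsq d (g z))) = cmod (f z) * ((cmod (g z))\<^sup>2 / reg_normsq d (g z))"
      using reg_normsq_pos[OF d, of "g z"] by (simp add: norm_mult norm_divide norm_power)
    also have "\<dots> \<le> cmod (f z) * 1"
      using reg_normsq_pos[OF d, of "g z"] reg_normsq_ge[OF d, of "g z"] by (intro mult_left_mono) auto
    finally have "cmod (cnj (f z) + f z * (cnj (g z))\<^sup>2 / of_real (reg_normsq d (g z))) \<le> 2 * cmod (f z)"
      by (intro order_trans[OF norm_triangle_ineq]) simp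
    then show ?thesis unfolding a_def norm_divide using \<mu> by (simp add: field_simps)
  qed
  \<comment> \<open>Steps in the polynomial |z|^2: \<open>t1\<close> runs from 0 at |z|^2 = 2 to 1
    at |z| = 2, and \<open>t2\<close> falls from 1 at |z| = 4R to 0 at |z|^2 = 32 R^2, which is
    inside |z| \<le> 6R. So the support is a compact part of \<open>outer 1\<close>.\<close>
  define t1 where "t1 z = ((cmod z)\<^sup>2 - 2) / 2" for z :: complex
  define t2 where "t2 z = 2 - (cmod z)\<^sup>2 / (16 * R\<^sup>2)" for z :: complex
  define cut where "cut z = smooth_step (of_real (t1 z)) * smooth_step (of_real (t2 z))" for z
  note N = wirtinger_on_normsq[OF wirtinger_on_id[of UNIV]]
  have "\<exists>p q. wirtinger_on UNIV cut p q"
  proof -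
    have "\<exists>p q. wirtinger_on UNIV (\<lambda>z. complex_of_real (t1 z)) p q"
      using wirtinger_on_cmult[OF wirtinger_on_diff[OF N wirtinger_on_const[of UNIV 2]], of "1/2"]
      by (auto simp: t1_def)
    moreover have "\<exists>p q. wirtinger_on UNIV (\<lambda>z. complex_of_real (t2 z)) p q"
      using wirtinger_on_diff[OF wirtinger_on_const[of UNIV 2] wirtinger_on_cmult[OF N, of "1 / of_real (16 * R\<^sup>2)"]]
      by (auto simp: t2_def)
    ultimately obtain p1 q1 p2 q2 where "wirtinger_on UNIV (\<lambda>z. complex_of_real (t1 z)) p1 q1"
      "wirtinger_on UNIV (\<lambda>z. complex_of_real (t2 z)) p2 q2" by blast
    from this[THEN wirtinger_on_smooth_step] show ?thesis unfolding cut_def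
      by (rule wirtinger_ex_mult)
  qed
  then obtain p' q' where cut: "wirtinger_on UNIV cut p' q'" by blast
  have cut1: "cut z = 1" if "2 \<le> cmod z" "cmod z \<le> 4 * R" for z
  proof -
    have "2\<^sup>2 \<le> (cmod z)\<^sup>2" using that by (intro power_mono) auto
    then have "t1 z \<ge> 1" by (simp add: t1_def)
    moreover have "(cmod z)\<^sup>2 \<le> (4 * R)\<^sup>2" using that by (intro power_mono) auto
    then have "t2 z \<ge> 1" using R by (simp add: t2_def power_mult_distrib)
    ultimately show ?thesis by (simp add: cut_def smooth_step_1)
  qed
  have cut_le: "cmod (cut z) \<le> 1" for z
    unfolding cut_def norm_mult by (intro mult_le_one norm_smooth_step_le) auto
  define K where "K = {z. 2 \<le> (cmod z)\<^sup>2} \<inter> cball 0 (6 * R)"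
  have Kc: "compact K" unfolding K_def
    by (intro closed_Int_compact closed_Collect_le continuous_intros) auto
  have K1: "K \<subseteq> outer 1"
  proof
    fix z assume "z \<in> K"
    then have "2 \<le> (cmod z)\<^sup>2" unfolding K_def by blast
    then have "1\<^sup>2 < (cmod z)\<^sup>2" unfolding one_power2 by linarith
    from power2_less_imp_less[OF this norm_ge_zero] show "z \<in> outer 1" by (simp add: outer_def)
  qed
  have cut0: "cut z = 0" if "z \<notin> K" for z
  proof (cases "2 \<le> (cmod z)\<^sup>2")
    case True
    then have "6 * R < cmod z" using that by (auto simp: K_def)
    then have "(6 * R)\<^sup>2 \<le> (cmod z)\<^sup>2" using R by (intro power_mono) auto
    then have "36 * R\<^sup>2 \<le> (cmod z)\<^sup>2" by (simp add: power_mult_distrib)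
    moreover have "0 \<le> R\<^sup>2" by simp
    ultimately have "32 * R\<^sup>2 \<le> (cmod z)\<^sup>2" by linarith
    then have "t2 z \<le> 0" using R by (simp add: t2_def field_simps)
    then show ?thesis by (simp add: cut_def smooth_step_0)
  next
    case False
    then have "t1 z \<le> 0" by (simp add: t1_def)
    then show ?thesis by (simp add: cut_def smooth_step_0)
  qed
  define b where "b z = a z * cut z" for z
  have b: "wirtinger_on UNIV b (\<lambda>z. p z * cut z + a z * p' z) (\<lambda>z. q z * cut z + a z * q' z)"
    unfolding b_def by (rule wirtinger_on_cutoff(1)[OF a cut open_outer compact_imp_closed[OF Kc] K1 cut0])
  have b0: "b z = 0" if "z \<notin> cball 0 (6 * R)" for z
    using cut0[of z] that by (auto simp: b_def K_def)
  define w where "w = cauchy_transform b"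
  have w: "(w has_derivative (\<lambda>h. cauchy_transform (\<lambda>z. p z * cut z + a z * p' z) z * h + b z * cnj h)) (at z)" for z
    unfolding w_def by (rule has_derivative_cauchy_transform[OF b b0])
  show thesis
  proof (rule that)
    show "continuous_on UNIV w"
      using w by (meson continuous_at_imp_continuous_on has_derivative_continuous)
    fix z assume z: "cmod z \<le> 4 * R"
    have "ennreal (cmod (of_real cp_const * w z)) \<le> (\<integral>\<^sup>+u. ennreal (cmod (b u) / cmod (z - u)) \<partial>lborel)"
    proof -
      have "of_real cp_const * w z = (LBINT u. b (z - u) * (1 / u))"
        using cp_const_pos by (simp add: w_def cauchy_transform_def)
      then show ?thesis
        by (simp only:) (rule norm_convolution_inverse_le[OF wirtinger_on_continuous[OF b], of "6 * R"], rule b0)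
    qed
    \<comment> \<open>For |z| \<le> 4R and |u| \<le> 6R the distance is at most 10R; 11R puts u into
      the open ball.\<close>
    also have "\<dots> \<le> (\<integral>\<^sup>+u. ennreal (1 / (2 * \<mu>)) * (ennreal (cmod (f u) / cmod (z - u)) * indicator (ball z (11 * R) \<inter> outer 1) u) \<partial>lborel)"
    proof (rule nn_integral_mono)
      fix u
      show "ennreal (cmod (b u) / cmod (z - u)) \<le> ennreal (1 / (2 * \<mu>)) * (ennreal (cmod (f u) / cmod (z - u)) * indicator (ball z (11 * R) \<inter> outer 1) u)"
      proof (cases "u \<in> K")
        case True
        then have "cmod u \<le> 6 * R" "u \<in> outer 1" using K1 by (auto simp: K_def)
        moreover then have "u \<in> ball z (11 * R)"
          using z R norm_triangle_ineq4[of z u] by (simp add: dist_norm)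
        moreover have "cmod (b u) \<le> 1 / (2 * \<mu>) * cmod (f u)"
          unfolding b_def norm_mult using mult_mono[OF a_le cut_le, of u u] \<mu> by simp
        then have "cmod (b u) / cmod (z - u) \<le> 1 / (2 * \<mu>) * cmod (f u) / cmod (z - u)"
          by (rule divide_right_mono) simp
        ultimately show ?thesis using \<mu> by (simp add: ennreal_mult[symmetric] ennreal_leI)
      next
        case False
        then show ?thesis by (simp add: b_def cut0)
      qed
    qed
    also have "\<dots> = ennreal (1 / (2 * \<mu>)) * kato f (11 * R) z" by (rule kato_cmult[OF wirtinger_on_continuous[OF f]])
    also have "\<dots> \<le> ennreal (1 / (2 * \<mu>)) * ennreal (C * (11 * R))" using R by (intro mult_left_mono K2) auto
    also have "\<dots> = ennreal (1 / (2 * \<mu>) * (C * (11 * R)))"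
      by (rule ennreal_mult[symmetric]) (use C R \<mu> in auto)
    finally have "cmod (of_real cp_const * w z) \<le> 1 / (2 * \<mu>) * (C * (11 * R))"
      using C R \<mu> by (subst (asm) ennreal_le_iff) auto
    then show "cmod (w z) \<le> 11 * C / (2 * \<mu> * cp_const) * R"
      using cp_const_pos \<mu> by (simp add: norm_mult field_simps)
  next
    show "(\<lambda>z. g z * exp (- w z)) holomorphic_on {z. 2 < cmod z \<and> cmod z < 4 * R \<and> \<delta> < cmod (g z)}"
      unfolding holomorphic_on_def
    proof
      fix z assume z: "z \<in> {z. 2 < cmod z \<and> cmod z < 4 * R \<and> \<delta> < cmod (g z)}"
      then have zo: "z \<in> outer 1" by (simp add: outer_def)
      have "d \<le> (cmod (g z))\<^sup>2" unfolding d_def using z \<delta> by (intro power_mono) auto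
      then have rn: "complex_of_real (reg_normsq d (g z)) = g z * cnj (g z)"
        by (simp add: reg_normsq_eq complex_norm_square del: of_real_power)
      have gz: "g z \<noteq> 0" using z \<delta> by auto
      have bz: "of_real (4 * \<mu>) * (b z * g z) = cnj (f z) * g z + f z * cnj (g z)"
        using z gz \<mu> unfolding b_def a_def rn by (simp add: cut1 field_simps power2_eq_square)
      then have bg: "b z * g z = gzb z" using eq[OF zo] \<mu>
        by (simp flip: bz)
      note has_derivative_compose[OF has_derivative_minus[OF w] DERIV_exp[unfolded has_field_derivative_def]]
      from has_derivative_mult[OF wirtinger_onD(1)[OF g zo] this]
      have "((\<lambda>z. g z * exp (- w z)) has_derivative
         (\<lambda>h. (gz z - g z * cauchy_transform (\<lambda>z. p z * cut z + a z * p' z) z) * exp (- w z) * h + ((gzb z - b z * g z) * exp (- w z)) * cnj h)) (at z)"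
        by (simp add: algebra_simps)
      from wirtinger_on_imp_field_derivative[OF this] bg
      have "((\<lambda>z. g z * exp (- w z)) has_field_derivative (gz z - g z * cauchy_transform (\<lambda>z. p z * cut z + a z * p' z) z) * exp (- w z)) (at z)"
        by simp
      then show "(\<lambda>z. g z * exp (- w z)) field_differentiable at z within {z. 2 < cmod z \<and> cmod z < 4 * R \<and> \<delta> < cmod (g z)}"
        by (meson field_differentiable_def field_differentiable_at_within)
    qed
  qed
qed

section \<open>Propagation of smallness\<close>

text \<open>
  Where \<open>|G| \<le> \<delta>\<close>, a sufficiently small \<open>\<delta>\<close> makes the bound needed for the maximum principle trivial.
\<close>

lemma propagation_of_smallness:
  fixes G :: "complex \<Rightarrow> complex"
  assumes \<rho>: "\<rho> \<ge> 1" and contG: "continuous_on {z. \<rho> \<le> cmod z} G"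
    and A: "A \<ge> 0" "\<And>z. \<rho> \<le> cmod z \<Longrightarrow> cmod (G z) \<le> A"
    and C: "C \<ge> 0"
    and factor: "\<And>R \<delta>. R \<ge> 1 \<Longrightarrow> \<delta> > 0 \<Longrightarrow> \<exists>w. continuous_on UNIV w \<and>
        (\<forall>z. cmod z \<le> 4 * R \<longrightarrow> cmod (w z) \<le> C * R) \<and>
        (\<lambda>z. G z * exp (- w z)) holomorphic_on {z. \<rho> < cmod z \<and> cmod z < 4 * R \<and> \<delta> < cmod (G z)}"
    and z1: "\<rho> < cmod z1" "G z1 \<noteq> 0"
  obtains B R0 where "B > 0"
    "\<And>R z0 m. R \<ge> R0 \<Longrightarrow> cmod z0 = R \<Longrightarrow> (\<And>z. dist z0 z = 1/2 \<Longrightarrow> cmod (G z) \<le> m) \<Longrightarrow>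
       exp (- (B * R * (ln R)\<^sup>2)) \<le> m"
proof -
  define r1 where "r1 = cmod z1"
  \<comment> \<open>The limit of |E z1| as R grows. Any q strictly between 1 and \<open>q0\<close>
    is then a lower bound of |E z1| for large R.\<close>
  define q0 where "q0 = r1 / \<rho>"
  define q where "q = (1 + q0) / 2"
  have q0: "q0 > 1" using z1 \<rho> by (simp add: q0_def r1_def)
  then have q: "1 < q" "q < q0" by (auto simp: q_def)
  define a where "a = \<bar>ln ((A + 1) / cmod (G z1))\<bar>"
  \<comment> \<open>Chosen so that q^(bR) beats exp(2CR) (A + 1) / |G z1|: one exp(CR) bounds
    exp(-w) on the boundary, the other bounds it from below at \<open>z1\<close>.\<close>
  define b where "b = (2 * C + a) / ln q"
  have b: "b \<ge> 0" using C q by (simp add: b_def a_def)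
  \<comment> \<open>From s \<le> (b + 2) R and |E|^s \<le> exp(3 l^2 s) near \<open>z0\<close>,
    where l \<le> 3 ln R gives 3 l^2 \<le> 27 (ln R)^2.\<close>
  define B where "B = 27 * (b + 2)"
  have "((\<lambda>R. (ln (4 * R) + 1) * (r1 + \<rho>) / R) \<longlongrightarrow> 0) at_top" by real_asymp
  moreover have "0 < 1 - q / q0" using q q0 by simp
  ultimately have "\<forall>\<^sub>F R in at_top. (ln (4 * R) + 1) * (r1 + \<rho>) / R < 1 - q / q0"
    by (rule order_tendstoD(2))
  then obtain R1 where R1: "\<And>R. R \<ge> R1 \<Longrightarrow> (ln (4 * R) + 1) * (r1 + \<rho>) / R < 1 - q / q0"
    unfolding eventually_at_top_linorder by blast
  define R0 where "R0 = max R1 (r1 + \<rho> + 2)"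
  show thesis
  proof (rule that[of B R0])
    show "B > 0" using b by (simp add: B_def)
    fix R z0 m
    assume R: "R \<ge> R0" and z0: "cmod z0 = R" and m: "\<And>z. dist z0 z = 1/2 \<Longrightarrow> cmod (G z) \<le> m"
    have r1: "r1 > \<rho>" using z1 by (simp add: r1_def)
    have RR: "R \<ge> r1 + \<rho> + 2" "R \<ge> 2" "R \<ge> 1" "R > 0" using R r1 \<rho> by (auto simp: R0_def)
    have m0: "m \<ge> 0" using order_trans[OF norm_ge_zero m[of "z0 + 1/2"]] by (simp add: dist_norm norm_divide)
    define l where "l = ln (4 * R)"
    have l: "l \<ge> 1"
    proof -
      have "exp 1 \<le> (4::real)" using exp_le by simp
      also have "4 \<le> 4 * R" using RR by simp
      finally show ?thesis unfolding l_def using RR by (simp add: ln_ge_iff)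
    qed
    \<comment> \<open>This makes e^n, and hence 3^n, at least 4R, so that (1/3)^n compensates
      z/\<rho> on the outer circle.\<close>
    define n where "n = nat \<lceil>l\<rceil>"
    have "real n = real_of_int \<lceil>l\<rceil>" using l by (simp add: n_def)
    then have n: "l \<le> real n" "real n \<le> l + 1" using ceiling_correct[of l] by linarith+
    \<comment> \<open>The extra 1 makes the final comparison with q^s strict.\<close>
    define s where "s = nat \<lceil>b * R\<rceil> + 1"
    have s: "real s \<le> (b + 2) * R"
    proof -
      have "0 \<le> b * R" using b RR by simp
      then have "real (nat \<lceil>b * R\<rceil>) = real_of_int \<lceil>b * R\<rceil>" by simp
      then have "real s \<le> b * R + 2" using ceiling_correct[of "b * R"] by (simp add: s_def)
      also have "\<dots> \<le> b * R + 2 * R" using RR by simp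
      finally show ?thesis by (simp add: algebra_simps)
    qed
    define E where "E z = z / of_real \<rho> * (of_real (R - \<rho>) / (z - z0)) ^ n" for z
    have nE: "cmod (E z) = cmod z / \<rho> * ((R - \<rho>) / cmod (z - z0)) ^ n" for z
      using \<rho> RR r1 by (simp add: E_def norm_mult norm_divide norm_power flip: of_real_diff)
    have E_inner: "cmod (E z) \<le> 1" if "cmod z = \<rho>" for z
    proof -
      have "R - \<rho> \<le> cmod (z - z0)" using norm_triangle_ineq2[of z0 z] that z0 by (simp add: norm_minus_commute)
      then have "((R - \<rho>) / cmod (z - z0)) ^ n \<le> 1"
        using RR r1 by (intro power_le_one) (auto simp: divide_le_eq_1)
      then show ?thesis unfolding nE using that \<rho> by simp
    qed
    have exp3: "4 * R \<le> 3 ^ n"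
    proof -
      have "4 * R = exp l" using RR by (simp add: l_def)
      also have "\<dots> \<le> exp (real n)" using n by simp
      also have "\<dots> = exp 1 ^ n" by (simp add: exp_of_nat_mult[symmetric])
      also have "\<dots> \<le> 3 ^ n" using exp_le by (intro power_mono) auto
      finally show ?thesis .
    qed
    have E_outer: "cmod (E z) \<le> 1" if "cmod z = 4 * R" for z
    proof -
      have "3 * R \<le> cmod (z - z0)" using norm_triangle_ineq2[of z z0] that z0 by simp
      then have "(R - \<rho>) / cmod (z - z0) \<le> R / (3 * R)"
        using RR r1 \<rho> by (intro frac_le) auto
      then have "((R - \<rho>) / cmod (z - z0)) ^ n \<le> (1/3) ^ n"
        using RR r1 by (intro power_mono) auto
      then have "cmod (E z) \<le> 4 * R / \<rho> * (1/3) ^ n"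
        unfolding nE using that RR \<rho> by (simp add: mult_left_mono divide_right_mono)
      also have "\<dots> \<le> 4 * R * (1/3) ^ n" using \<rho> RR by (intro mult_right_mono) (auto simp: divide_le_eq)
      also have "\<dots> \<le> 1" using exp3 by (simp add: power_divide)
      finally show ?thesis .
    qed
    have E_all: "cmod (E z) \<le> (4 * R) ^ (n + 1)" if "cmod z \<le> 4 * R" "1/2 \<le> cmod (z - z0)" for z
    proof -
      have "(R - \<rho>) / cmod (z - z0) \<le> R / (1/2)"
        using RR r1 \<rho> that by (intro frac_le) auto
      then have "(R - \<rho>) / cmod (z - z0) \<le> 4 * R" using RR by simp
      then have p: "((R - \<rho>) / cmod (z - z0)) ^ n \<le> (4 * R) ^ n" using RR r1 by (intro power_mono) auto
      have "cmod z / \<rho> \<le> 4 * R / 1" using that \<rho> RR by (intro frac_le) auto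
      then have "cmod z / \<rho> * ((R - \<rho>) / cmod (z - z0)) ^ n \<le> 4 * R / 1 * (4 * R) ^ n"
        using p RR r1 \<rho> by (intro mult_mono) auto
      then show ?thesis unfolding nE by simp
    qed
    have M: "(4 * R) ^ (n + 1) \<le> exp (3 * l\<^sup>2)"
    proof -
      have "(4 * R) ^ (n + 1) = exp l ^ (n + 1)" using RR by (simp add: l_def)
      also have "\<dots> = exp (real (n + 1) * l)" by (rule exp_of_nat_mult[symmetric])
      also have "\<dots> \<le> exp (3 * l\<^sup>2)"
      proof -
        have "real (n + 1) \<le> 3 * l" using n l by simp
        then have "real (n + 1) * l \<le> 3 * l * l" using l by (intro mult_right_mono) auto
        then show ?thesis by (simp add: power2_eq_square mult.assoc)
      qed
      finally show ?thesis .
    qed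
    have E_z1: "q \<le> cmod (E z1)"
    proof -
      \<comment> \<open>1 - x is a lower bound of the quotient in \<open>E\<close> at
        \<open>z1\<close>. Bernoulli's inequality bounds its n-th power below by 1 - n x, and
        \<open>R1\<close> was chosen to keep n x below 1 - q/q0.\<close>
      define x where "x = (r1 + \<rho>) / (R + r1)"
      have x: "0 \<le> x" "x \<le> 1" using RR r1 \<rho> by (auto simp: x_def)
      have "real n * x \<le> (l + 1) * ((r1 + \<rho>) / R)"
        unfolding x_def using n l RR r1 \<rho> by (intro mult_mono frac_le) auto
      also have "\<dots> < 1 - q / q0" using R1[of R] R by (simp add: R0_def l_def)
      finally have "q / q0 \<le> 1 - real n * x" by simp
      also have "\<dots> \<le> (1 - x) ^ n"
        using Bernoulli_inequality[of "- x" n] x by simp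
      also have "1 - x = (R - \<rho>) / (R + r1)" using RR r1 \<rho> by (simp add: x_def field_simps)
      also have "((R - \<rho>) / (R + r1)) ^ n \<le> ((R - \<rho>) / cmod (z1 - z0)) ^ n"
      proof (intro power_mono frac_le)
        show "cmod (z1 - z0) \<le> R + r1" using norm_triangle_ineq4[of z1 z0] z0 by (simp add: r1_def)
        have "cmod z0 - cmod z1 \<le> cmod (z1 - z0)" using norm_triangle_ineq2[of z0 z1] by (simp add: norm_minus_commute)
        then show "0 < cmod (z1 - z0)" using z0 RR r1 \<rho> unfolding r1_def by linarith
      qed (use RR r1 \<rho> in auto)
      finally have "q0 * (q / q0) \<le> q0 * ((R - \<rho>) / cmod (z1 - z0)) ^ n"
        using q0 by (intro mult_left_mono) auto
      moreover have "q0 * (q / q0) = q" using q0 by simp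
      ultimately show ?thesis unfolding nE q0_def r1_def by simp
    qed
    define M where "M = (4 * R) ^ (n + 1)"
    have M1: "M \<ge> 1" unfolding M_def using RR by (intro one_le_power) auto
    \<comment> \<open>The first entry keeps \<open>z1\<close> in the region of holomorphy; the
      second cancels the largest possible value M^s of |E|^s on the part of the boundary where |G|
      \<le> \<delta>.\<close>
    define \<delta> where "\<delta> = min (cmod (G z1) / 2) (1 / M ^ s)"
    have \<delta>: "\<delta> > 0" "\<delta> < cmod (G z1)" "\<delta> \<le> 1 / M ^ s" using z1(2) M1 by (auto simp: \<delta>_def min_less_iff_disj)
    obtain w where w: "continuous_on UNIV w" "\<And>z. cmod z \<le> 4 * R \<Longrightarrow> cmod (w z) \<le> C * R"
      and hol: "(\<lambda>z. G z * exp (- w z)) holomorphic_on {z. \<rho> < cmod z \<and> cmod z < 4 * R \<and> \<delta> < cmod (G z)}"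
      using factor[OF RR(3) \<delta>(1)] by blast
    have ew: "cmod (exp (- w z)) \<le> exp (C * R)" if "cmod z \<le> 4 * R" for z
    proof -
      have "Re (- w z) \<le> cmod (- w z)" by (rule complex_Re_le_cmod)
      also have "\<dots> \<le> C * R" using w(2)[OF that] by simp
      finally show ?thesis by simp
    qed
    have ew': "exp (- (C * R)) \<le> cmod (exp (- w z))" if "cmod z \<le> 4 * R" for z
    proof -
      have "Re (w z) \<le> C * R" using complex_Re_le_cmod[of "w z"] w(2)[OF that] by linarith
      then show ?thesis by simp
    qed
    define H where "H z = G z * exp (- w z) * E z ^ s" for z
    have nH: "cmod (H z) = cmod (G z) * cmod (exp (- w z)) * cmod (E z) ^ s" for z
      by (simp add: H_def norm_mult norm_power)
    define S0 where "S0 = {z. \<rho> < cmod z} \<inter> {z. \<delta> < cmod (G z)}"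
    define S where "S = S0 \<inter> {z. cmod z < 4 * R} \<inter> {z. 1/2 < cmod (z - z0)}"
    define Cl where "Cl = {z. \<rho> \<le> cmod z} \<inter> {z. cmod z \<le> 4 * R} \<inter> {z. 1/2 \<le> cmod (z - z0)}"
    have o1: "open {z::complex. \<rho> < cmod z}" by (intro open_Collect_less continuous_intros)
    have "open S0"
    proof -
      have c: "continuous_on {z. \<rho> < cmod z} (\<lambda>z. cmod (G z))"
        by (intro continuous_on_norm continuous_on_subset[OF contG]) auto
      have "open ({z. \<rho> < cmod z} \<inter> (\<lambda>z. cmod (G z)) -` {\<delta><..})"
        by (rule continuous_open_preimage[OF c o1]) simp
      moreover have "{z. \<rho> < cmod z} \<inter> (\<lambda>z. cmod (G z)) -` {\<delta><..} = S0" by (auto simp: S0_def)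
      ultimately show ?thesis by simp
    qed
    then have oS: "open S" unfolding S_def
      by (intro open_Int open_Collect_less continuous_intros)
    have cCl: "closed Cl" unfolding Cl_def
      by (intro closed_Int closed_Collect_le continuous_intros)
    have SCl: "closure S \<subseteq> Cl" by (rule closure_minimal[OF _ cCl]) (auto simp: S_def S0_def Cl_def)
    \<comment> \<open>The first entry serves both circles around 0 and, thanks to A + 1 \<ge> 1, the
      set |G| \<le> \<delta>; the second serves the circle around \<open>z0\<close>.\<close>
    define B' where "B' = max ((A + 1) * exp (C * R)) (m * exp (C * R) * exp (3 * l\<^sup>2) ^ s)"
    have "cmod (H z1) \<le> B'"
    proof (rule maximum_modulus_frontier[of H S])
      have "H holomorphic_on S" unfolding H_def E_def
        using \<rho> by (intro holomorphic_intros holomorphic_on_subset[OF hol]) (auto simp: S_def S0_def)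
      then show "H holomorphic_on interior S" using oS by (simp add: interior_open)
      have "continuous_on Cl H" unfolding H_def E_def
        by (intro continuous_intros continuous_on_subset[OF contG] continuous_on_subset[OF w(1)])
           (use \<rho> in \<open>auto simp: Cl_def\<close>)
      then show "continuous_on (closure S) H" by (rule continuous_on_subset[OF _ SCl])
      show "bounded S" by (rule bounded_subset[OF bounded_ball[of 0 "4 * R"]]) (auto simp: S_def)
      have "cmod z1 < 4 * R" using RR r1 \<rho> by (simp add: r1_def)
      moreover have "1/2 < cmod (z1 - z0)"
        using norm_triangle_ineq2[of z0 z1] z0 RR r1 \<rho> unfolding r1_def norm_minus_commute[of z1] by linarith
      ultimately show "z1 \<in> S" using z1 \<delta> by (simp add: S_def S0_def)
      fix z assume "z \<in> frontier S"
      then have zc: "z \<in> Cl" "z \<notin> S" using SCl oS by (auto simp: frontier_def interior_open)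
      then have z4: "\<rho> \<le> cmod z" "cmod z \<le> 4 * R" "1/2 \<le> cmod (z - z0)" by (auto simp: Cl_def)
      have EM: "cmod (E z) ^ s \<le> M ^ s" unfolding M_def by (intro power_mono E_all z4) auto
      consider "cmod z = \<rho> \<or> cmod z = 4 * R" | "cmod (z - z0) = 1/2" | "cmod (G z) \<le> \<delta>"
        using zc z4 by (force simp: S_def S0_def)
      then show "cmod (H z) \<le> B'"
      proof cases
        case 1
        then have "cmod (E z) ^ s \<le> 1" using E_inner E_outer by (intro power_le_one) auto
        then have "cmod (H z) \<le> A * exp (C * R) * 1"
          unfolding nH using A z4 by (intro mult_mono ew) auto
        also have "\<dots> \<le> (A + 1) * exp (C * R)" by simp
        finally show ?thesis unfolding B'_def by simp
      next
        case 2
        then have "cmod (G z) \<le> m" by (intro m) (simp add: dist_norm norm_minus_commute)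
        moreover have "cmod (E z) ^ s \<le> exp (3 * l\<^sup>2) ^ s"
          using E_all[OF z4(2,3)] M by (intro power_mono) auto
        ultimately have "cmod (H z) \<le> m * exp (C * R) * exp (3 * l\<^sup>2) ^ s"
          unfolding nH using m0 z4 by (intro mult_mono ew) auto
        then show ?thesis unfolding B'_def by simp
      next
        case 3
        have "cmod (H z) \<le> (1 / M ^ s) * exp (C * R) * M ^ s"
          unfolding nH using 3 \<delta> z4 M1 by (intro mult_mono ew EM) auto
        also have "\<dots> = exp (C * R)" using M1 by simp
        also have "\<dots> \<le> (A + 1) * exp (C * R)" using A by simp
        finally show ?thesis unfolding B'_def by simp
      qed
    qed
    \<comment> \<open>\<open>H\<close> at \<open>z1\<close> exceeds the first entry of
      \<open>B'\<close>, so the second entry must be the larger one, and that bounds m from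
      below.\<close>
    moreover have "(A + 1) * exp (C * R) < cmod (H z1)"
    proof -
      have "(A + 1) / cmod (G z1) * exp (2 * C * R) \<le> exp (a + 2 * C * R)"
      proof -
        have p: "0 < (A + 1) / cmod (G z1)" using A z1 by simp
        then have "(A + 1) / cmod (G z1) = exp (ln ((A + 1) / cmod (G z1)))" by simp
        also have "\<dots> \<le> exp a" unfolding exp_le_cancel_iff a_def by simp
        finally show ?thesis unfolding exp_add by (rule mult_right_mono) simp
      qed
      also have "\<dots> \<le> exp (b * R * ln q)"
      proof -
        have "a \<le> a * R" using RR by (simp add: a_def mult_le_cancel_left1)
        then have "a + 2 * C * R \<le> (2 * C + a) * R" by (simp add: algebra_simps)
        also have "\<dots> = b * R * ln q" using q by (simp add: b_def)
        finally show ?thesis by simp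
      qed
      also have "\<dots> \<le> exp (real (nat \<lceil>b * R\<rceil>) * ln q)"
      proof -
        have "b * R \<le> real (nat \<lceil>b * R\<rceil>)" by linarith
        then show ?thesis using q by (simp add: mult_right_mono)
      qed
      also have "\<dots> = q ^ nat \<lceil>b * R\<rceil>" using q by (simp add: exp_of_nat_mult)
      also have "\<dots> < q ^ s" unfolding s_def using q by simp
      finally have "(A + 1) * exp (2 * C * R) < cmod (G z1) * q ^ s"
        using z1 by (simp add: field_simps)
      then have "(A + 1) * exp (2 * C * R) * exp (- (C * R)) < cmod (G z1) * q ^ s * exp (- (C * R))" by simp
      also have "cmod (G z1) * q ^ s * exp (- (C * R)) = cmod (G z1) * exp (- (C * R)) * q ^ s" by simp
      also have "\<dots> \<le> cmod (H z1)"
        unfolding nH using E_z1 q RR r1 \<rho> by (intro mult_mono power_mono ew') (auto simp: r1_def)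
      finally show ?thesis by (simp add: mult.assoc exp_add[symmetric])
    qed
    ultimately have "(A + 1) * exp (C * R) < B'" by linarith
    then have "(A + 1) * exp (C * R) < m * exp (C * R) * exp (3 * l\<^sup>2) ^ s"
      unfolding B'_def less_max_iff_disj by blast
    also have "\<dots> = (m * exp (3 * l\<^sup>2) ^ s) * exp (C * R)" by (simp only: mult_ac)
    finally have "A + 1 < m * exp (3 * l\<^sup>2) ^ s"
      by (rule mult_less_cancel_right_pos[THEN iffD1, rotated]) simp
    then have "1 < m * exp (3 * l\<^sup>2) ^ s" using A by simp
    also have "exp (3 * l\<^sup>2) ^ s = exp (real s * (3 * l\<^sup>2))" by (rule exp_of_nat_mult[symmetric])
    finally have "exp (- (real s * (3 * l\<^sup>2))) < m" by (simp add: exp_minus field_simps)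
    moreover have "real s * (3 * l\<^sup>2) \<le> B * R * (ln R)\<^sup>2"
    proof -
      have "ln 4 = ln (2 ^ 2 :: real)" by simp
      also have "\<dots> = 2 * ln 2" by (subst ln_realpow) auto
      also have "\<dots> \<le> 2 * ln R" using RR by simp
      finally have "l \<le> 3 * ln R" unfolding l_def using RR by (simp add: ln_mult)
      then have "l\<^sup>2 \<le> (3 * ln R)\<^sup>2" using l by (intro power_mono) auto
      then have "3 * l\<^sup>2 \<le> 27 * (ln R)\<^sup>2" by (simp add: power_mult_distrib)
      have "real s * (3 * l\<^sup>2) \<le> ((b + 2) * R) * (27 * (ln R)\<^sup>2)"
        by (rule mult_mono[OF s \<open>3 * l\<^sup>2 \<le> _\<close>]) (use b RR in auto)
      then show ?thesis by (simp only: B_def mult_ac)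
    qed
    ultimately show "exp (- (B * R * (ln R)\<^sup>2)) \<le> m"
      using exp_le_cancel_iff[of "- (B * R * (ln R)\<^sup>2)" "- (real s * (3 * l\<^sup>2))"] by linarith
  qed
qed

text \<open>On the circle of radius 1/2 around \<open>z0\<close> the interior estimate bounds |G| by
  C1 times the mass of f on \<open>ball z0 1\<close>, and this product is taken as m. Since R (ln
  R)^2 \<ge> 1 for R \<ge> 3, adding |ln C1| to the exponent absorbs C1.\<close>

lemma ball_mass_lower_bound:
  fixes G f :: "complex \<Rightarrow> complex"
  assumes \<rho>: "\<rho> \<ge> 2" and contG: "continuous_on {z. \<rho> \<le> cmod z} G"
    and C1: "C1 > 0" "\<And>z. \<rho> \<le> cmod z \<Longrightarrow> ennreal (cmod (G z)) \<le> ennreal C1 * ball_mass f z (1/2)"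
    and A: "A \<ge> 0" "\<And>z. 2 \<le> cmod z \<Longrightarrow> ball_mass f z (1/2) \<le> ennreal A"
    and C: "C \<ge> 0"
    and factor: "\<And>R \<delta>. R \<ge> 1 \<Longrightarrow> \<delta> > 0 \<Longrightarrow> \<exists>w. continuous_on UNIV w \<and>
        (\<forall>z. cmod z \<le> 4 * R \<longrightarrow> cmod (w z) \<le> C * R) \<and>
        (\<lambda>z. G z * exp (- w z)) holomorphic_on {z. \<rho> < cmod z \<and> cmod z < 4 * R \<and> \<delta> < cmod (G z)}"
    and z1: "\<rho> < cmod z1" "G z1 \<noteq> 0"
  shows "\<exists>B>0. \<exists>R0. \<forall>R\<ge>R0. \<forall>z0. cmod z0 = R \<longrightarrow> ennreal (exp (- (B * R * (ln R)\<^sup>2))) \<le> ball_mass f z0 1"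
proof -
  have bound: "cmod (G z) \<le> C1 * A" if "\<rho> \<le> cmod z" for z
  proof -
    have "ennreal (cmod (G z)) \<le> ennreal C1 * ball_mass f z (1/2)" by (rule C1(2)[OF that])
    also have "\<dots> \<le> ennreal C1 * ennreal A" using that \<rho> by (intro mult_left_mono A(2)) auto
    also have "\<dots> = ennreal (C1 * A)" using C1 A by (simp add: ennreal_mult)
    finally show ?thesis using C1 A by (subst (asm) ennreal_le_iff) auto
  qed
  have \<rho>1: "1 \<le> \<rho>" and CA: "0 \<le> C1 * A" using \<rho> C1 A by auto
  obtain B R0 where B: "B > 0" and main: "\<And>R z0 m. R \<ge> R0 \<Longrightarrow> cmod z0 = R \<Longrightarrow>
      (\<And>z. dist z0 z = 1/2 \<Longrightarrow> cmod (G z) \<le> m) \<Longrightarrow> exp (- (B * R * (ln R)\<^sup>2)) \<le> m"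
    using propagation_of_smallness[OF \<rho>1 contG CA bound C factor z1] by blast
  define B' where "B' = B + \<bar>ln C1\<bar>"
  have "ennreal (exp (- (B' * R * (ln R)\<^sup>2))) \<le> ball_mass f z0 1"
    if R: "R \<ge> max R0 (\<rho> + 1)" and z0: "cmod z0 = R" for R z0
  proof (cases "ball_mass f z0 1")
    case (real n)
    have RR: "R \<ge> 3" using R \<rho> by simp
    have "cmod (G z) \<le> C1 * n" if z: "dist z0 z = 1/2" for z
    proof -
      have "cmod z0 - 1/2 \<le> cmod z" using norm_triangle_sub[of z0 z] z by (simp add: dist_norm)
      then have "\<rho> \<le> cmod z" using z0 R by simp
      then have "ennreal (cmod (G z)) \<le> ennreal C1 * ball_mass f z (1/2)" by (rule C1(2))
      also have "\<dots> \<le> ennreal C1 * ball_mass f z0 1"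
      proof (intro mult_left_mono ball_mass_mono subsetI)
        fix x assume "x \<in> ball z (1/2)"
        then show "x \<in> ball z0 1" using dist_triangle[of z0 x z] z by simp
      qed simp
      also have "\<dots> = ennreal (C1 * n)" using C1 real by (simp add: ennreal_mult)
      finally show ?thesis using C1 real by (subst (asm) ennreal_le_iff) auto
    qed
    then have le: "exp (- (B * R * (ln R)\<^sup>2)) \<le> C1 * n" using main[OF _ z0] R by auto
    define t where "t = R * (ln R)\<^sup>2"
    have "1 \<le> ln R"
    proof -
      have "exp 1 \<le> R" using exp_le RR by linarith
      then show ?thesis using RR by (simp add: ln_ge_iff)
    qed
    then have "1 \<le> (ln R)\<^sup>2" by (rule one_le_power)
    then have "1 * 1 \<le> t" unfolding t_def using RR by (intro mult_mono) auto
    then have "\<bar>ln C1\<bar> * 1 \<le> \<bar>ln C1\<bar> * t" by (intro mult_left_mono) auto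
    then have "- (B' * t) \<le> - (B * t) - ln C1" by (simp add: B'_def algebra_simps)
    then have "exp (- (B' * t)) \<le> exp (- (B * t) - ln C1)" by simp
    also have "\<dots> = exp (- (B * t)) / C1" using C1 by (simp add: exp_diff)
    also have "\<dots> \<le> n" using le C1 by (simp add: t_def divide_le_eq mult_ac)
    finally show ?thesis using real by (simp add: t_def mult.assoc ennreal_leI)
  qed simp
  then show ?thesis using B by (intro exI[of _ B'] conjI exI[of _ "max R0 (\<rho> + 1)"]) (auto simp: B'_def)
qed

text \<open>Each fallback needs the vanishing only outside a larger disc: \<open>g\<close> beyond
  radius 2, then \<omega> beyond 3, then f is nonzero beyond 4. Each unit step leaves room for the
  balls of radius 1/2 in the interior estimates.\<close>

theorem ball_mass_lower_bound_exterior: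
  assumes f: "wirtinger_on (outer 1) f fz fb" and \<omega>: "\<And>z. z \<in> outer 1 \<Longrightarrow> \<omega> z = 2 * \<i> * fb z"
    and W: "wirtinger_on (outer 1) \<omega> g gb" and gb: "\<And>z. z \<in> outer 1 \<Longrightarrow> gb z = cnj (g z)"
    and g: "wirtinger_on (outer 1) g gz gzb"
    and eq: "\<And>z. z \<in> outer 1 \<Longrightarrow> of_real (4 * \<mu>) * gzb z = cnj (f z) * g z + f z * cnj (g z)"
    and \<mu>: "\<mu> > 0"
    and K1: "\<And>\<eta>. \<eta> > 0 \<Longrightarrow> \<exists>r>0. \<forall>z. kato f r z \<le> ennreal \<eta>"
    and K2: "\<And>r z. r \<ge> 1 \<Longrightarrow> kato f r z \<le> ennreal (C * r)" and C: "C \<ge> 0"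
    and z1: "cmod z1 > 4" "f z1 \<noteq> 0"
  shows "\<exists>B>0. \<exists>R0. \<forall>R\<ge>R0. \<forall>z0. cmod z0 = R \<longrightarrow> ennreal (exp (- (B * R * (ln R)\<^sup>2))) \<le> ball_mass f z0 1"
proof -
  have A: "ball_mass f z (1/2) \<le> ennreal C" if "2 \<le> cmod z" for z
  proof -
    have "ball z (1/2) \<subseteq> outer 1"
      using cball_subset_outer[of 1 "1/2" z] that ball_subset_cball[of z "1/2"] by auto
    then have "ball_mass f z (1/2) \<le> kato f (1/2) z" by (intro ball_mass_le_kato) auto
    also have "\<dots> \<le> kato f 1 z" by (rule kato_mono) simp
    also have "\<dots> \<le> ennreal (C * 1)" by (rule K2) simp
    finally show ?thesis by simp
  qed
  \<comment> \<open>For holomorphic G the integrating factor is w = 0, with growth constant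
    0.\<close>
  have trivial: "\<exists>w. continuous_on UNIV w \<and> (\<forall>z. cmod z \<le> 4 * R \<longrightarrow> cmod (w z) \<le> 0 * R) \<and>
        (\<lambda>z. G z * exp (- w z)) holomorphic_on {z. \<rho> < cmod z \<and> cmod z < 4 * R \<and> \<delta> < cmod (G z)}"
    if G: "wirtinger_on (outer \<rho>') G a b" and b: "\<And>z. z \<in> outer \<rho>' \<Longrightarrow> b z = 0" and "\<rho>' \<le> \<rho>" for G a b \<rho> \<rho>' R \<delta>
  proof (intro exI[of _ "\<lambda>z. 0"] conjI)
    show "(\<lambda>z. G z * exp (- 0)) holomorphic_on {z. \<rho> < cmod z \<and> cmod z < 4 * R \<and> \<delta> < cmod (G z)}"
      unfolding holomorphic_on_def
    proof
      fix z assume "z \<in> {z. \<rho> < cmod z \<and> cmod z < 4 * R \<and> \<delta> < cmod (G z)}"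
      then have "z \<in> outer \<rho>'" using \<open>\<rho>' \<le> \<rho>\<close> by (simp add: outer_def)
      from wirtinger_on_imp_field_derivative[OF wirtinger_onD(1)[OF G this] b[OF this]]
      show "(\<lambda>z. G z * exp (- 0)) field_differentiable at z within {z. \<rho> < cmod z \<and> cmod z < 4 * R \<and> \<delta> < cmod (G z)}"
        by (simp add: field_differentiable_def) (blast intro: has_field_derivative_at_within)
    qed
  qed auto
  have sub: "outer s \<subseteq> outer t" if "t \<le> s" for s t using that by (auto simp: outer_def)
  have cont: "continuous_on {z. \<rho> \<le> cmod z} G" if "wirtinger_on (outer 1) G a b" "\<rho> \<ge> 2" for G a b \<rho>
    by (rule continuous_on_subset[OF wirtinger_on_continuous[OF that(1)]]) (use that(2) in \<open>auto simp: outer_def\<close>)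
  show ?thesis
  proof (cases "\<exists>z. cmod z > 2 \<and> g z \<noteq> 0")
    case True
    then obtain z2 where z2: "2 < cmod z2" "g z2 \<noteq> 0" by blast
    have le: "cmod (gzb z) \<le> 1 / (2 * \<mu>) * (cmod (f z) * cmod (g z))" if "z \<in> outer 1" for z
    proof -
      have "4 * \<mu> * cmod (gzb z) = cmod (of_real (4 * \<mu>) * gzb z)" using \<mu> by (simp add: norm_mult)
      also have "\<dots> \<le> cmod (cnj (f z) * g z) + cmod (f z * cnj (g z))"
        unfolding eq[OF that] by (rule norm_triangle_ineq)
      also have "\<dots> = 2 * (cmod (f z) * cmod (g z))" by (simp add: norm_mult)
      finally show ?thesis using \<mu> by (simp add: field_simps)
    qed
    obtain C1 where C1: "C1 > 0" "\<And>z. cmod z \<ge> 2 \<Longrightarrow> ennreal (cmod (g z)) \<le> ennreal C1 * ball_mass f z (1/2)"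
      using norm_le_ball_mass_gradient[OF f \<omega> W g le _ K1] \<mu> by auto
    show ?thesis
    proof (rule ball_mass_lower_bound[OF order_refl cont[OF g order_refl] C1(1) _ C A])
      show "0 \<le> 11 * C / (2 * \<mu> * cp_const)" using C \<mu> cp_const_pos by simp
      show "\<exists>w. continuous_on UNIV w \<and> (\<forall>z. cmod z \<le> 4 * R \<longrightarrow> cmod (w z) \<le> 11 * C / (2 * \<mu> * cp_const) * R) \<and>
        (\<lambda>z. g z * exp (- w z)) holomorphic_on {z. 2 < cmod z \<and> cmod z < 4 * R \<and> \<delta> < cmod (g z)}"
        if "R \<ge> 1" "\<delta> > 0" for R \<delta>
        by (rule integrating_factor[OF f g eq \<mu> K2 C that]) blast+
    qed (use C1 z2 in auto)
  next
    case False
    then have g0: "g z = 0" if "z \<in> outer 2" for z using that by (auto simp: outer_def)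
    have W2: "wirtinger_on (outer 2) \<omega> g gb" by (rule wirtinger_on_subset[OF W sub]) simp
    have f2: "wirtinger_on (outer 2) f fz fb" by (rule wirtinger_on_subset[OF f sub]) simp
    have gb0: "gb z = 0" if "z \<in> outer 2" for z using g0[OF that] gb[of z] sub[of 1 2] that by auto
    have \<omega>2: "\<omega> z = 2 * \<i> * fb z" if "z \<in> outer 2" for z using \<omega>[of z] sub[of 1 2] that by auto
    show ?thesis
    proof (cases "\<exists>z. cmod z > 3 \<and> \<omega> z \<noteq> 0")
      case True
      then obtain z2 where z2: "3 < cmod z2" "\<omega> z2 \<noteq> 0" by blast
      have bd: "ennreal (cmod (\<omega> z)) \<le> ennreal (192 / cp_const) * ball_mass f z (1/2)" if "3 \<le> cmod z" for z
        by (rule norm_le_ball_mass_vorticity[OF f2 \<omega>2 W2 gb0 open_outer cball_subset_outer]) (use that in auto)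
      show ?thesis
        by (rule ball_mass_lower_bound[OF _ cont[OF W] _ bd C A order_refl trivial[OF W2 gb0] z2])
           (use cp_const_pos in auto)
    next
      case False
      have f3: "wirtinger_on (outer 3) f fz fb" by (rule wirtinger_on_subset[OF f sub]) simp
      have fb0: "fb z = 0" if "z \<in> outer 3" for z
      proof -
        have "\<omega> z = 0" using False that by (auto simp: outer_def)
        moreover have "\<omega> z = 2 * \<i> * fb z" using \<omega>[of z] sub[of 1 3] that by auto
        ultimately show ?thesis by simp
      qed
      have bd: "ennreal (cmod (f z)) \<le> ennreal (16 / cp_const) * ball_mass f z (1/2)" if "4 \<le> cmod z" for z
        by (rule norm_le_ball_mass_velocity[OF f3 fb0 open_outer cball_subset_outer]) (use that in auto)
      show ?thesis
        by (rule ball_mass_lower_bound[OF _ cont[OF f] _ bd C A order_refl trivial[OF f3 fb0] z1])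
           (use cp_const_pos in auto)
    qed
  qed
qed

section \<open>Kato bounds from integrability\<close>

lemma nn_integral_ball_powr_shift:
  "(\<integral>\<^sup>+u. ennreal (cmod (z - u) powr (- s)) * indicator (ball z r) u \<partial>lborel)
     = (\<integral>\<^sup>+u. ennreal (cmod u powr (- s)) * indicator (ball 0 r) u \<partial>lborel)"
proof -
  have "(\<integral>\<^sup>+u. ennreal (cmod u powr (- s)) * indicator (ball 0 r) u \<partial>lborel)
      = (\<integral>\<^sup>+u. (\<lambda>u. ennreal (cmod u powr (- s)) * indicator (ball 0 r) u) (z - u) \<partial>lborel)"
    by (rule nn_integral_reflect[symmetric], intro borel_measurable_times_ennreal borel_measurable_indicator) auto
  also have "\<dots> = (\<integral>\<^sup>+u. ennreal (cmod (z - u) powr (- s)) * indicator (ball z r) u \<partial>lborel)"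
    by (rule nn_integral_cong) (simp add: indicator_def dist_norm norm_minus_commute)
  finally show ?thesis ..
qed

lemma kato_bounds_of_sup:
  assumes L: "AE u in lborel. u \<in> outer 1 \<longrightarrow> cmod (f u) \<le> L"
  obtains C where "C \<ge> 0" "\<And>r z. r > 0 \<Longrightarrow> kato f r z \<le> ennreal (C * r)"
proof -
  obtain C1 where C1: "C1 \<ge> 0" "\<And>r. r > 0 \<Longrightarrow>
      (\<integral>\<^sup>+u. ennreal (cmod u powr (- 1)) * indicator (ball 0 r) u \<partial>lborel) \<le> ennreal (C1 * r powr (2 - 1))"
    using nn_integral_ball_powr[of 1] by auto
  define L' where "L' = max 0 L"
  have "kato f r z \<le> ennreal (L' * C1 * r)" if r: "r > 0" for r z
  proof -
    have "kato f r z \<le> (\<integral>\<^sup>+u. ennreal L' * (ennreal (cmod (z - u) powr (- 1)) * indicator (ball z r) u) \<partial>lborel)"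
      unfolding kato_def
    proof (rule nn_integral_mono_AE)
      show "AE u in lborel. ennreal (cmod (f u) / cmod (z - u)) * indicator (ball z r \<inter> outer 1) u
        \<le> ennreal L' * (ennreal (cmod (z - u) powr (- 1)) * indicator (ball z r) u)"
        using L
      proof eventually_elim
        case (elim u)
        show ?case
        proof (cases "u \<in> ball z r \<inter> outer 1")
          case True
          then have "cmod (f u) \<le> L'" using elim by (auto simp: L'_def)
          then have "cmod (f u) / cmod (z - u) \<le> L' / cmod (z - u)" by (rule divide_right_mono) simp
          also have "\<dots> = L' * cmod (z - u) powr (- 1)" by (simp add: powr_minus divide_inverse)
          finally show ?thesis using True by (simp add: ennreal_mult[symmetric] L'_def ennreal_leI)
        qed simp
      qed
    qed
    also have "\<dots> = ennreal L' * (\<integral>\<^sup>+u. ennreal (cmod (z - u) powr (- 1)) * indicator (ball z r) u \<partial>lborel)"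
      by (rule nn_integral_cmult, intro borel_measurable_times_ennreal borel_measurable_indicator) auto
    also have "\<dots> \<le> ennreal L' * ennreal (C1 * r powr (2 - 1))"
      unfolding nn_integral_ball_powr_shift by (intro mult_left_mono C1(2) r) simp
    also have "\<dots> = ennreal (L' * C1 * r)" using C1 r by (simp add: L'_def ennreal_mult[symmetric] mult.assoc)
    finally show ?thesis .
  qed
  then show thesis using C1(1) by (intro that[of "L' * C1"]) (auto simp: L'_def)
qed

lemma young_powr:
  fixes x y p s :: real
  assumes "p > 1" "s = p / (p - 1)" "x \<ge> 0" "y \<ge> 0"
  shows "x * y \<le> x powr p + y powr s"
proof -
  have "s > 1" using assms(1) unfolding assms(2) by (simp add: pos_less_divide_eq)
  moreover have "1 / p + 1 / s = 1" using assms(1) unfolding assms(2) by (simp add: add_divide_distrib[symmetric])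
  ultimately have s: "s > 1" "1 / p + 1 / s = 1" by auto
  have "x * y \<le> x powr p / p + y powr s / s"
    using Youngs_inequality[of p s x y] assms s by simp
  also have "\<dots> \<le> x powr p / 1 + y powr s / 1"
    using assms s by (intro add_mono divide_left_mono) auto
  finally show ?thesis by simp
qed

text \<open>Young's inequality with a free scale t, in the role of Hoelder's inequality: the L^p
  part carries t^p, and the kernel part carries t^(-s) with s < 2, so the kernel power is integrable
  near z.\<close>

lemma kato_bound_of_Lp:
  fixes p :: real
  assumes f: "continuous_on (outer 1) f" and p: "p > 2"
    and P: "(\<integral>\<^sup>+u. ennreal (cmod (f u) powr p) * indicator (outer 1) u \<partial>lborel) \<le> ennreal P" "P \<ge> 0"
    and s: "s = p / (p - 1)"
  obtains C where "C \<ge> 0" "\<And>t r z. t > 0 \<Longrightarrow> r > 0 \<Longrightarrow>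
    kato f r z \<le> ennreal (t powr p * P + t powr (- s) * (C * r powr (2 - s)))"
proof -
  have s12: "1 < s" "s < 2" using p by (auto simp: s field_simps)
  obtain C where C: "C \<ge> 0" "\<And>r. r > 0 \<Longrightarrow>
      (\<integral>\<^sup>+u. ennreal (cmod u powr (- s)) * indicator (ball 0 r) u \<partial>lborel) \<le> ennreal (C * r powr (2 - s))"
    using nn_integral_ball_powr[of s] s12 by auto
  have "kato f r z \<le> ennreal (t powr p * P + t powr (- s) * (C * r powr (2 - s)))" if t: "t > 0" and r: "r > 0" for t r z
  proof -
    let ?F = "\<lambda>u. ennreal (cmod (f u) powr p) * indicator (outer 1) u"
    let ?K = "\<lambda>u. ennreal (cmod (z - u) powr (- s)) * indicator (ball z r) u"
    have [measurable]: "(\<lambda>u. indicator (outer 1) u *\<^sub>R f u) \<in> borel_measurable borel"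
      by (rule borel_measurable_continuous_on_indicator) (auto intro: f)
    have eq: "?F = (\<lambda>u. ennreal (cmod (indicator (outer 1) u *\<^sub>R f u) powr p))"
      using p by (auto simp: indicator_def)
    have mF: "?F \<in> borel_measurable lborel" unfolding eq by measurable
    have mK: "?K \<in> borel_measurable lborel"
      by (intro borel_measurable_times_ennreal borel_measurable_indicator) auto
    have "kato f r z \<le> (\<integral>\<^sup>+u. ennreal (t powr p) * ?F u + ennreal (t powr (- s)) * ?K u \<partial>lborel)"
      unfolding kato_def
    proof (rule nn_integral_mono)
      fix u
      show "ennreal (cmod (f u) / cmod (z - u)) * indicator (ball z r \<inter> outer 1) u
        \<le> ennreal (t powr p) * ?F u + ennreal (t powr (- s)) * ?K u"
      proof (cases "u \<in> ball z r \<inter> outer 1")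
        case True
        have "cmod (f u) / cmod (z - u) = (t * cmod (f u)) * inverse (t * cmod (z - u))"
          using t by (simp add: divide_inverse)
        also have "\<dots> \<le> (t * cmod (f u)) powr p + inverse (t * cmod (z - u)) powr s"
          by (rule young_powr[OF _ s]) (use p t in auto)
        also have "inverse (t * cmod (z - u)) powr s = (t * cmod (z - u)) powr (- s)"
          unfolding powr_minus by (rule inverse_powr)
        finally have "cmod (f u) / cmod (z - u) \<le> t powr p * cmod (f u) powr p + t powr (- s) * cmod (z - u) powr (- s)"
          using t by (simp add: powr_mult)
        then show ?thesis using True by (simp add: ennreal_mult[symmetric] ennreal_plus[symmetric] ennreal_leI del: ennreal_plus)
      qed simp
    qed
    also have "\<dots> = ennreal (t powr p) * (\<integral>\<^sup>+u. ?F u \<partial>lborel) + ennreal (t powr (- s)) * (\<integral>\<^sup>+u. ?K u \<partial>lborel)"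
      using mF mK by (subst nn_integral_add) (auto simp: nn_integral_cmult)
    also have "\<dots> \<le> ennreal (t powr p) * ennreal P + ennreal (t powr (- s)) * ennreal (C * r powr (2 - s))"
      unfolding nn_integral_ball_powr_shift by (intro add_mono mult_left_mono P C(2) r) auto
    also have "\<dots> = ennreal (t powr p * P + t powr (- s) * (C * r powr (2 - s)))"
      using P C by (simp add: ennreal_mult[symmetric] ennreal_plus[symmetric] del: ennreal_plus)
    finally show ?thesis .
  qed
  with C(1) show thesis by (rule that)
qed

text \<open>For smallness, t is fixed first to make the L^p part at most \<eta>/2, and then r is
  shrunk for the kernel part. For growth, t = 1 is enough, because s > 1 gives r^(2-s) \<le> r for r
  \<ge> 1.\<close>

lemma kato_bounds_of_Lp:
  fixes p :: real
  assumes f: "continuous_on (outer 1) f" and p: "p > 2"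
    and P: "(\<integral>\<^sup>+u. ennreal (cmod (f u) powr p) * indicator (outer 1) u \<partial>lborel) < \<infinity>"
  shows "\<And>\<eta>. \<eta> > 0 \<Longrightarrow> \<exists>r>0. \<forall>z. kato f r z \<le> ennreal \<eta>"
    and "\<exists>C\<ge>0. \<forall>r\<ge>1. \<forall>z. kato f r z \<le> ennreal (C * r)"
proof -
  define s where "s = p / (p - 1)"
  have s12: "1 < s" "s < 2" using p by (auto simp: s_def field_simps)
  obtain P' where P': "(\<integral>\<^sup>+u. ennreal (cmod (f u) powr p) * indicator (outer 1) u \<partial>lborel) \<le> ennreal P'" "P' \<ge> 0"
    using P by (cases "\<integral>\<^sup>+u. ennreal (cmod (f u) powr p) * indicator (outer 1) u \<partial>lborel") auto
  obtain C where C: "C \<ge> 0" "\<And>t r z. t > 0 \<Longrightarrow> r > 0 \<Longrightarrow>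
    kato f r z \<le> ennreal (t powr p * P' + t powr (- s) * (C * r powr (2 - s)))"
    using kato_bound_of_Lp[OF f p P' s_def] by blast
  show "\<exists>r>0. \<forall>z. kato f r z \<le> ennreal \<eta>" if \<eta>: "\<eta> > 0" for \<eta>
  proof -
    define t where "t = (\<eta> / (2 * (P' + 1))) powr (1 / p)"
    have t: "t > 0" using \<eta> P' by (simp add: t_def)
    have "t powr p = \<eta> / (2 * (P' + 1))" using \<eta> P' p by (simp add: t_def powr_powr)
    then have "t powr p * P' = \<eta> / 2 * (P' / (P' + 1))" by simp
    also have "\<dots> \<le> \<eta> / 2 * 1" using \<eta> P' by (intro mult_left_mono) auto
    finally have 1: "t powr p * P' \<le> \<eta> / 2" by simp
    define c where "c = t powr (- s) * (C + 1)"
    have c: "c > 0" using t C by (simp add: c_def)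
    define r where "r = (\<eta> / (2 * c)) powr (1 / (2 - s))"
    have r: "r > 0" using \<eta> c by (simp add: r_def)
    have r2: "r powr (2 - s) = \<eta> / (2 * c)" using \<eta> c s12 by (simp add: r_def powr_powr)
    have "t powr (- s) * (C * r powr (2 - s)) \<le> c * r powr (2 - s)"
      unfolding c_def using t by (simp add: mult_left_mono algebra_simps)
    also have "\<dots> = \<eta> / 2" unfolding r2 using c by simp
    finally have "t powr p * P' + t powr (- s) * (C * r powr (2 - s)) \<le> \<eta>" using 1 by simp
    then have "kato f r z \<le> ennreal \<eta>" for z
      using C(2)[OF t r, of z] by (meson ennreal_leI order_trans)
    then show ?thesis using r by blast
  qed
  show "\<exists>C\<ge>0. \<forall>r\<ge>1. \<forall>z. kato f r z \<le> ennreal (C * r)"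
  proof (intro exI[of _ "P' + C"] conjI allI impI)
    show "0 \<le> P' + C" using P' C by simp
    fix r z assume r: "(r::real) \<ge> 1"
    have "kato f r z \<le> ennreal (1 powr p * P' + 1 powr (- s) * (C * r powr (2 - s)))"
      by (rule C(2)) (use r in auto)
    also have "1 powr p * P' + 1 powr (- s) * (C * r powr (2 - s)) \<le> P' * r + C * r powr 1"
    proof -
      have "r powr (2 - s) \<le> r powr 1" using r s12 by (intro powr_mono) auto
      then have "C * r powr (2 - s) \<le> C * r powr 1" using C by (intro mult_left_mono)
      moreover have "P' \<le> P' * r" using P' r by (simp add: mult_le_cancel_left1)
      ultimately show ?thesis by simp
    qed
    also have "\<dots> = (P' + C) * r" using r by (simp add: algebra_simps)
    finally show "kato f r z \<le> ennreal ((P' + C) * r)" by (simp add: ennreal_leI)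
  qed
qed

section \<open>The Navier--Stokes equations in complex notation\<close>

definition vec_of_complex :: "complex \<Rightarrow> real^2" where
  "vec_of_complex z = Re z *\<^sub>R axis 1 1 + Im z *\<^sub>R axis 2 1"

text \<open>
  Not the inverse of \<open>vec_of_complex\<close>: the velocity enters as \<open>v\<^sub>1 - \<i> v\<^sub>2\<close>.
\<close>

definition complex_of_vec :: "real^2 \<Rightarrow> complex" where
  "complex_of_vec u = Complex (u $ 1) (- (u $ 2))"

lemma vec_of_complex_nth [simp]: "vec_of_complex z $ 1 = Re z" "vec_of_complex z $ 2 = Im z"
  by (simp_all add: vec_of_complex_def axis_def)

lemma norm_vec2: "norm (u :: real^2) = sqrt ((u $ 1)\<^sup>2 + (u $ 2)\<^sup>2)"
  by (simp add: norm_vec_def L2_set_def UNIV_2)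

lemma norm_vec_of_complex [simp]: "norm (vec_of_complex z) = cmod z"
  by (simp add: norm_vec2 cmod_def)

lemma norm_complex_of_vec [simp]: "cmod (complex_of_vec u) = norm u"
  by (simp add: norm_vec2 cmod_def complex_of_vec_def)

lemma vec_of_complex_diff: "vec_of_complex (z - w) = vec_of_complex z - vec_of_complex w"
  by (simp add: vec_eq_iff forall_2)

lemma surj_vec_of_complex: "\<exists>z. x = vec_of_complex z"
  by (rule exI[of _ "Complex (x $ 1) (x $ 2)"]) (simp add: vec_eq_iff forall_2)

lemma bounded_linear_vec_of_complex: "bounded_linear vec_of_complex"
  unfolding vec_of_complex_def
  by (intro bounded_linear_add bounded_linear_compose[OF bounded_linear_scaleR_left] bounded_linear_Re bounded_linear_Im)

lemma bounded_linear_complex_of_vec: "bounded_linear complex_of_vec"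
proof -
  have "complex_of_vec = (\<lambda>u. of_real (u $ 1) - \<i> * of_real (u $ 2))"
    by (simp add: fun_eq_iff complex_of_vec_def complex_eq_iff)
  moreover have "bounded_linear (\<lambda>u::real^2. complex_of_real (u $ 1) - \<i> * of_real (u $ 2))"
    by (intro bounded_linear_sub bounded_linear_compose[OF bounded_linear_mult_right]
         bounded_linear_compose[OF bounded_linear_of_real] bounded_linear_vec_nth)
  ultimately show ?thesis by simp
qed

lemma continuous_on_vec_of_complex: "continuous_on S vec_of_complex"
  by (rule linear_continuous_on[OF bounded_linear_vec_of_complex])

lemma measurable_vec_of_complex [measurable]: "vec_of_complex \<in> borel_measurable borel"
  by (rule borel_measurable_continuous_onI[OF continuous_on_vec_of_complex])

text \<open>Lebesgue measure is determined by its values on boxes, and the preimage of a box is a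
  box with the same side lengths.\<close>

lemma lborel_vec_of_complex: "distr lborel borel vec_of_complex = lborel"
proof (rule lborel_eqI[symmetric])
  fix l u :: "real^2"
  assume le: "\<And>b. b \<in> Basis \<Longrightarrow> l \<bullet> b \<le> u \<bullet> b"
  have B: "(Basis :: (real^2) set) = {axis 1 1, axis 2 1}"
    unfolding Basis_vec_def UNIV_2 by auto
  have le12: "l $ 1 \<le> u $ 1" "l $ 2 \<le> u $ 2"
    using le[of "axis 1 1"] le[of "axis 2 1"] by (auto simp: B inner_axis)
  have pre: "vec_of_complex -` box l u = box (Complex (l $ 1) (l $ 2)) (Complex (u $ 1) (u $ 2))"
    by (auto simp: box_def B Basis_complex_def inner_axis inner_complex_def)
  have "emeasure (distr lborel borel vec_of_complex) (box l u) = emeasure lborel (vec_of_complex -` box l u)"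
    by (subst emeasure_distr) auto
  also have "\<dots> = (\<Prod>b\<in>Basis. (Complex (u $ 1) (u $ 2) - Complex (l $ 1) (l $ 2)) \<bullet> b)"
    unfolding pre using le12 by (intro emeasure_lborel_box) (auto simp: Basis_complex_def inner_complex_def)
  also have "(\<Prod>b\<in>Basis. (Complex (u $ 1) (u $ 2) - Complex (l $ 1) (l $ 2)) \<bullet> b) = (\<Prod>b\<in>Basis. (u - l) \<bullet> b)"
    unfolding B Basis_complex_def by (simp add: inner_axis axis_eq_axis inner_complex_def complex_eq_iff)
  finally show "emeasure (distr lborel borel vec_of_complex) (box l u) = (\<Prod>b\<in>Basis. (u - l) \<bullet> b)" .
qed simp

lemma nn_integral_vec_of_complex:
  assumes "F \<in> borel_measurable borel"
  shows "(\<integral>\<^sup>+x. F x \<partial>lborel) = (\<integral>\<^sup>+z. F (vec_of_complex z) \<partial>lborel)"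
  using nn_integral_distr[of vec_of_complex lborel borel F] assms
  by (simp add: lborel_vec_of_complex)

lemma exterior_domain_iff: "x \<in> exterior_domain \<longleftrightarrow> 1 \<le> norm x"
  by (auto simp: exterior_domain_def)

lemma vec_of_complex_exterior: "z \<in> outer 1 \<Longrightarrow> vec_of_complex z \<in> exterior_domain"
  by (simp add: outer_def exterior_domain_iff)

lemma at_within_exterior_domain: "1 < norm x \<Longrightarrow> at x within exterior_domain = at x"
proof (rule at_within_interior)
  assume "1 < norm x"
  moreover have "open {x :: real^2. 1 < norm x}" by (intro open_Collect_less continuous_intros)
  ultimately show "x \<in> interior exterior_domain"
    by (intro interiorI[of "{x. 1 < norm x}"]) (auto simp: exterior_domain_iff)
qed

lemma smooth_on_partial_deriv: "smooth_on S u \<Longrightarrow> smooth_on S (partial_deriv S i u)"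
  unfolding smooth_on_def partial_deriv_def[abs_def]
proof
  fix k
  assume "\<forall>k. Ck_on k S u"
  then have "Ck_on (Suc k) S u" by blast
  then show "Ck_on k S (\<lambda>x. frechet_derivative u (at x within S) (axis i 1))" by simp
qed

lemma smooth_on_continuous: "smooth_on S u \<Longrightarrow> continuous_on S u"
  unfolding smooth_on_def by (metis Ck_on.simps(1))

lemma smooth_on_has_derivative:
  fixes u :: "real^2 \<Rightarrow> 'b::real_normed_vector"
  assumes "smooth_on S u" "x \<in> S"
  shows "(u has_derivative (\<lambda>h. h $ 1 *\<^sub>R partial_deriv S 1 u x + h $ 2 *\<^sub>R partial_deriv S 2 u x)) (at x within S)"
proof -
  have "Ck_on (Suc 0) S u" using assms(1) unfolding smooth_on_def by blast
  then have d: "(u has_derivative frechet_derivative u (at x within S)) (at x within S)"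
    using assms(2) by (simp add: differentiable_on_def frechet_derivative_works)
  then have lin: "linear (frechet_derivative u (at x within S))"
    by (rule has_derivative_linear)
  have "frechet_derivative u (at x within S) h = h $ 1 *\<^sub>R partial_deriv S 1 u x + h $ 2 *\<^sub>R partial_deriv S 2 u x" for h
  proof -
    have "h = h $ 1 *\<^sub>R axis 1 1 + h $ 2 *\<^sub>R axis 2 1" by (simp add: vec_eq_iff forall_2 axis_def)
    then show ?thesis unfolding partial_deriv_def
      by (metis (no_types) linear_add[OF lin] linear_scale[OF lin])
  qed
  then show ?thesis using d by (metis (no_types, lifting) ext)
qed

text \<open>L is \<open>complex_of_vec\<close> for the velocity and its derivatives, and
  \<open>complex_of_real\<close> for the pressure.\<close>

definition pull :: "('a \<Rightarrow> complex) \<Rightarrow> (real^2 \<Rightarrow> 'a) \<Rightarrow> complex \<Rightarrow> complex" where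
  "pull L u z = L (u (vec_of_complex z))"

text \<open>On the open set \<open>outer 1\<close> derivatives within \<open>exterior_domain\<close>
  are ordinary ones, so the Wirtinger derivatives are the usual halves of d1 - \<i> d2 and d1 + \<i>
  d2.\<close>

lemma wirtinger_on_pull:
  fixes L :: "'a::real_normed_vector \<Rightarrow> complex"
  assumes L: "bounded_linear L" and u: "smooth_on exterior_domain u"
  defines "d \<equiv> \<lambda>i. pull L (partial_deriv exterior_domain i u)"
  shows "wirtinger_on (outer 1) (pull L u) (\<lambda>z. 1/2 * (d 1 z - \<i> * d 2 z)) (\<lambda>z. 1/2 * (d 1 z + \<i> * d 2 z))"
proof (rule wirtinger_onI)
  interpret bounded_linear L by (rule L)
  fix z assume z: "z \<in> outer 1"
  then have z1: "1 < norm (vec_of_complex z)" by (simp add: outer_def)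
  let ?x = "vec_of_complex z"
  have "(u has_derivative (\<lambda>h. h $ 1 *\<^sub>R partial_deriv exterior_domain 1 u ?x + h $ 2 *\<^sub>R partial_deriv exterior_domain 2 u ?x)) (at ?x)"
    using smooth_on_has_derivative[OF u vec_of_complex_exterior[OF z]] unfolding at_within_exterior_domain[OF z1] .
  from has_derivative_compose[OF bounded_linear_imp_has_derivative[OF bounded_linear_vec_of_complex] this]
  have "((\<lambda>z. u (vec_of_complex z)) has_derivative
    (\<lambda>h. Re h *\<^sub>R partial_deriv exterior_domain 1 u ?x + Im h *\<^sub>R partial_deriv exterior_domain 2 u ?x)) (at z)"
    by simp
  from has_derivative_compose[OF this bounded_linear_imp_has_derivative[OF L]]
  have "(pull L u has_derivative (\<lambda>h. Re h *\<^sub>R d 1 z + Im h *\<^sub>R d 2 z)) (at z)"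
    by (simp add: pull_def[abs_def] d_def add scaleR)
  moreover have "Re h *\<^sub>R d 1 z + Im h *\<^sub>R d 2 z = 1/2 * (d 1 z - \<i> * d 2 z) * h + 1/2 * (d 1 z + \<i> * d 2 z) * cnj h" for h
    by (simp add: complex_eq_iff field_simps)
  ultimately show "(pull L u has_derivative (\<lambda>h. 1/2 * (d 1 z - \<i> * d 2 z) * h + 1/2 * (d 1 z + \<i> * d 2 z) * cnj h)) (at z)"
    by simp
next
  have c: "continuous_on (outer 1) (d i)" for i
  proof -
    have "continuous_on exterior_domain (partial_deriv exterior_domain i u)"
      by (rule smooth_on_continuous[OF smooth_on_partial_deriv[OF u]])
    then have "continuous_on (outer 1) (\<lambda>z. partial_deriv exterior_domain i u (vec_of_complex z))"
      by (rule continuous_on_compose2[OF _ continuous_on_vec_of_complex]) (use vec_of_complex_exterior in blast)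
    from continuous_on_compose2[OF linear_continuous_on[OF L, of UNIV] this]
    show ?thesis by (simp add: d_def pull_def[abs_def])
  qed
  show "continuous_on (outer 1) (\<lambda>z. 1/2 * (d 1 z - \<i> * d 2 z))" "continuous_on (outer 1) (\<lambda>z. 1/2 * (d 1 z + \<i> * d 2 z))"
    by (intro continuous_intros c)+
qed

text \<open>Eliminates the pressure and supplies the differential hypotheses of
  \<open>ball_mass_lower_bound_exterior\<close>.\<close>

lemma navier_stokes_wirtinger:
  assumes NS: "smooth_steady_NS_solution \<mu> exterior_domain v q"
  defines "f \<equiv> pull complex_of_vec v"
  obtains fz fb \<omega> g gb gz gzb where
    "wirtinger_on (outer 1) f fz fb" "\<And>z. z \<in> outer 1 \<Longrightarrow> \<omega> z = 2 * \<i> * fb z"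
    "wirtinger_on (outer 1) \<omega> g gb" "\<And>z. z \<in> outer 1 \<Longrightarrow> gb z = cnj (g z)"
    "wirtinger_on (outer 1) g gz gzb"
    "\<And>z. z \<in> outer 1 \<Longrightarrow> of_real (4 * \<mu>) * gzb z = cnj (f z) * g z + f z * cnj (g z)"
proof -
  let ?S = "exterior_domain"
  let ?L = complex_of_vec
  note L = bounded_linear_complex_of_vec
  interpret L: bounded_linear ?L by (rule L)
  have v: "smooth_on ?S v" and q: "smooth_on ?S q"
    and eq: "\<And>x. x \<in> ?S \<Longrightarrow> - (\<mu> *\<^sub>R laplacian ?S v x) + convection ?S v x + gradient ?S q x = 0"
    and div: "\<And>x. x \<in> ?S \<Longrightarrow> divergence ?S v x = 0"
    using NS unfolding smooth_steady_NS_solution_def by auto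
  define V where "V i = partial_deriv ?S i v" for i
  define W where "W i j = partial_deriv ?S j (V i)" for i j
  have sV: "smooth_on ?S (V i)" for i unfolding V_def by (rule smooth_on_partial_deriv[OF v])
  have sW: "smooth_on ?S (W i j)" for i j unfolding W_def by (rule smooth_on_partial_deriv[OF sV])
  define P where "P i = pull ?L (V i)" for i
  define PP where "PP i j = pull ?L (W i j)" for i j
  define fz where "fz z = 1/2 * (P 1 z - \<i> * P 2 z)" for z
  define fb where "fb z = 1/2 * (P 1 z + \<i> * P 2 z)" for z
  have wf: "wirtinger_on (outer 1) f fz fb"
    using wirtinger_on_pull[OF L v] by (simp add: f_def fz_def[abs_def] fb_def[abs_def] P_def V_def)
  have wP: "wirtinger_on (outer 1) (P i) (\<lambda>z. 1/2 * (PP i 1 z - \<i> * PP i 2 z)) (\<lambda>z. 1/2 * (PP i 1 z + \<i> * PP i 2 z))" for i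
    using wirtinger_on_pull[OF L sV[of i]] by (simp add: P_def PP_def W_def)
  have wfz: "wirtinger_on (outer 1) fz
     (\<lambda>z. 1/2 * (1/2 * (PP 1 1 z - \<i> * PP 1 2 z) - \<i> * (1/2 * (PP 2 1 z - \<i> * PP 2 2 z))))
     (\<lambda>z. 1/2 * (1/2 * (PP 1 1 z + \<i> * PP 1 2 z) - \<i> * (1/2 * (PP 2 1 z + \<i> * PP 2 2 z))))"
    unfolding fz_def[abs_def] by (intro wirtinger_on_cmult wirtinger_on_diff wP)
  have wfb: "wirtinger_on (outer 1) fb
     (\<lambda>z. 1/2 * (1/2 * (PP 1 1 z - \<i> * PP 1 2 z) + \<i> * (1/2 * (PP 2 1 z - \<i> * PP 2 2 z))))
     (\<lambda>z. 1/2 * (1/2 * (PP 1 1 z + \<i> * PP 1 2 z) + \<i> * (1/2 * (PP 2 1 z + \<i> * PP 2 2 z))))"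
    unfolding fb_def[abs_def] by (intro wirtinger_on_cmult wirtinger_on_add wP)
  have PP: "PP 1 2 z = PP 2 1 z" if z: "z \<in> outer 1" for z
  proof -
    have "1/2 * (1/2 * (PP 1 1 z + \<i> * PP 1 2 z) - \<i> * (1/2 * (PP 2 1 z + \<i> * PP 2 2 z)))
       = 1/2 * (1/2 * (PP 1 1 z - \<i> * PP 1 2 z) + \<i> * (1/2 * (PP 2 1 z - \<i> * PP 2 2 z)))"
      by (rule wirtinger_mixed_symmetric[OF wf wfz wfb open_outer z])
    then have "\<i> * (PP 1 2 z - PP 2 1 z) = 0" by (simp add: algebra_simps)
    then show ?thesis by simp
  qed
  define \<omega> where "\<omega> z = 2 * \<i> * fb z" for z
  \<comment> \<open>2 \<i> times the mixed Wirtinger derivative of f, which is a quarter of its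
    Laplacian; \<open>PP\<close> makes the cross terms cancel.\<close>
  define g where "g z = \<i> / 2 * (PP 1 1 z + PP 2 2 z)" for z
  define gb where "gb z = 2 * \<i> * (1/2 * (1/2 * (PP 1 1 z + \<i> * PP 1 2 z) + \<i> * (1/2 * (PP 2 1 z + \<i> * PP 2 2 z))))" for z
  have w\<omega>: "wirtinger_on (outer 1) \<omega> g gb"
    unfolding \<omega>_def[abs_def]
    by (rule wirtinger_on_transform[OF wirtinger_on_cmult[OF wfb, of "2 * \<i>"] open_outer])
       (simp_all add: g_def gb_def PP algebra_simps)
  have div': "V 1 x $ 1 + V 2 x $ 2 = 0" if x: "x \<in> ?S" for x
  proof -
    have "partial_deriv ?S i (\<lambda>y. v y $ i) x = V i x $ i" for i
    proof -
      have "((\<lambda>y. v y $ i) has_derivative (\<lambda>h. (h $ 1 *\<^sub>R partial_deriv ?S 1 v x + h $ 2 *\<^sub>R partial_deriv ?S 2 v x) $ i)) (at x within ?S)"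
        by (rule has_derivative_compose[OF smooth_on_has_derivative[OF v x] bounded_linear_imp_has_derivative[OF bounded_linear_vec_nth]])
      from frechet_derivative_exterior_domain[OF x this]
      show ?thesis using exhaust_2[of i] by (auto simp: partial_deriv_def[of _ _ "\<lambda>y. v y $ _"] V_def axis_def)
    qed
    then show ?thesis using div[OF x] by (simp add: divergence_def UNIV_2)
  qed
  \<comment> \<open>The real part of \<open>fb\<close> is half of the divergence, so
    \<open>fb\<close> is imaginary and \<omega> is the usual scalar vorticity.\<close>
  have \<omega>real: "cnj (\<omega> z) = \<omega> z" if z: "z \<in> outer 1" for z
    using div'[OF vec_of_complex_exterior[OF z]]
    by (simp add: \<omega>_def fb_def P_def pull_def complex_of_vec_def complex_eq_iff)
  have gb: "gb z = cnj (g z)" if z: "z \<in> outer 1" for z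
  proof -
    have "wirtinger_on (outer 1) \<omega> (\<lambda>z. cnj (gb z)) (\<lambda>z. cnj (g z))"
      by (rule wirtinger_on_transform[OF wirtinger_on_cnj[OF w\<omega>] open_outer]) (use \<omega>real in auto)
    from wirtinger_on_unique(2)[OF w\<omega> this z] show ?thesis .
  qed
  have wPP: "\<exists>a b. wirtinger_on (outer 1) (PP i j) a b" for i j
    using wirtinger_on_pull[OF L sW[of i j]] by (auto simp: PP_def)
  have "\<exists>gz gzb. wirtinger_on (outer 1) g gz gzb"
    unfolding g_def[abs_def] by (intro wirtinger_ex_mult wirtinger_ex_add wPP exI) (rule wirtinger_on_const)
  then obtain gz gzb where wg: "wirtinger_on (outer 1) g gz gzb" by blast
  note wcg = wirtinger_on_cnj[OF wg]
  \<comment> \<open>\<open>gzb\<close> is a mixed second derivative of the real function \<omega>;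
    taken in the other order it is the conjugate of itself.\<close>
  have gzb_real: "gzb z = cnj (gzb z)" if z: "z \<in> outer 1" for z
  proof -
    have "wirtinger_on (outer 1) gb (\<lambda>z. cnj (gzb z)) (\<lambda>z. cnj (gz z))"
      by (rule wirtinger_on_transform[OF wcg open_outer]) (use gb in auto)
    from wirtinger_mixed_symmetric[OF w\<omega> wg this open_outer z] show ?thesis .
  qed
  define Q where "Q = pull complex_of_real q"
  define Qz where "Qz z = 1/2 * (pull complex_of_real (partial_deriv ?S 1 q) z - \<i> * pull complex_of_real (partial_deriv ?S 2 q) z)" for z
  have "\<exists>Qb. wirtinger_on (outer 1) Q Qz Qb"
    using wirtinger_on_pull[OF bounded_linear_of_real q] by (auto simp: Q_def Qz_def[abs_def])
  then obtain Qb where wQ: "wirtinger_on (outer 1) Q Qz Qb" by blast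
  \<comment> \<open>The image of the momentum equation under \<open>complex_of_vec\<close>. The sign
    convention turns the pressure gradient into 2 \<open>Qz\<close>; as a direction of
    differentiation the velocity is the complex number cnj f, which gives the two convection
    terms.\<close>
  have momentum: "2 * \<i> * of_real \<mu> * g z + cnj (f z) * fz z + f z * fb z + 2 * Qz z = 0" if z: "z \<in> outer 1" for z
  proof -
    let ?x = "vec_of_complex z"
    have "?L (- (\<mu> *\<^sub>R laplacian ?S v ?x) + convection ?S v ?x + gradient ?S q ?x) = ?L 0"
      using eq[OF vec_of_complex_exterior[OF z]] by simp
    then have "- (\<mu> *\<^sub>R ?L (laplacian ?S v ?x)) + ?L (convection ?S v ?x) + ?L (gradient ?S q ?x) = 0"
      by (simp add: L.add L.diff L.neg L.scaleR L.zero)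
    moreover have "?L (laplacian ?S v ?x) = - 2 * \<i> * g z"
      by (simp add: laplacian_def UNIV_2 L.add g_def PP_def pull_def W_def V_def algebra_simps)
    moreover have "?L (convection ?S v ?x) = cnj (f z) * fz z + f z * fb z"
      by (simp add: convection_def UNIV_2 L.add L.scaleR f_def fz_def fb_def P_def pull_def V_def[symmetric])
         (simp add: complex_of_vec_def complex_eq_iff field_simps)
    moreover have "?L (gradient ?S q ?x) = 2 * Qz z"
      by (simp add: gradient_def Qz_def pull_def complex_of_vec_def complex_eq_iff)
    ultimately show ?thesis by (simp add: scaleR_conv_of_real algebra_simps)
  qed
  \<comment> \<open>The momentum equation gives the first derivative of the real function \<open>|v|\<^sup>2 + 2 q\<close>; that its
    mixed second derivative is real is the curl of the momentum equation.\<close>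
  define H where "H z = f z * cnj (f z) + 2 * Q z" for z
  define B where "B z = \<i> * (gb z * f z + \<omega> z * fb z) - 2 * \<i> * of_real \<mu> * gzb z" for z
  have wH: "wirtinger_on (outer 1) H (\<lambda>z. fz z * cnj (f z) + f z * cnj (fb z) + 2 * Qz z)
      (\<lambda>z. fb z * cnj (f z) + f z * cnj (fz z) + 2 * Qb z)"
    unfolding H_def[abs_def]
    by (intro wirtinger_on_add wirtinger_on_mult[OF wf wirtinger_on_cnj[OF wf]] wirtinger_on_cmult wQ)
  have Hz: "fz z * cnj (f z) + f z * cnj (fb z) + 2 * Qz z = \<i> * (\<omega> z * f z) - 2 * \<i> * of_real \<mu> * g z"
    if z: "z \<in> outer 1" for z
  proof -
    have "cnj (fb z) = - fb z" using \<omega>real[OF z] by (simp add: \<omega>_def complex_eq_iff)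
    moreover have "\<i> * (\<omega> z * f z) = (\<i> * \<i>) * (2 * fb z * f z)"
      unfolding \<omega>_def by (simp only: mult_ac)
    ultimately have "f z * cnj (fb z) = \<i> * (\<omega> z * f z) + f z * fb z" by (simp add: mult.commute)
    then show ?thesis using momentum[OF z] by (simp add: algebra_simps)
  qed
  have wHz: "\<exists>A. wirtinger_on (outer 1) (\<lambda>z. fz z * cnj (f z) + f z * cnj (fb z) + 2 * Qz z) A B"
  proof
    show "wirtinger_on (outer 1) (\<lambda>z. fz z * cnj (f z) + f z * cnj (fb z) + 2 * Qz z)
      (\<lambda>z. \<i> * (g z * f z + \<omega> z * fz z) - 2 * \<i> * of_real \<mu> * gz z) B"
      by (rule wirtinger_on_transform[OF wirtinger_on_diff[OF wirtinger_on_cmult[OF wirtinger_on_mult[OF w\<omega> wf], of \<i>]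
             wirtinger_on_cmult[OF wg, of "2 * \<i> * of_real \<mu>"]] open_outer])
         (use Hz in \<open>auto simp: B_def\<close>)
  qed
  then obtain A where wA: "wirtinger_on (outer 1) (\<lambda>z. fz z * cnj (f z) + f z * cnj (fb z) + 2 * Qz z) A B" by blast
  have Breal: "B z = cnj (B z)" if z: "z \<in> outer 1" for z
  proof -
    have wHc: "wirtinger_on (outer 1) H (\<lambda>z. cnj (fb z * cnj (f z) + f z * cnj (fz z) + 2 * Qb z))
        (\<lambda>z. cnj (fz z * cnj (f z) + f z * cnj (fb z) + 2 * Qz z))"
      by (rule wirtinger_on_transform[OF wirtinger_on_cnj[OF wH] open_outer])
         (auto simp: H_def Q_def pull_def)
    have "wirtinger_on (outer 1) (\<lambda>z. cnj (fb z * cnj (f z) + f z * cnj (fz z) + 2 * Qb z)) A B"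
      by (rule wirtinger_on_transform[OF wA open_outer wirtinger_on_unique(1)[OF wH wHc]]) simp_all
    from wirtinger_mixed_symmetric[OF wHc this wirtinger_on_cnj[OF wA] open_outer z] show ?thesis .
  qed
  have vorticity: "of_real (4 * \<mu>) * gzb z = cnj (f z) * g z + f z * cnj (g z)" if z: "z \<in> outer 1" for z
  proof -
    have "\<i> * (\<omega> z * fb z) = \<omega> z * \<omega> z / 2" by (simp add: \<omega>_def)
    then have B1: "B z = \<i> * cnj (g z) * f z + \<omega> z * \<omega> z / 2 - 2 * \<i> * of_real \<mu> * gzb z"
      by (simp add: B_def gb[OF z] algebra_simps)
    then have B2: "cnj (B z) = - \<i> * g z * cnj (f z) + \<omega> z * \<omega> z / 2 + 2 * \<i> * of_real \<mu> * gzb z"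
      using \<omega>real[OF z] gzb_real[OF z] by simp
    have "(\<i> * cnj (g z) * f z + \<omega> z * \<omega> z / 2 - 2 * \<i> * of_real \<mu> * gzb z)
        - (- \<i> * g z * cnj (f z) + \<omega> z * \<omega> z / 2 + 2 * \<i> * of_real \<mu> * gzb z) = 0"
      unfolding B1[symmetric] B2[symmetric] using Breal[OF z] by simp
    then have "\<i> * (of_real (4 * \<mu>) * gzb z) = \<i> * (cnj (f z) * g z + f z * cnj (g z))"
      by (simp add: algebra_simps)
    then show ?thesis by simp
  qed
  show thesis
    by (rule that[OF wf _ w\<omega> gb wg vorticity]) (auto simp: \<omega>_def)
qed

section \<open>Transfer between the plane of \<open>v\<close> and the complex plane, and the final
  estimate\<close>

lemma borel_measurable_norm_indicator:
  fixes v :: "real^2 \<Rightarrow> real^2"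
  assumes "continuous_on A v" "A \<in> sets borel"
  shows "(\<lambda>x. norm (indicator A x *\<^sub>R v x)) \<in> borel_measurable borel"
  using borel_measurable_continuous_on_indicator[OF assms(2,1)] by measurable

lemma closed_exterior_domain: "closed exterior_domain"
  unfolding exterior_domain_def by (simp add: closed_Diff)

text \<open>For p = \<infinity> a single bound linear in r gives both claims. For finite p,
  \<open>Lp_norm\<close> sends an infinite integral to \<infinity>, so finiteness of the norm is
  finiteness of the integral.\<close>

lemma kato_bounds_of_Lp_norm:
  assumes v: "smooth_on exterior_domain v" and p: "2 < p" and fin: "Lp_norm p exterior_domain v < \<infinity>"
  defines "f \<equiv> pull complex_of_vec v"
  shows "\<And>\<eta>. \<eta> > 0 \<Longrightarrow> \<exists>r>0. \<forall>z. kato f r z \<le> ennreal \<eta>"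
    and "\<exists>C\<ge>0. \<forall>r\<ge>1. \<forall>z. kato f r z \<le> ennreal (C * r)"
proof -
  have vc: "continuous_on exterior_domain v" by (rule smooth_on_continuous[OF v])
  have fc: "continuous_on (outer 1) f"
    unfolding f_def by (rule wirtinger_on_continuous[OF wirtinger_on_pull[OF bounded_linear_complex_of_vec v]])
  have nf: "cmod (f z) = norm (v (vec_of_complex z))" for z by (simp add: f_def pull_def)
  have meas: "exterior_domain \<in> sets borel" by (rule borel_closed[OF closed_exterior_domain])
  have "(\<forall>\<eta>>0. \<exists>r>0. \<forall>z. kato f r z \<le> ennreal \<eta>) \<and> (\<exists>C\<ge>0. \<forall>r\<ge>1. \<forall>z. kato f r z \<le> ennreal (C * r))"
  proof (cases "p = \<infinity>")
    case True
    define e where "e = esssup (restrict_space lborel exterior_domain) (\<lambda>x. ennreal (norm (v x)))"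
    have "e < \<infinity>" using fin True by (simp add: Lp_norm_def e_def)
    then obtain L where L: "e = ennreal L" "L \<ge> 0" by (cases e) auto
    have "AE x in restrict_space lborel exterior_domain. ennreal (norm (v x)) \<le> e"
      unfolding e_def by (rule esssup_AE)
    then have "AE x in lborel. x \<in> exterior_domain \<longrightarrow> ennreal (norm (v x)) \<le> e"
      using meas by (subst (asm) AE_restrict_space_iff) auto
    then have "AE x in distr lborel borel vec_of_complex. x \<in> exterior_domain \<longrightarrow> ennreal (norm (v x)) \<le> e"
      unfolding lborel_vec_of_complex .
    from AE_distrD[OF _ this] have "AE z in lborel. vec_of_complex z \<in> exterior_domain \<longrightarrow> ennreal (cmod (f z)) \<le> e"
      by (simp add: nf)
    then have "AE z in lborel. z \<in> outer 1 \<longrightarrow> cmod (f z) \<le> L"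
      by (rule eventually_mono) (use L vec_of_complex_exterior in auto)
    then obtain C where C: "C \<ge> 0" "\<And>r z. r > 0 \<Longrightarrow> kato f r z \<le> ennreal (C * r)"
      using kato_bounds_of_sup by blast
    show ?thesis
    proof (intro conjI allI impI)
      fix \<eta> :: real assume \<eta>: "\<eta> > 0"
      have "C * (\<eta> / (C + 1)) = \<eta> * (C / (C + 1))" by simp
      also have "\<dots> \<le> \<eta> * 1" using \<eta> C by (intro mult_left_mono) auto
      finally have "kato f (\<eta> / (C + 1)) z \<le> ennreal \<eta>" for z
        using C(2)[of "\<eta> / (C + 1)" z] \<eta> C(1) by (auto intro: order_trans ennreal_leI)
      then show "\<exists>r>0. \<forall>z. kato f r z \<le> ennreal \<eta>"
        using \<eta> C by (intro exI[of _ "\<eta> / (C + 1)"]) auto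
    next
      show "\<exists>C\<ge>0. \<forall>r\<ge>1. \<forall>z. kato f r z \<le> ennreal (C * r)"
        using C by (intro exI[of _ C]) auto
    qed
  next
    case False
    then obtain r where r: "p = ennreal r" "r \<ge> 0" by (cases p) auto
    then have r2: "r > 2" using p by (metis ennreal_less_iff ennreal_numeral zero_le_numeral)
    define I where "I = (\<integral>\<^sup>+x\<in>exterior_domain. ennreal (norm (v x) powr r) \<partial>lborel)"
    have "I < \<infinity>"
      using fin False r by (auto simp: Lp_norm_def I_def Let_def less_top split: if_splits)
    have eq: "(\<lambda>x. ennreal (norm (v x) powr r) * indicator exterior_domain x)
        = (\<lambda>x. ennreal (norm (indicator exterior_domain x *\<^sub>R v x) powr r))"
      using r2 by (auto simp: indicator_def)
    have "(\<lambda>x. ennreal (norm (v x) powr r) * indicator exterior_domain x) \<in> borel_measurable borel"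
      unfolding eq using borel_measurable_norm_indicator[OF vc meas] by measurable
    from nn_integral_vec_of_complex[OF this]
    have I: "I = (\<integral>\<^sup>+z. ennreal (cmod (f z) powr r) * indicator exterior_domain (vec_of_complex z) \<partial>lborel)"
      by (simp add: I_def nf)
    have "(\<integral>\<^sup>+z. ennreal (cmod (f z) powr r) * indicator (outer 1) z \<partial>lborel) \<le> I"
      unfolding I by (intro nn_integral_mono mult_left_mono) (auto simp: indicator_def vec_of_complex_exterior)
    then have "(\<integral>\<^sup>+z. ennreal (cmod (f z) powr r) * indicator (outer 1) z \<partial>lborel) < \<infinity>"
      using \<open>I < \<infinity>\<close> by (rule le_less_trans)
    from kato_bounds_of_Lp[OF fc r2 this] show ?thesis by blast
  qed
  then show "\<And>\<eta>. \<eta> > 0 \<Longrightarrow> \<exists>r>0. \<forall>z. kato f r z \<le> ennreal \<eta>"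
    and "\<exists>C\<ge>0. \<forall>r\<ge>1. \<forall>z. kato f r z \<le> ennreal (C * r)" by blast+
qed

text \<open>Cauchy--Schwarz on a disc of area pi, obtained by integrating |v| \<le> |v|^2 / (2 l) +
  l / 2.\<close>

lemma local_energy_ge:
  assumes v: "continuous_on exterior_domain v" and z0: "cmod z0 \<ge> 2" and E: "E > 0"
    and le: "ennreal E \<le> ball_mass (pull complex_of_vec v) z0 1"
  shows "E\<^sup>2 / pi \<le> (LINT y:ball (vec_of_complex z0) 1|lborel. (norm (v y))\<^sup>2)"
proof -
  let ?x = "vec_of_complex z0"
  let ?B = "ball ?x 1"
  let ?I = "LINT y:?B|lborel. (norm (v y))\<^sup>2"
  have sub: "cball ?x 1 \<subseteq> exterior_domain"
  proof
    fix y assume "y \<in> cball ?x 1"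
    then show "y \<in> exterior_domain"
      using norm_triangle_sub[of ?x y] z0 by (simp add: exterior_domain_iff dist_norm)
  qed
  have vB: "continuous_on ?B v" and vC: "continuous_on (cball ?x 1) v"
    using continuous_on_subset[OF v] sub ball_subset_cball by blast+
  have "set_integrable lborel (cball ?x 1) (\<lambda>y. (norm (v y))\<^sup>2)"
    unfolding set_integrable_def by (intro borel_integrable_compact continuous_intros vC) auto
  then have i: "set_integrable lborel ?B (\<lambda>y. (norm (v y))\<^sup>2)"
    by (rule set_integrable_subset) auto
  have i1: "integrable lborel (indicat_real ?B)"
    using emeasure_lborel_ball_finite[of ?x 1] by (intro integrable_real_indicator) auto
  have B: "integral\<^sup>L lborel (indicat_real ?B) = pi"
    by (simp add: content_ball unit_ball_vol_2)
  \<comment> \<open>The choice of l that makes the integrated inequality E \<le> I / (2 l) + l pi /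
    2 yield exactly I \<ge> E^2 / pi.\<close>
  define l where "l = E / pi"
  have l: "l > 0" using E by (simp add: l_def)
  define h where "h y = 1 / (2 * l) * (indicat_real ?B y *\<^sub>R (norm (v y))\<^sup>2) + l / 2 * indicat_real ?B y" for y
  have ih: "integrable lborel h"
    unfolding h_def using i i1 by (intro Bochner_Integration.integrable_add integrable_mult_right) (auto simp: set_integrable_def)
  have "ennreal E \<le> (\<integral>\<^sup>+z. ennreal (norm (v (vec_of_complex z))) * indicator ?B (vec_of_complex z) \<partial>lborel)"
    using le by (simp add: ball_mass_def pull_def indicator_def dist_norm vec_of_complex_diff[symmetric])
  also have "\<dots> = (\<integral>\<^sup>+y. ennreal (norm (v y)) * indicator ?B y \<partial>lborel)"
  proof (rule nn_integral_vec_of_complex[symmetric])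
    have eq: "(\<lambda>y. ennreal (norm (v y)) * indicator ?B y) = (\<lambda>y. ennreal (norm (indicator ?B y *\<^sub>R v y)))"
      by (auto simp: indicator_def)
    show "(\<lambda>y. ennreal (norm (v y)) * indicator ?B y) \<in> borel_measurable borel"
      unfolding eq using borel_measurable_norm_indicator[OF vB] by measurable
  qed
  also have "\<dots> \<le> (\<integral>\<^sup>+y. ennreal (h y) \<partial>lborel)"
  proof (rule nn_integral_mono)
    fix y
    have "0 \<le> (norm (v y) - l)\<^sup>2" by simp
    then have "2 * l * norm (v y) \<le> (norm (v y))\<^sup>2 + l\<^sup>2" by (simp add: power2_eq_square algebra_simps)
    then have "norm (v y) \<le> 1 / (2 * l) * (norm (v y))\<^sup>2 + l / 2"
      using l by (simp add: field_simps power2_eq_square)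
    then show "ennreal (norm (v y)) * indicator ?B y \<le> ennreal (h y)"
      by (auto simp: h_def indicator_def ennreal_leI)
  qed
  also have "\<dots> = ennreal (integral\<^sup>L lborel h)"
    using l by (intro nn_integral_eq_integral ih) (auto simp: h_def)
  also have "integral\<^sup>L lborel h = 1 / (2 * l) * ?I + l / 2 * pi"
    unfolding h_def set_lebesgue_integral_def B[symmetric]
    using i i1 by (subst Bochner_Integration.integral_add) (auto simp: set_integrable_def)
  finally have "E \<le> 1 / (2 * l) * ?I + l / 2 * pi"
    using l by (subst (asm) ennreal_le_iff) (auto simp: set_lebesgue_integral_def)
  then show ?thesis using E by (simp add: l_def field_simps power2_eq_square)
qed

theorem theorem1p1:
  fixes \<mu> :: real and p :: ennreal
    and v :: "real^2 \<Rightarrow> real^2" and q :: "real^2 \<Rightarrow> real"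
  assumes "\<mu> > 0"
    and "2 < p"
    and "smooth_steady_NS_solution \<mu> exterior_domain v q"
    and "Lp_norm p exterior_domain v < \<infinity>"
    and "min_local_energy v 10 \<noteq> 0"
  shows "\<exists>C0>0. \<forall>\<^sub>F R in at_top. min_local_energy v R \<ge> exp (- (C0 * R * (ln R)\<^sup>2))"
proof -
  let ?f = "pull complex_of_vec v"
  have v: "smooth_on exterior_domain v" using assms(3) by (simp add: smooth_steady_NS_solution_def)
  have nonempty: "sphere (0::real^2) R \<noteq> {}" if "R \<ge> 0" for R
  proof -
    have "vec_of_complex (of_real R) \<in> sphere 0 R" using that by simp
    then show ?thesis by blast
  qed
  \<comment> \<open>If v vanished beyond radius 4, every unit ball centred at distance 10 would
    carry no energy and the infimum would be 0.\<close>
  have "\<exists>z. cmod z > 4 \<and> ?f z \<noteq> 0"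
  proof (rule ccontr)
    assume contr: "\<not> (\<exists>z. cmod z > 4 \<and> ?f z \<noteq> 0)"
    have v0: "v x = 0" if "norm x > 4" for x
    proof -
      obtain z where z: "x = vec_of_complex z" using surj_vec_of_complex by blast
      then have "?f z = 0" using that contr by auto
      then have "norm (v x) = 0" unfolding norm_complex_of_vec[symmetric] z by (simp add: pull_def)
      then show ?thesis by simp
    qed
    have "(LINT y:ball x0 1|lborel. (norm (v y))\<^sup>2) = 0" if "x0 \<in> sphere 0 10" for x0
    proof -
      have zero: "indicat_real (ball x0 1) y *\<^sub>R (norm (v y))\<^sup>2 = 0" for y
      proof (cases "y \<in> ball x0 1")
        case True
        then have "norm y > 4" using that norm_triangle_sub[of x0 y] by (simp add: dist_norm)
        then show ?thesis by (simp add: v0)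
      qed simp
      show ?thesis unfolding set_lebesgue_integral_def zero by simp
    qed
    then have "min_local_energy v 10 = (INF x0\<in>sphere (0::real^2) 10. 0)"
      unfolding min_local_energy_def by (intro INF_cong) auto
    also have "\<dots> = 0" using nonempty[of 10] by (intro cINF_const) auto
    finally show False using assms(5) by simp
  qed
  then obtain z1 where z1: "cmod z1 > 4" "?f z1 \<noteq> 0" by blast
  obtain C where C: "C \<ge> 0" "\<And>r z. r \<ge> 1 \<Longrightarrow> kato ?f r z \<le> ennreal (C * r)"
    using kato_bounds_of_Lp_norm(2)[OF v assms(2,4)] by blast
  obtain fz fb \<omega> g gb gz gzb where ns:
    "wirtinger_on (outer 1) ?f fz fb" "\<And>z. z \<in> outer 1 \<Longrightarrow> \<omega> z = 2 * \<i> * fb z"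
    "wirtinger_on (outer 1) \<omega> g gb" "\<And>z. z \<in> outer 1 \<Longrightarrow> gb z = cnj (g z)"
    "wirtinger_on (outer 1) g gz gzb"
    "\<And>z. z \<in> outer 1 \<Longrightarrow> of_real (4 * \<mu>) * gzb z = cnj (?f z) * g z + ?f z * cnj (g z)"
    using navier_stokes_wirtinger[OF assms(3)] by blast
  obtain B R0 where B: "B > 0" "\<And>R z0. R \<ge> R0 \<Longrightarrow> cmod z0 = R \<Longrightarrow>
      ennreal (exp (- (B * R * (ln R)\<^sup>2))) \<le> ball_mass ?f z0 1"
    using ball_mass_lower_bound_exterior[OF ns assms(1) kato_bounds_of_Lp_norm(1)[OF v assms(2,4)] C(2,1) z1] by blast
  show ?thesis
  \<comment> \<open>The doubling comes from squaring the mass; the extra 2 absorbs 1 / pi, because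
    pi \<le> exp 2 and R (ln R)^2 \<ge> 1 for R \<ge> 3.\<close>
  proof (intro exI[of _ "2 * B + 2"] conjI)
    show "2 * B + 2 > 0" using B by simp
    have "exp (- ((2 * B + 2) * R * (ln R)\<^sup>2)) \<le> min_local_energy v R" if R: "R \<ge> max R0 3" for R
      unfolding min_local_energy_def
    proof (rule cINF_greatest[OF nonempty])
      show "0 \<le> R" using R by simp
      fix x0 :: "real^2" assume "x0 \<in> sphere 0 R"
      then obtain z0 where z0: "x0 = vec_of_complex z0" "cmod z0 = R"
        using surj_vec_of_complex[of x0] by auto
      define t where "t = R * (ln R)\<^sup>2"
      have "exp 1 \<le> R" using exp_le R by linarith
      then have "1 \<le> ln R" using R by (simp add: ln_ge_iff)
      then have "1 * 1 \<le> t" unfolding t_def using R by (intro mult_mono one_le_power) auto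
      have "pi \<le> exp 2"
      proof -
        have "2 \<le> exp (1::real)" using exp_ge_add_one_self[of 1] by simp
        then have "2 * 2 \<le> exp 1 * exp (1::real)" by (intro mult_mono) auto
        then show ?thesis using pi_less_4 by (simp add: exp_add[symmetric])
      qed
      also have "\<dots> \<le> exp (2 * t)" using \<open>1 * 1 \<le> t\<close> by simp
      finally have "exp (- (2 * B * t)) / exp (2 * t) \<le> exp (- (2 * B * t)) / pi"
        by (intro divide_left_mono) auto
      moreover have "exp (- (2 * B * t)) / exp (2 * t) = exp (- ((2 * B + 2) * t))"
        unfolding exp_diff[symmetric] by (simp add: algebra_simps)
      moreover have "exp (- (2 * B * t)) = (exp (- (B * t)))\<^sup>2"
        by (simp add: power2_eq_square exp_add[symmetric])
      ultimately have "exp (- ((2 * B + 2) * t)) \<le> (exp (- (B * t)))\<^sup>2 / pi" by simp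
      also have "\<dots> \<le> (LINT y:ball x0 1|lborel. (norm (v y))\<^sup>2)"
        unfolding z0(1)
        by (rule local_energy_ge[OF smooth_on_continuous[OF v]]) (use B(2)[of R z0] R z0 in \<open>auto simp: t_def mult.assoc\<close>)
      finally show "exp (- ((2 * B + 2) * R * (ln R)\<^sup>2)) \<le> (LINT y:ball x0 1|lborel. (norm (v y))\<^sup>2)"
        by (simp add: t_def mult.assoc)
    qed
    then show "\<forall>\<^sub>F R in at_top. exp (- ((2 * B + 2) * R * (ln R)\<^sup>2)) \<le> min_local_energy v R"
      by (rule eventually_at_top_linorderI)
  qed
qed

end
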